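(* Consider the $n$-simplex $\alpha_n$ (rank $n$), the $n$-dimensional cross-polytope $\beta_n$ (rank $n$), the $24$-cell (rank $4$), the icosahedron (rank $3$) and the $600$-cell (rank $4$). For every permutation $\delta$ and every flag, the length of the corresponding generalized zigzag in each of these polytopes equals the corresponding Coxeter number, namely $$h(\mathsf A_n)=n+1,\quad h(\mathsf B_n)=2n,\quad h(\mathsf F_4)=12,\quad h(\mathsf H_3)=10,\quad h(\mathsf H_4)=30,$$ respectively.
   Context: An abstract polytope of rank $n$ has $k$-faces for $k=-1,0,\dots,n$, with unique $(-1)$-face and $n$-face; here the polytopes are the face lattices of the named regular convex polytopes. As simplicial complexes of boundary faces: $\alpha_n$ has vertex set $\{1,\dots,n+1\}$ and its faces are all proper subsets of it; $\beta_n$ has vertex set $\{\pm1,\dots,\pm n\}$ and its faces are the subsets containing no pair $\{i,-i\}$. A flag $F$ is a maximal chain $X_0<X_1<\dots<X_{n-1}$ with $X_i$ an $i$-face (the $(-1)$-face and $n$-face are disregarded). For $i\in\{0,\dots,n-1\}$, $\sigma_i(F)$ is the unique flag differing from $F$ precisely in its $i$-face. For a permutation $\delta$ of $\{0,\dots,n-1\}$ put $T_\delta=\sigma_{\delta(n-1)}\cdots\sigma_{\delta(1)}\sigma_{\delta(0)}$. The sequence $\{T_\delta^i(F)\}_{i\in\mathbb N}$ is a generalized zigzag, and its length is the smallest $l>0$ such that $T_\delta^l(F)=F$. The Coxeter number of a finite Coxeter system $(W,S)$ with $S=\{s_1,\dots,s_n\}$ is the order $h$ of an element $s_{\delta(1)}\cdots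 s_{\delta(n)}$, $\delta$ any permutation of $\{1,\dots,n\}$ (it does not depend on $\delta$). *)

theory Defs
  imports
    "HOL-Analysis.Analysis"
    "HOL-Combinatorics.Permutations"
    "HOL-Algebra.Multiplicative_Group"
begin

section \<open>Flags and generalized zigzags\<close>

text \<open>
  A polytope of rank \<open>n\<close> is given by the map \<open>P\<close> sending \<open>k < n\<close> to the set of its \<open>k\<close>-faces;
  the order is inclusion.  The unique faces of rank \<open>-1\<close> and \<open>n\<close>, which play no role in flags,
  are left out.
\<close>

text \<open>
  A flag is the list \<open>[X\<^sub>0, \<dots>, X\<^sub>n\<^sub>-\<^sub>1]\<close> of its members by increasing rank.  A chain of proper faces
  in a polytope is maximal iff it has a member of each rank.
\<close>

definition flags :: "nat \<Rightarrow> (nat \<Rightarrow> 'a set set) \<Rightarrow> 'a set list set" where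
  "flags n P = {X. length X = n \<and> (\<forall>i<n. X ! i \<in> P i) \<and> (\<forall>i. Suc i < n \<longrightarrow> X ! i \<subset> X ! Suc i)}"

definition flag_swap :: "nat \<Rightarrow> (nat \<Rightarrow> 'a set set) \<Rightarrow> nat \<Rightarrow> 'a set list \<Rightarrow> 'a set list" where
  "flag_swap n P i X =
     (THE Y. Y \<in> flags n P \<and> Y ! i \<noteq> X ! i \<and> (\<forall>j<n. j \<noteq> i \<longrightarrow> Y ! j = X ! j))"

text \<open>\<open>\<sigma>\<^bsub>\<delta>(0)\<^esub>\<close> is applied first.\<close>

definition zigzag_map :: "nat \<Rightarrow> (nat \<Rightarrow> 'a set set) \<Rightarrow> (nat \<Rightarrow> nat) \<Rightarrow> 'a set list \<Rightarrow> 'a set list" where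
  "zigzag_map n P \<delta> X = fold (\<lambda>k. flag_swap n P (\<delta> k)) [0..<n] X"

definition zigzag_length :: "nat \<Rightarrow> (nat \<Rightarrow> 'a set set) \<Rightarrow> (nat \<Rightarrow> nat) \<Rightarrow> 'a set list \<Rightarrow> nat" where
  "zigzag_length n P \<delta> X = (LEAST l. 0 < l \<and> (zigzag_map n P \<delta> ^^ l) X = X)"

section \<open>The polytopes\<close>

definition simplicial_faces :: "'a set set \<Rightarrow> nat \<Rightarrow> 'a set set" where
  "simplicial_faces K k = {X \<in> K. card X = Suc k}"

definition simplex_faces :: "nat \<Rightarrow> nat \<Rightarrow> nat set set" where
  "simplex_faces n = simplicial_faces {X. X \<subset> {1..n+1}}"

definition cross_polytope_faces :: "nat \<Rightarrow> nat \<Rightarrow> int set set" where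
  "cross_polytope_faces n =
     simplicial_faces {X. X \<subseteq> {- int n..int n} - {0} \<and> (\<forall>i. \<not> (i \<in> X \<and> - i \<in> X))}"

definition convex_polytope_faces :: "'a::euclidean_space set \<Rightarrow> nat \<Rightarrow> 'a set set" where
  "convex_polytope_faces P k = {F. F face_of P \<and> aff_dim F = int k}"

definition cell24 :: "(real^4) set" where
  "cell24 = convex hull {x. (\<forall>i. x $ i \<in> {-1, 0, 1}) \<and> card {i. x $ i \<noteq> 0} = 2}"

definition golden_ratio :: real where
  "golden_ratio = (1 + sqrt 5) / 2"

text \<open>All cyclic permutations of \<open>(0, \<plusminus>1, \<plusminus>\<phi>)\<close>.\<close>

definition icosahedron :: "(real^3) set" where
  "icosahedron = convex hull
     (\<Union>s\<in>{-1, 1}. \<Union>t\<in>{-1, 1}.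
        {vector [0, s, t * golden_ratio],
         vector [t * golden_ratio, 0, s],
         vector [s, t * golden_ratio, 0]})"

text \<open>
  The 8 permutations of \<open>(\<plusminus>1, 0, 0, 0)\<close>, the 16 points \<open>(\<plusminus>1/2, \<plusminus>1/2, \<plusminus>1/2, \<plusminus>1/2)\<close>, and the 96 even
  permutations of \<open>(\<plusminus>\<phi>/2, \<plusminus>1/2, \<plusminus>1/(2\<phi>), 0)\<close>.
\<close>

definition cell600 :: "(real^4) set" where
  "cell600 = convex hull
     ({s *\<^sub>R axis i 1 | s i. s \<in> {-1, 1}}
      \<union> {x. \<forall>i. x $ i \<in> {-1/2, 1/2}}
      \<union> {\<chi> i. s i * (vector [golden_ratio/2, 1/2, 1/(2 * golden_ratio), 0] :: real^4) $ p i | s p.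
           (\<forall>i. s i \<in> {-1, 1}) \<and> p permutes UNIV \<and> evenperm p})"

section \<open>Coxeter groups and Coxeter numbers\<close>

text \<open>
  The group with generators \<open>s\<^sub>0, \<dots>, s\<^sub>n\<^sub>-\<^sub>1\<close> and relations \<open>(s\<^sub>i s\<^sub>j)\<^bsup>m i j\<^esup> = 1\<close>.  As \<open>m i i = 1\<close>, the
  generators are involutions, so no formal inverses are needed and elements are classes of
  positive words.
\<close>

inductive coxeter_eq :: "nat \<Rightarrow> (nat \<Rightarrow> nat \<Rightarrow> nat) \<Rightarrow> nat list \<Rightarrow> nat list \<Rightarrow> bool"
  for n :: nat and m :: "nat \<Rightarrow> nat \<Rightarrow> nat" where
  refl: "u \<in> lists {..<n} \<Longrightarrow> coxeter_eq n m u u"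
| sym: "coxeter_eq n m u v \<Longrightarrow> coxeter_eq n m v u"
| trans: "coxeter_eq n m u v \<Longrightarrow> coxeter_eq n m v w \<Longrightarrow> coxeter_eq n m u w"
| relator: "u \<in> lists {..<n} \<Longrightarrow> v \<in> lists {..<n} \<Longrightarrow> i < n \<Longrightarrow> j < n \<Longrightarrow>
    coxeter_eq n m (u @ concat (replicate (m i j) [i, j]) @ v) (u @ v)"

definition coxeter_class :: "nat \<Rightarrow> (nat \<Rightarrow> nat \<Rightarrow> nat) \<Rightarrow> nat list \<Rightarrow> nat list set" where
  "coxeter_class n m u = {v. coxeter_eq n m u v}"

definition coxeter_group :: "nat \<Rightarrow> (nat \<Rightarrow> nat \<Rightarrow> nat) \<Rightarrow> nat list set monoid" where
  "coxeter_group n m =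
     \<lparr>carrier = coxeter_class n m ` lists {..<n},
      mult = (\<lambda>A B. \<Union>u\<in>A. \<Union>v\<in>B. coxeter_class n m (u @ v)),
      one = coxeter_class n m []\<rparr>"

definition coxeter_element :: "nat \<Rightarrow> (nat \<Rightarrow> nat \<Rightarrow> nat) \<Rightarrow> (nat \<Rightarrow> nat) \<Rightarrow> nat list set" where
  "coxeter_element n m \<delta> =
     foldr (\<lambda>k x. coxeter_class n m [\<delta> k] \<otimes>\<^bsub>coxeter_group n m\<^esub> x) [0..<n] \<one>\<^bsub>coxeter_group n m\<^esub>"

text \<open>The definite description is meaningful only if the order does not depend on \<open>\<delta>\<close>.\<close>

definition coxeter_number :: "nat \<Rightarrow> (nat \<Rightarrow> nat \<Rightarrow> nat) \<Rightarrow> nat" where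
  "coxeter_number n m =
     (THE h. \<forall>\<delta>. \<delta> permutes {..<n} \<longrightarrow> group.ord (coxeter_group n m) (coxeter_element n m \<delta>) = h)"

text \<open>
  Linear Coxeter diagrams: \<open>e i\<close> is the label of the edge between nodes \<open>i\<close> and \<open>i + 1\<close>.
  For \<open>n = 1\<close>, types \<open>A\<^sub>n\<close> and \<open>B\<^sub>n\<close> coincide.
\<close>

definition linear_coxeter_matrix :: "(nat \<Rightarrow> nat) \<Rightarrow> nat \<Rightarrow> nat \<Rightarrow> nat" where
  "linear_coxeter_matrix e i j =
     (if i = j then 1 else if j = Suc i then e i else if i = Suc j then e j else 2)"

definition matrix_A :: "nat \<Rightarrow> nat \<Rightarrow> nat" where
  "matrix_A = linear_coxeter_matrix (\<lambda>_. 3)"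

definition matrix_B :: "nat \<Rightarrow> nat \<Rightarrow> nat \<Rightarrow> nat" where
  "matrix_B n = linear_coxeter_matrix (\<lambda>i. if i + 2 = n then 4 else 3)"

definition matrix_F :: "nat \<Rightarrow> nat \<Rightarrow> nat" where
  "matrix_F = linear_coxeter_matrix (\<lambda>i. if i = 1 then 4 else 3)"

definition matrix_H :: "nat \<Rightarrow> nat \<Rightarrow> nat" where
  "matrix_H = linear_coxeter_matrix (\<lambda>i. if i = 0 then 5 else 3)"

lemma coxeter_eq_lists: "coxeter_eq n m u v \<Longrightarrow> u \<in> lists {..<n} \<and> v \<in> lists {..<n}"
proof (induction rule: coxeter_eq.induct)
  case (relator u v i j)
  have "concat (replicate k [i, j]) \<in> lists {..<n}" for k
    using relator by (induction k) auto
  with relator show ?case by auto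
qed auto

lemma coxeter_eq_context:
  assumes "coxeter_eq n m u v" "a \<in> lists {..<n}" "b \<in> lists {..<n}"
  shows "coxeter_eq n m (a @ u @ b) (a @ v @ b)"
  using assms
proof (induction rule: coxeter_eq.induct)
  case (relator u v i j)
  then show ?case
    using coxeter_eq.relator[of "a @ u" n "v @ b" i j m] by simp
next
  case (refl u)
  then show ?case by (intro coxeter_eq.refl) simp
next
  case (sym u v)
  then show ?case by (blast intro: coxeter_eq.sym)
next
  case (trans u v w)
  then show ?case by (blast intro: coxeter_eq.trans)
qed

lemma coxeter_eq_append:
  assumes "coxeter_eq n m u u'" "coxeter_eq n m v v'"
  shows "coxeter_eq n m (u @ v) (u' @ v')"
  using coxeter_eq_context[OF assms(1), of "[]" v] coxeter_eq_context[OF assms(2), of u' "[]"]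
    coxeter_eq_lists[OF assms(1)] coxeter_eq_lists[OF assms(2)]
  by (auto intro: coxeter_eq.trans)

lemma coxeter_class_eq_iff:
  "u \<in> lists {..<n} \<Longrightarrow> coxeter_class n m u = coxeter_class n m v \<longleftrightarrow> coxeter_eq n m u v"
  unfolding coxeter_class_def set_eq_iff mem_Collect_eq
  by (meson coxeter_eq.refl coxeter_eq.sym coxeter_eq.trans)

lemma coxeter_group_mult:
  assumes "u \<in> lists {..<n}" "v \<in> lists {..<n}"
  shows "coxeter_class n m u \<otimes>\<^bsub>coxeter_group n m\<^esub> coxeter_class n m v = coxeter_class n m (u @ v)"
proof -
  have "coxeter_class n m (a @ b) = coxeter_class n m (u @ v)"
    if "a \<in> coxeter_class n m u" "b \<in> coxeter_class n m v" for a b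
    using that coxeter_eq_append[of n m u a v b] assms
    by (auto simp: coxeter_class_def[of n m u] coxeter_class_def[of n m v]
        coxeter_class_eq_iff[of "u @ v" n m "a @ b", symmetric])
  moreover have "u \<in> coxeter_class n m u" "v \<in> coxeter_class n m v"
    using assms by (auto simp: coxeter_class_def intro!: coxeter_eq.refl)
  ultimately have "(\<Union>a\<in>coxeter_class n m u. \<Union>b\<in>coxeter_class n m v. coxeter_class n m (a @ b))
      = coxeter_class n m (u @ v)"
    by blast
  then show ?thesis
    by (simp add: coxeter_group_def)
qed

lemma coxeter_group_is_group:
  assumes "\<And>i. i < n \<Longrightarrow> m i i = 1"
  shows "group (coxeter_group n m)"
proof -
  have inv: "coxeter_eq n m (rev u @ u) []" if "u \<in> lists {..<n}" for u
    using that
  proof (induction u)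
    case (Cons i u)
    then have u: "u \<in> lists {..<n}" and i: "i < n" by auto
    have "coxeter_eq n m (rev u @ [i, i] @ u) (rev u @ u)"
      using coxeter_eq.relator[of "rev u" n u i i m] u i assms by (simp add: in_lists_conv_set)
    then have "coxeter_eq n m (rev u @ [i, i] @ u) []"
      using Cons.IH by (rule coxeter_eq.trans)
    then show ?case by simp
  qed (auto intro: coxeter_eq.refl)
  have carrier: "carrier (coxeter_group n m) = coxeter_class n m ` lists {..<n}"
    and one: "\<one>\<^bsub>coxeter_group n m\<^esub> = coxeter_class n m []"
    by (auto simp: coxeter_group_def)
  show ?thesis
  proof (rule groupI)
    fix x assume "x \<in> carrier (coxeter_group n m)"
    then obtain u where u: "u \<in> lists {..<n}" "x = coxeter_class n m u"
      by (auto simp: carrier)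
    then have r: "rev u \<in> lists {..<n}" by (auto simp: in_lists_conv_set)
    have "coxeter_class n m (rev u) \<otimes>\<^bsub>coxeter_group n m\<^esub> x = \<one>\<^bsub>coxeter_group n m\<^esub>"
      using u r inv[OF u(1)] by (simp add: coxeter_group_mult one coxeter_class_eq_iff)
    with r show "\<exists>y\<in>carrier (coxeter_group n m). y \<otimes>\<^bsub>coxeter_group n m\<^esub> x = \<one>\<^bsub>coxeter_group n m\<^esub>"
      by (auto simp: carrier)
  next
    fix x y assume "x \<in> carrier (coxeter_group n m)" "y \<in> carrier (coxeter_group n m)"
    then obtain u v where u: "u \<in> lists {..<n}" "x = coxeter_class n m u"
        and v: "v \<in> lists {..<n}" "y = coxeter_class n m v"
      unfolding carrier by (elim imageE)
    then have "u @ v \<in> lists {..<n}" by simp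
    then show "x \<otimes>\<^bsub>coxeter_group n m\<^esub> y \<in> carrier (coxeter_group n m)"
      unfolding u(2) v(2) coxeter_group_mult[OF u(1) v(1)] carrier by (rule imageI)
  next
    fix x y z assume "x \<in> carrier (coxeter_group n m)" "y \<in> carrier (coxeter_group n m)"
      "z \<in> carrier (coxeter_group n m)"
    then obtain u v w where u: "u \<in> lists {..<n}" "x = coxeter_class n m u"
        and v: "v \<in> lists {..<n}" "y = coxeter_class n m v"
        and w: "w \<in> lists {..<n}" "z = coxeter_class n m w"
      unfolding carrier by (elim imageE)
    then have "u @ v \<in> lists {..<n}" "v @ w \<in> lists {..<n}" by simp_all
    then show "x \<otimes>\<^bsub>coxeter_group n m\<^esub> y \<otimes>\<^bsub>coxeter_group n m\<^esub> z
        = x \<otimes>\<^bsub>coxeter_group n m\<^esub> (y \<otimes>\<^bsub>coxeter_group n m\<^esub> z)"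
      unfolding u(2) v(2) w(2) by (simp only: coxeter_group_mult u v w append_assoc)
  next
    show "\<one>\<^bsub>coxeter_group n m\<^esub> \<in> carrier (coxeter_group n m)"
      unfolding one carrier by (rule imageI) simp
  next
    fix x assume "x \<in> carrier (coxeter_group n m)"
    then obtain u where "u \<in> lists {..<n}" "x = coxeter_class n m u"
      by (auto simp: carrier)
    then show "\<one>\<^bsub>coxeter_group n m\<^esub> \<otimes>\<^bsub>coxeter_group n m\<^esub> x = x"
      using coxeter_group_mult[of "[]" n u m] by (simp add: one)
  qed
qed

end

theory Submission
  imports Defs
begin

text \<open>
  In a regular polytope every flag is \<open>g F\<^sub>0\<close> for a symmetry \<open>g\<close> and a fixed base flag \<open>F\<^sub>0\<close>, and the
  flag adjacent to \<open>F\<^sub>0\<close> at rank \<open>i\<close> is \<open>r\<^sub>i F\<^sub>0\<close> for a generating reflection \<open>r\<^sub>i\<close>.  Since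
  \<open>\<sigma>\<^sub>i (g F\<^sub>0) = g r\<^sub>i F\<^sub>0\<close>, the length of a zigzag is the order of the product of the \<open>r\<^sub>i\<close> in the order
  given by \<open>\<delta>\<close>.  All these products are conjugate because the diagram is a path, so one word has to
  be considered per type: the relation \<open>c\<^sup>h = 1\<close> in the Coxeter group bounds its order from above, and
  the action on the polytope bounds it from below.

  The faces of the 24-cell, the icosahedron and the 600-cell are found by Wythoff's construction.  A functional exposing
  a facet can be moved into the fundamental chamber, where it is maximal exactly on the orbit of the
  base vertex under a standard parabolic subgroup.
\<close>

section \<open>Words in Coxeter generators\<close>

text \<open>The Coxeter number lives in a group given by generators and relations, the zigzag in a
  concrete symmetry group. They are compared through a homomorphism: c^h = 1 is derived from the
  presentation and descends to every representation, while one representation in which no smaller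
  power of one Coxeter element is the identity settles the order on both sides at once. For types A
  and B the relation has a derivation uniform in \<open>n\<close>; for the exceptional types it is a
  finite computation with rewriting rules, each of which only has to be valid in the group.

  The geometric obstacle is that the faces of the three convex hulls are faces of a convex set, with
  no combinatorial list to start from. Only the vertices are listed: simple roots and dual vectors
  with coordinates in Z[phi] reduce the hypotheses on a polytope to a finite check on its vertices,
  and the faces follow by general arguments. For the icosahedron {3,5} and the 600-cell {3,3,5} the
  label 5 belongs to the two highest ranks, whereas \<open>matrix_H\<close> begins with it; this is
  why ranks and nodes are related by a permutation.\<close>

declare coxeter_eq.trans [trans]

lemma coxeter_eq_refl_iff [simp]: "coxeter_eq n m u u \<longleftrightarrow> u \<in> lists {..<n}"
  using coxeter_eq_lists coxeter_eq.refl by blast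

abbreviation word_power :: "'b list \<Rightarrow> nat \<Rightarrow> 'b list" where
  "word_power w k \<equiv> concat (replicate k w)"

lemma word_power_in_lists: "w \<in> lists A \<Longrightarrow> word_power w k \<in> lists A"
  by (induction k) auto

lemma word_power_Suc2: "word_power w (Suc k) = word_power w k @ w"
  by (induction k) auto

lemma coxeter_eq_word_power:
  assumes "coxeter_eq n m u v"
  shows "coxeter_eq n m (word_power u k) (word_power v k)"
proof (induction k)
  case (Suc k)
  then show ?case using coxeter_eq_append[OF assms] by simp
qed simp

lemma rev_in_lists: "u \<in> lists A \<Longrightarrow> rev u \<in> lists A"
  by (simp add: in_lists_conv_set)

text \<open>Conjugacy takes the form \<open>g u = v g\<close> because words carry no formal
  inverses.\<close>

definition coxeter_conj :: "nat \<Rightarrow> (nat \<Rightarrow> nat \<Rightarrow> nat) \<Rightarrow> nat list \<Rightarrow> nat list \<Rightarrow> bool" where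
  "coxeter_conj n m u v \<longleftrightarrow> (\<exists>g\<in>lists {..<n}. coxeter_eq n m (g @ u) (v @ g))"

locale coxeter_diagram =
  fixes n :: nat and m :: "nat \<Rightarrow> nat \<Rightarrow> nat"
  assumes diag: "i < n \<Longrightarrow> m i i = 1"
begin

abbreviation eq (infix "\<doteq>" 50) where "u \<doteq> v \<equiv> coxeter_eq n m u v"

lemma cong:
  assumes "u \<doteq> v" "a \<in> lists {..<n}" "b \<in> lists {..<n}"
  shows "a @ u @ b \<doteq> a @ v @ b"
  by (intro coxeter_eq_context assms)

text \<open>Each generator is its own inverse, so reversal inverts a word; the product collapses
  from the middle outwards.\<close>

lemma rev_self: "u \<in> lists {..<n} \<Longrightarrow> rev u @ u \<doteq> []"
proof (induction u)
  case (Cons i u)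
  then have u: "u \<in> lists {..<n}" "rev u \<in> lists {..<n}" and i: "i < n"
    by (simp_all add: rev_in_lists)
  have "rev (i # u) @ i # u \<doteq> rev u @ u"
    using coxeter_eq.relator[OF u(2,1) i i, of m] diag[OF i] by simp
  also have "\<dots> \<doteq> []" by (rule Cons.IH[OF u(1)])
  finally show ?case .
qed simp

lemma self_rev: "u \<in> lists {..<n} \<Longrightarrow> u @ rev u \<doteq> []"
  using rev_self[of "rev u"] by (simp add: rev_in_lists)

lemma eq_of_append_rev:
  assumes "v \<in> lists {..<n}" "u @ rev v \<doteq> []"
  shows "u \<doteq> v"
proof -
  have u: "u \<in> lists {..<n}" using coxeter_eq_lists[OF assms(2)] by simp
  have "u \<doteq> u @ rev v @ v"
    using coxeter_eq_append[OF coxeter_eq.refl[OF u] coxeter_eq.sym[OF rev_self[OF assms(1)]]] by simp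
  also have "u @ rev v @ v \<doteq> v"
    using coxeter_eq_append[OF assms(2) coxeter_eq.refl[OF assms(1)]] by simp
  finally show ?thesis .
qed

text \<open>Half of the relator is moved to the other side. As reversal inverts, the second half
  turns into \<open>v\<close>, which gives the braid form of the relation.\<close>

lemma braid:
  assumes "i < n" "j < n" "v \<in> lists {..<n}" "word_power [i, j] (m i j) = u @ rev v"
  shows "u \<doteq> v"
proof (rule eq_of_append_rev[OF assms(3)])
  show "u @ rev v \<doteq> []"
    using coxeter_eq.relator[of "[]" n "[]" i j m] assms(1,2) by (simp add: assms(4))
qed

lemma commute_letter:
  assumes "i < n" "u \<in> lists {..<n}" "\<And>j. j \<in> set u \<Longrightarrow> m i j = 2"
  shows "[i] @ u \<doteq> u @ [i]"
  using assms(2,3)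
proof (induction u rule: list.induct)
  case (Cons j u)
  then have u: "u \<in> lists {..<n}" "j < n" by auto
  have "[i, j] \<doteq> [j, i]"
    using assms(1) u Cons.prems(2)[of j] by (intro braid[of i j]) (simp_all add: numeral_2_eq_2)
  from cong[OF this, of "[]" u] u have "[i] @ j # u \<doteq> [j] @ [i] @ u"
    by simp
  also have "\<dots> \<doteq> [j] @ u @ [i]"
    using cong[OF Cons.IH, of "[j]" "[]"] u Cons.prems(2) by simp
  finally show ?case by simp
qed (use assms(1) in simp)

lemma commute:
  assumes "u \<in> lists {..<n}" "v \<in> lists {..<n}"
    and "\<And>i j. i \<in> set u \<Longrightarrow> j \<in> set v \<Longrightarrow> m i j = 2"
  shows "u @ v \<doteq> v @ u"
  using assms(1,3)
proof (induction u rule: list.induct)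
  case (Cons i u)
  then have u: "u \<in> lists {..<n}" "i < n" by auto
  have "(i # u) @ v \<doteq> [i] @ v @ u"
    using cong[OF Cons.IH, of "[i]" "[]"] u Cons.prems(2) by simp
  also have "\<dots> \<doteq> v @ [i] @ u"
    using cong[OF commute_letter[OF u(2) assms(2)], of "[]" u] u Cons.prems(2) by simp
  finally show ?case by simp
qed (use assms(2) in simp)

lemma conj_of_eq: "u \<doteq> v \<Longrightarrow> coxeter_conj n m u v"
  unfolding coxeter_conj_def by (rule bexI[of _ "[]"]) simp_all

lemma conj_rotate: "u \<in> lists {..<n} \<Longrightarrow> v \<in> lists {..<n} \<Longrightarrow> coxeter_conj n m (u @ v) (v @ u)"
  unfolding coxeter_conj_def by (rule bexI[of _ v]) simp_all

lemma conj_trans [trans]: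
  assumes "coxeter_conj n m u v" "coxeter_conj n m v w"
  shows "coxeter_conj n m u w"
proof -
  obtain g h where g: "g \<in> lists {..<n}" "g @ u \<doteq> v @ g" and h: "h \<in> lists {..<n}" "h @ v \<doteq> w @ h"
    using assms unfolding coxeter_conj_def by blast
  have "(h @ g) @ u \<doteq> h @ v @ g"
    using cong[OF g(2) h(1), of "[]"] by simp
  also have "\<dots> \<doteq> w @ h @ g"
    using cong[OF h(2) _ g(1), of "[]"] by simp
  finally show ?thesis
    unfolding coxeter_conj_def using g(1) h(1) by (intro bexI[of _ "h @ g"]) simp_all
qed

lemma conj_sym:
  assumes "coxeter_conj n m u v"
  shows "coxeter_conj n m v u"
proof -
  obtain g where g: "g \<in> lists {..<n}" "g @ u \<doteq> v @ g"
    using assms unfolding coxeter_conj_def by blast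
  have uv: "u \<in> lists {..<n}" "v \<in> lists {..<n}" using coxeter_eq_lists[OF g(2)] by auto
  have h: "rev g \<in> lists {..<n}" by (rule rev_in_lists[OF g(1)])
  have "rev g @ v \<doteq> rev g @ v @ g @ rev g"
    using cong[OF coxeter_eq.sym[OF self_rev[OF g(1)]], of "rev g @ v" "[]"] h uv by simp
  also have "\<dots> \<doteq> rev g @ g @ u @ rev g"
    using cong[OF coxeter_eq.sym[OF g(2)] h h] by simp
  also have "\<dots> \<doteq> u @ rev g"
    using cong[OF rev_self[OF g(1)], of "[]" "u @ rev g"] h uv by simp
  finally show ?thesis unfolding coxeter_conj_def using h by blast
qed

lemma conj_power:
  assumes "coxeter_conj n m u v"
  shows "coxeter_conj n m (word_power u k) (word_power v k)"
proof -
  obtain g where g: "g \<in> lists {..<n}" "g @ u \<doteq> v @ g"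
    using assms unfolding coxeter_conj_def by blast
  have uv: "u \<in> lists {..<n}" "v \<in> lists {..<n}" using coxeter_eq_lists[OF g(2)] by auto
  have "g @ word_power u k \<doteq> word_power v k @ g"
  proof (induction k)
    case (Suc k)
    have "g @ word_power u (Suc k) \<doteq> v @ g @ word_power u k"
      using cong[OF g(2) _ word_power_in_lists[OF uv(1)], of "[]"] by simp
    also have "\<dots> \<doteq> v @ word_power v k @ g"
      using cong[OF Suc uv(2), of "[]"] by simp
    finally show ?case by simp
  qed (use g in simp)
  then show ?thesis unfolding coxeter_conj_def using g by blast
qed

text \<open>Carries the relation c^h = 1 from one Coxeter element to its conjugates.\<close>

lemma conj_Nil:
  assumes "coxeter_conj n m [] v"
  shows "v \<doteq> []"
proof -
  obtain g where g: "g \<in> lists {..<n}" "g \<doteq> v @ g"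
    using assms unfolding coxeter_conj_def by auto
  then have v: "v \<in> lists {..<n}" using coxeter_eq_lists[OF g(2)] by auto
  have h: "rev g \<in> lists {..<n}" by (rule rev_in_lists[OF g(1)])
  have "v \<doteq> v @ g @ rev g"
    using cong[OF coxeter_eq.sym[OF self_rev[OF g(1)]] v, of "[]"] by simp
  also have "\<dots> \<doteq> g @ rev g"
    using cong[OF coxeter_eq.sym[OF g(2)] _ h, of "[]"] by simp
  also have "\<dots> \<doteq> []" by (rule self_rev[OF g(1)])
  finally show ?thesis .
qed

end

section \<open>Conjugacy of the Coxeter elements of a path\<close>

lemma coxeter_diagram_linear: "coxeter_diagram n (linear_coxeter_matrix e)"
  by unfold_locales (simp add: linear_coxeter_matrix_def)

lemma linear_coxeter_matrix_far: "Suc i < j \<or> Suc j < i \<Longrightarrow> linear_coxeter_matrix e i j = 2"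
  by (auto simp: linear_coxeter_matrix_def)

text \<open>
  The diagram is a path, so a letter \<open>k\<close> fails to commute with at most one of the two halves of a
  word in smaller letters; moving it past the other half and rotating brings it next to \<open>k + 1\<close>.
\<close>

lemma linear_coxeter_conj_aux:
  fixes e :: "nat \<Rightarrow> nat"
  defines "m \<equiv> linear_coxeter_matrix e"
  assumes "k \<le> n" "distinct w" "set w = {..<k}"
  shows "coxeter_conj n m (w @ [k..<n]) [0..<n]"
  using assms(2-)
proof (induction k arbitrary: w)
  case 0
  interpret coxeter_diagram n m unfolding m_def by (rule coxeter_diagram_linear)
  have "[0..<n] \<doteq> [0..<n]" by (auto simp: in_lists_conv_set)
  from conj_of_eq[OF this] show ?case using 0 by simp
next
  case (Suc k)
  interpret coxeter_diagram n m unfolding m_def by (rule coxeter_diagram_linear)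
  have far: "m i j = 2" if "Suc i < j \<or> Suc j < i" for i j
    using that by (simp add: m_def linear_coxeter_matrix_far)
  \<comment> \<open>\<open>k\<close> is the largest letter of \<open>w\<close>, so the only letter
    that can obstruct it is \<open>k - 1\<close>, which occurs in at most one of \<open>u\<close>
    and \<open>v\<close>.\<close>
  obtain u v where w: "w = u @ k # v"
    using Suc.prems by (metis lessThan_iff lessI split_list)
  have d: "distinct (u @ v)" and s: "set (u @ v) = {..<k}"
    using Suc.prems unfolding w by (auto simp: lessThan_Suc)
  let ?t = "[Suc k..<n]"
  have k: "[k..<n] = k # ?t" using Suc.prems by (simp add: upt_conv_Cons)
  have lt: "i < k" if "i \<in> set u \<or> i \<in> set v" for i
  proof -
    have "set u \<union> set v = {..<k}" using s by simp
    then show ?thesis using that by blast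
  qed
  have uvn: "u \<in> lists {..<n}" "v \<in> lists {..<n}" "k < n" "?t \<in> lists {..<n}"
  proof -
    show "u \<in> lists {..<n}" "v \<in> lists {..<n}" "k < n" "?t \<in> lists {..<n}"
      using Suc.prems(1) lt by (force simp: in_lists_conv_set)+
  qed
  have IH: "coxeter_conj n m ((u @ v) @ k # ?t) [0..<n]"
    using Suc.IH[OF _ d s] Suc.prems k by simp
  have "coxeter_conj n m (w @ ?t) ((u @ v) @ k # ?t)"
  proof (cases "0 < k \<and> k - 1 \<in> set v")
    case False
    have "m k j = 2" if "j \<in> set v" for j
      using far[of k j] that False lt[of j] by (cases "j = k - 1") auto
    from cong[OF commute_letter[OF uvn(3,2) this] uvn(1,4)]
    have "w @ ?t \<doteq> (u @ v) @ k # ?t" by (simp add: w)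
    then show ?thesis by (rule conj_of_eq)
  next
    case True
    then have "k - 1 \<notin> set u" using d by auto
    then have "m k j = 2" if "j \<in> set u" for j
      using far[of k j] that lt[of j] by (cases "j = k - 1") auto
    from cong[OF coxeter_eq.sym[OF commute_letter[OF uvn(3,1) this]], of "[]" "v @ ?t"] uvn
    have "w @ ?t \<doteq> [k] @ (u @ v) @ ?t" by (simp add: w)
    also have "\<dots> \<doteq> [k] @ ?t @ (u @ v)"
    proof -
      \<comment> \<open>The letters of \<open>u @ v\<close> are below \<open>k\<close> and those of
        \<open>?t\<close> above it, so no two of them are adjacent nodes.\<close>
      have "(u @ v) @ ?t \<doteq> ?t @ (u @ v)"
      proof (intro commute far)
        fix i j assume ij: "i \<in> set (u @ v)" "j \<in> set ?t"
        with lt[of i] have "i < k" by auto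
        with ij show "Suc i < j \<or> Suc j < i" by auto
      qed (use uvn in simp_all)
      from cong[OF this, of "[k]" "[]"] uvn(3) show ?thesis by simp
    qed
    finally have "coxeter_conj n m (w @ ?t) ((k # ?t) @ (u @ v))"
      using conj_of_eq by simp
    also have "coxeter_conj n m ((k # ?t) @ (u @ v)) ((u @ v) @ (k # ?t))"
      using uvn by (intro conj_rotate) simp_all
    finally show ?thesis .
  qed
  then show ?case using IH conj_trans by blast
qed

lemma linear_coxeter_conj:
  assumes "distinct w" "set w = {..<n}"
  shows "coxeter_conj n (linear_coxeter_matrix e) w [0..<n]"
  using linear_coxeter_conj_aux[of n n w e] assms by simp

section \<open>Representations and the order of a Coxeter element\<close>

definition word_map :: "(nat \<Rightarrow> 'b \<Rightarrow> 'b) \<Rightarrow> nat list \<Rightarrow> 'b \<Rightarrow> 'b" where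
  "word_map f w = foldr (\<lambda>i g. f i \<circ> g) w id"

lemma word_map_Nil [simp]: "word_map f [] = id"
  and word_map_Cons [simp]: "word_map f (i # w) = f i \<circ> word_map f w"
  by (simp_all add: word_map_def)

lemma word_map_append [simp]: "word_map f (u @ v) = word_map f u \<circ> word_map f v"
  by (induction u) auto

lemma word_map_power: "word_map f (word_power w k) = word_map f w ^^ k"
  by (induction k) auto

lemma word_map_map: "word_map f (map g w) = word_map (f \<circ> g) w"
  by (induction w) auto

definition coxeter_rep :: "nat \<Rightarrow> (nat \<Rightarrow> nat \<Rightarrow> nat) \<Rightarrow> (nat \<Rightarrow> 'b \<Rightarrow> 'b) \<Rightarrow> bool" where
  "coxeter_rep n m f \<longleftrightarrow> (\<forall>i<n. \<forall>j<n. (f i \<circ> f j) ^^ m i j = id)"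

text \<open>Von Dyck's principle: maps that satisfy the defining relations extend to the group, so
  words for the same element act alike.\<close>

lemma coxeter_rep_word_map:
  assumes "coxeter_rep n m f" "coxeter_eq n m u v"
  shows "word_map f u = word_map f v"
  using assms(2)
proof (induction rule: coxeter_eq.induct)
  case (relator u v i j)
  then have "word_map f (word_power [i, j] (m i j)) = id"
    using assms(1) unfolding word_map_power by (simp add: coxeter_rep_def)
  then show ?case by simp
qed auto

text \<open>The conjugating word acts invertibly, its inverse being the action of the reversed word,
  and can be cancelled.\<close>

lemma (in coxeter_diagram) rep_conj_power:
  assumes "coxeter_rep n m f" "coxeter_conj n m u v" "word_map f u ^^ k = id"
  shows "word_map f v ^^ k = id"
proof -
  obtain g where g: "g \<in> lists {..<n}" "g @ word_power u k \<doteq> word_power v k @ g"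
    using conj_power[OF assms(2)] unfolding coxeter_conj_def by blast
  have "word_map f g = (word_map f v ^^ k) \<circ> word_map f g"
    using coxeter_rep_word_map[OF assms(1) g(2)] assms(3) by (simp add: word_map_power)
  moreover have "word_map f g \<circ> word_map f (rev g) = id"
    using coxeter_rep_word_map[OF assms(1) self_rev[OF g(1)]] by simp
  ultimately show ?thesis
    by (metis comp_assoc comp_id id_comp)
qed

text \<open>
  A representation in which one Coxeter element has order at least \<open>h\<close> bounds all orders from
  below, and the word identity bounds them from above.
\<close>

lemma linear_coxeter_powers:
  fixes e :: "nat \<Rightarrow> nat"
  defines "m \<equiv> linear_coxeter_matrix e"
  assumes "0 < h" and pow: "coxeter_eq n m (word_power [0..<n] h) []"
    and rep: "coxeter_rep n m f"
    and w0: "distinct w0" "set w0 = {..<n}"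
    and low: "\<And>k. 0 < k \<Longrightarrow> k < h \<Longrightarrow> word_map f w0 ^^ k \<noteq> id"
    and w: "distinct w" "set w = {..<n}"
  shows "word_map f w ^^ k = id \<longleftrightarrow> h dvd k" "coxeter_eq n m (word_power w k) [] \<longleftrightarrow> h dvd k"
proof -
  interpret coxeter_diagram n m unfolding m_def by (rule coxeter_diagram_linear)
  have c: "coxeter_conj n m w [0..<n]" "coxeter_conj n m w0 [0..<n]"
    unfolding m_def using linear_coxeter_conj w w0 by blast+
  have "coxeter_conj n m [] (word_power [0..<n] h)"
    by (rule conj_of_eq[OF coxeter_eq.sym[OF pow]])
  also have "coxeter_conj n m (word_power [0..<n] h) (word_power w h)"
    by (rule conj_power[OF conj_sym[OF c(1)]])
  finally have wh: "word_power w h \<doteq> []" by (rule conj_Nil)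
  have fh: "word_map f w ^^ h = id"
    using coxeter_rep_word_map[OF rep wh] by (simp add: word_map_power)
  \<comment> \<open>Exponents matter only modulo \<open>h\<close>. A vanishing power with nonzero
    remainder would, by conjugacy, give an exponent that \<open>low\<close> excludes for
    \<open>w0\<close>.\<close>
  have mod: "word_map f w ^^ k = word_map f w ^^ (k mod h)" for k
  proof -
    have "word_map f w ^^ k = word_map f w ^^ (k mod h + h * (k div h))" by simp
    also have "\<dots> = word_map f w ^^ (k mod h)"
      unfolding funpow_add funpow_mult[symmetric] fh by simp
    finally show ?thesis .
  qed
  show *: "word_map f w ^^ k = id \<longleftrightarrow> h dvd k" for k
  proof
    assume "word_map f w ^^ k = id"
    then have "word_map f w ^^ (k mod h) = id" using mod by simp
    then have "word_map f w0 ^^ (k mod h) = id"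
      using rep_conj_power[OF rep conj_trans[OF c(1) conj_sym[OF c(2)]]] by blast
    then have "k mod h = 0" using low[of "k mod h"] \<open>0 < h\<close> by auto
    then show "h dvd k" by auto
  next
    assume "h dvd k"
    then show "word_map f w ^^ k = id" using mod[of k] by simp
  qed
  show "word_power w k \<doteq> [] \<longleftrightarrow> h dvd k"
  proof
    assume "word_power w k \<doteq> []"
    then show "h dvd k"
      using coxeter_rep_word_map[OF rep] * by (fastforce simp: word_map_power)
  next
    assume "h dvd k"
    then obtain q where q: "k = h * q" by auto
    have "word_power (word_power w h) q \<doteq> word_power [] q"
      by (intro coxeter_eq_word_power wh)
    moreover have "word_power (word_power w h) q = word_power w (h * q)"
      by (induction q) (auto simp: replicate_add)
    moreover have "word_power [] q = ([] :: nat list)" by (induction q) auto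
    ultimately show "word_power w k \<doteq> []" using q by simp
  qed
qed

section \<open>Coxeter numbers of path diagrams\<close>

lemma coxeter_group_one: "\<one>\<^bsub>coxeter_group n m\<^esub> = coxeter_class n m []"
  by (simp add: coxeter_group_def)

lemma coxeter_element_eq_class:
  assumes "\<delta> permutes {..<n}"
  shows "coxeter_element n m \<delta> = coxeter_class n m (map \<delta> [0..<n])"
proof -
  have "foldr (\<lambda>k x. coxeter_class n m [\<delta> k] \<otimes>\<^bsub>coxeter_group n m\<^esub> x) ks \<one>\<^bsub>coxeter_group n m\<^esub>
      = coxeter_class n m (map \<delta> ks)" if "ks \<in> lists {..<n}" for ks
    using that
  proof (induction ks)
    case (Cons k ks)
    then have "[\<delta> k] \<in> lists {..<n}" "map \<delta> ks \<in> lists {..<n}"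
      using permutes_in_image[OF assms] by auto
    with Cons show ?case using coxeter_group_mult[of "[\<delta> k]" n "map \<delta> ks" m] by simp
  qed (simp add: coxeter_group_one)
  from this[of "[0..<n]"] show ?thesis by (simp add: coxeter_element_def in_lists_conv_set)
qed

lemma permutes_word:
  assumes "\<delta> permutes {..<n}"
  shows "distinct (map \<delta> [0..<n])" "set (map \<delta> [0..<n]) = {..<n}"
  using permutes_image[OF assms] permutes_inj_on[OF assms]
  by (simp_all add: distinct_map lessThan_atLeast0)

lemma linear_coxeter_number:
  fixes e :: "nat \<Rightarrow> nat"
  defines "m \<equiv> linear_coxeter_matrix e"
  assumes "0 < h" "coxeter_eq n m (word_power [0..<n] h) []" "coxeter_rep n m f"
    and "distinct w0" "set w0 = {..<n}"
    and "\<And>k. 0 < k \<Longrightarrow> k < h \<Longrightarrow> word_map f w0 ^^ k \<noteq> id"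
  shows "coxeter_number n m = h"
proof -
  interpret group "coxeter_group n m"
    by (rule coxeter_group_is_group) (simp add: m_def linear_coxeter_matrix_def)
  have "ord (coxeter_element n m \<delta>) = h" if \<delta>: "\<delta> permutes {..<n}" for \<delta>
  proof -
    let ?w = "map \<delta> [0..<n]"
    have w: "?w \<in> lists {..<n}" using permutes_word[OF \<delta>] by auto
    have pow: "coxeter_class n m ?w [^]\<^bsub>coxeter_group n m\<^esub> k = coxeter_class n m (word_power ?w k)" for k :: nat
    proof (induction k)
      case (Suc k)
      then show ?case
        using coxeter_group_mult[of "word_power ?w k" n ?w m] w word_power_in_lists[OF w]
        by (simp only: nat_pow_Suc word_power_Suc2)
    qed (simp add: coxeter_group_one)
    have cl: "coxeter_class n m ?w \<in> carrier (coxeter_group n m)"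
      using w by (simp add: coxeter_group_def)
    have "coxeter_class n m ?w [^]\<^bsub>coxeter_group n m\<^esub> k = \<one>\<^bsub>coxeter_group n m\<^esub> \<longleftrightarrow> h dvd k" for k :: nat
      unfolding pow coxeter_group_one coxeter_class_eq_iff[OF word_power_in_lists[OF w]]
      using linear_coxeter_powers(2)[of h n e f w0 ?w k] assms permutes_word[OF \<delta>] by blast
    then have "ord (coxeter_class n m ?w) dvd k \<longleftrightarrow> h dvd k" for k
      using pow_eq_id[OF cl] by simp
    then show ?thesis
      unfolding coxeter_element_eq_class[OF \<delta>] by (meson dvd_antisym dvd_refl)
  qed
  \<comment> \<open>Some permutation has to exist, as otherwise the condition in
    \<open>coxeter_number\<close> would hold vacuously for every number; \<open>id\<close> secures
    uniqueness.\<close>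
  moreover have "id permutes {..<n}" by (rule permutes_id)
  ultimately show ?thesis
    unfolding coxeter_number_def by (intro the_equality) blast+
qed

section \<open>Rewriting words by valid rules\<close>

fun strip_prefix :: "'b list \<Rightarrow> 'b list \<Rightarrow> 'b list option" where
  "strip_prefix [] ys = Some ys"
| "strip_prefix (x # xs) [] = None"
| "strip_prefix (x # xs) (y # ys) = (if x = y then strip_prefix xs ys else None)"

lemma strip_prefix_Some: "strip_prefix xs ys = Some zs \<Longrightarrow> ys = xs @ zs"
  by (induction xs ys rule: strip_prefix.induct) (auto split: if_splits)

fun apply_rule :: "(nat list \<times> nat list) list \<Rightarrow> nat list \<Rightarrow> (nat list \<times> nat list) option" where
  "apply_rule [] w = None"
| "apply_rule ((l, r) # R) w =
     (case strip_prefix l w of None \<Rightarrow> apply_rule R w | Some d \<Rightarrow> Some (d, r))"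

lemma apply_rule_Some: "apply_rule R w = Some (d, r) \<Longrightarrow> \<exists>l. (l, r) \<in> set R \<and> w = l @ d"
  by (induction R w rule: apply_rule.induct) (auto split: option.splits dest: strip_prefix_Some)

text \<open>\<open>out\<close> is the part already scanned. A replacement is put back on the input,
  so that redexes it forms with the remaining stack are found. When the steps run out, the current
  word is returned as it is.\<close>

fun rewrite_word :: "nat \<Rightarrow> (nat list \<times> nat list) list \<Rightarrow> nat list \<Rightarrow> nat list \<Rightarrow> nat list" where
  "rewrite_word 0 R out inp = rev out @ inp"
| "rewrite_word (Suc f) R out [] = rev out"
| "rewrite_word (Suc f) R out (i # inp) =
     (case apply_rule R (i # out) of
        None \<Rightarrow> rewrite_word f R (i # out) inp
      | Some (d, r) \<Rightarrow> rewrite_word f R d (r @ inp))"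

text \<open>
  The left-hand sides of rules are stored reversed, as they are matched against the reversed
  stack \<open>out\<close>; the first argument bounds the number of steps.
\<close>

definition valid_rules :: "nat \<Rightarrow> (nat \<Rightarrow> nat \<Rightarrow> nat) \<Rightarrow> (nat list \<times> nat list) list \<Rightarrow> bool" where
  "valid_rules n m R \<longleftrightarrow> (\<forall>(l, r) \<in> set R. coxeter_eq n m (rev l) r)"

lemma rewrite_word_eq:
  assumes "valid_rules n m R" "out \<in> lists {..<n}" "inp \<in> lists {..<n}"
  shows "coxeter_eq n m (rev out @ inp) (rewrite_word f R out inp)"
  using assms
proof (induction f R out inp rule: rewrite_word.induct)
  case (3 f R out i inp)
  show ?case
  proof (cases "apply_rule R (i # out)")
    case None
    then show ?thesis using 3 by auto
  next
    case (Some dr)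
    obtain d r where dr: "dr = (d, r)" by (cases dr)
    obtain l where R: "(l, r) \<in> set R" and io: "i # out = l @ d"
      using apply_rule_Some[OF Some[unfolded dr]] by blast
    have eq: "coxeter_eq n m (rev l) r" using 3(3) R by (auto simp: valid_rules_def)
    then have r: "r \<in> lists {..<n}" using coxeter_eq_lists by blast
    have d: "d \<in> lists {..<n}" using 3(4,5) io by (metis Cons_in_lists_iff append_in_lists_conv)
    have "coxeter_eq n m (rev d @ rev l @ inp) (rev d @ r @ inp)"
      using coxeter_eq_context[OF eq, of "rev d" inp] d 3(5) by (simp add: rev_in_lists)
    also have "rev d @ rev l @ inp = rev out @ i # inp"
      using arg_cong[OF io, of rev] by (metis append.assoc append_Cons append_Nil rev.simps(2) rev_append)
    finally have "coxeter_eq n m (rev out @ i # inp) (rev d @ r @ inp)" .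
    moreover have "coxeter_eq n m (rev d @ r @ inp) (rewrite_word f R d (r @ inp))"
      using 3(2)[OF Some[unfolded dr] HOL.refl 3(3)] d r 3(5) by simp
    ultimately have "coxeter_eq n m (rev out @ i # inp) (rewrite_word f R d (r @ inp))"
      by (rule coxeter_eq.trans)
    then show ?thesis
      using Some dr by simp
  qed
qed (simp_all add: rev_in_lists)

text \<open>The bound 1300 affects only how far the reduction proceeds: with valid rules the result
  represents the same element in any case.\<close>

abbreviation normal_form :: "(nat list \<times> nat list) list \<Rightarrow> nat list \<Rightarrow> nat list" where
  "normal_form R w \<equiv> rewrite_word 1300 R [] w"

lemma normal_form_eq:
  "valid_rules n m R \<Longrightarrow> w \<in> lists {..<n} \<Longrightarrow> coxeter_eq n m w (normal_form R w)"
  using rewrite_word_eq[of n m R "[]" w] by simp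

text \<open>Meant for overlaps, where \<open>u @ v\<close> and \<open>v @ w\<close> are both
  left-hand sides. The word \<open>u @ v @ w\<close> is reduced starting from either part; the two
  results are equal in the group and form the new rule, oriented from the first to the
  second.\<close>

definition add_critical_pair :: "nat list \<times> nat list \<times> nat list \<Rightarrow> (nat list \<times> nat list) list \<Rightarrow> (nat list \<times> nat list) list" where
  "add_critical_pair = (\<lambda>(u, v, w) R.
     R @ [(rev (normal_form R (u @ normal_form R (v @ w))), normal_form R (normal_form R (u @ v) @ w))])"

lemma valid_rules_add_critical_pair:
  assumes R: "valid_rules n m R" and c: "u \<in> lists {..<n}" "v \<in> lists {..<n}" "w \<in> lists {..<n}"
  shows "valid_rules n m (add_critical_pair (u, v, w) R)"
proof -
  note nf = normal_form_eq[OF R]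
  have vw: "coxeter_eq n m (v @ w) (normal_form R (v @ w))" and uv: "coxeter_eq n m (u @ v) (normal_form R (u @ v))"
    using c by (simp_all add: nf)
  have l: "u @ normal_form R (v @ w) \<in> lists {..<n}" "normal_form R (u @ v) @ w \<in> lists {..<n}"
    using coxeter_eq_lists[OF vw] coxeter_eq_lists[OF uv] c by simp_all
  have "coxeter_eq n m (normal_form R (u @ normal_form R (v @ w))) (u @ normal_form R (v @ w))"
    by (rule coxeter_eq.sym[OF nf[OF l(1)]])
  also have "coxeter_eq n m \<dots> (u @ v @ w)"
    using coxeter_eq_context[OF coxeter_eq.sym[OF vw] c(1), of "[]"] by simp
  also have "coxeter_eq n m \<dots> (normal_form R (u @ v) @ w)"
    using coxeter_eq_context[OF uv _ c(3), of "[]"] by simp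
  also have "coxeter_eq n m \<dots> (normal_form R (normal_form R (u @ v) @ w))"
    by (rule nf[OF l(2)])
  finally have "coxeter_eq n m (normal_form R (u @ normal_form R (v @ w))) (normal_form R (normal_form R (u @ v) @ w))" .
  then show ?thesis using R by (auto simp: valid_rules_def add_critical_pair_def)
qed

lemma coxeter_eq_Nil_by_rewriting:
  assumes "valid_rules n m R" "list_all (\<lambda>(u, v, w). list_all (\<lambda>i. i < n) (u @ v @ w)) C"
    and "x \<in> lists {..<n}" "normal_form (fold add_critical_pair C R) x = []"
  shows "coxeter_eq n m x []"
proof -
  have "valid_rules n m (fold add_critical_pair C R)"
    using assms(1,2)
  proof (induction C arbitrary: R)
    case (Cons c C)
    obtain u v w where c: "c = (u, v, w)" by (cases c)
    then show ?case
      using Cons valid_rules_add_critical_pair[of n m R u v w] by (auto simp: list_all_iff in_lists_conv_set)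
  qed auto
  from normal_form_eq[OF this assms(3)] show ?thesis using assms(4) by simp
qed

text \<open>\<open>take\<close> cuts the alternating word of length \<open>m j i\<close> out of the
  power. The side that begins with the larger letter \<open>j\<close> is the one replaced, in
  keeping with the shortlex order.\<close>

definition braid_rules :: "nat \<Rightarrow> (nat \<Rightarrow> nat \<Rightarrow> nat) \<Rightarrow> (nat list \<times> nat list) list" where
  "braid_rules n m = [([i, i], []). i \<leftarrow> [0..<n]] @
     [(rev (take (m j i) (word_power [j, i] (m j i))), take (m j i) (word_power [i, j] (m j i))).
       j \<leftarrow> [0..<n], i \<leftarrow> [0..<j]]"

lemma (in coxeter_diagram) valid_braid_rules:
  assumes "\<And>i j. i < n \<Longrightarrow> j < n \<Longrightarrow> i < j \<Longrightarrow> m j i \<in> {2, 3, 4, 5}"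
  shows "valid_rules n m (braid_rules n m)"
proof -
  have "[i, i] \<doteq> []" if "i < n" for i
    using self_rev[of "[i]"] that by simp
  moreover have "take (m j i) (word_power [j, i] (m j i)) \<doteq> take (m j i) (word_power [i, j] (m j i))"
    if "j < n" "i < j" for i j
  proof (rule braid[of j i])
    \<comment> \<open>Checked label by label: the second half of the relator, read backwards, is the
      alternating word that begins with \<open>i\<close>.\<close>
    show "word_power [j, i] (m j i) = take (m j i) (word_power [j, i] (m j i)) @ rev (take (m j i) (word_power [i, j] (m j i)))"
      using assms[of i j] that by (auto simp: eval_nat_numeral)
    show "take (m j i) (word_power [i, j] (m j i)) \<in> lists {..<n}"
      using that word_power_in_lists[of "[i, j]" "{..<n}" "m j i"] by (auto dest: in_set_takeD)
  qed (use that in auto)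
  ultimately show ?thesis
    by (auto simp: valid_rules_def braid_rules_def)
qed

lemma linear_coxeter_power_by_rewriting:
  assumes "\<And>i. e i \<in> {3, 4, 5}"
    and "list_all (\<lambda>(u, v, w). list_all (\<lambda>i. i < n) (u @ v @ w)) C"
    and "normal_form (fold add_critical_pair C (braid_rules n (linear_coxeter_matrix e))) (word_power [0..<n] h) = []"
  shows "coxeter_eq n (linear_coxeter_matrix e) (word_power [0..<n] h) []"
proof (rule coxeter_eq_Nil_by_rewriting[OF _ assms(2) _ assms(3)])
  interpret coxeter_diagram n "linear_coxeter_matrix e" by (rule coxeter_diagram_linear)
  show "valid_rules n (linear_coxeter_matrix e) (braid_rules n (linear_coxeter_matrix e))"
    using assms(1) by (intro valid_braid_rules) (auto simp: linear_coxeter_matrix_def)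
qed (auto simp: in_lists_conv_set)

section \<open>Powers of the Coxeter element in type A\<close>

locale linear_diagram =
  fixes n :: nat and e :: "nat \<Rightarrow> nat"
begin

sublocale coxeter_diagram n "linear_coxeter_matrix e"
  by (rule coxeter_diagram_linear)

notation eq (infix "\<doteq>" 50)

lemma commute_far:
  assumes "u \<in> lists {..<n}" "v \<in> lists {..<n}"
    and "\<And>i j. i \<in> set u \<Longrightarrow> j \<in> set v \<Longrightarrow> Suc i < j \<or> Suc j < i"
  shows "u @ v \<doteq> v @ u"
  using assms by (intro commute linear_coxeter_matrix_far)

lemma upt_in_lists: "k \<le> n \<Longrightarrow> [i..<k] \<in> lists {..<n}"
  by (auto simp: in_lists_conv_set)

text \<open>Conjugation by the ascending product shifts generators along the path, as a long cycle
  shifts adjacent transpositions. The braid relation turns \<open>j\<close> into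
  \<open>j + 1\<close>; every other letter that is crossed commutes with the moving one.\<close>

lemma shift_letter:
  assumes "k \<le> n" "Suc j < k" "e j = 3"
  shows "[0..<k] @ [j] \<doteq> [Suc j] @ [0..<k]"
proof -
  have k: "[0..<k] = [0..<j] @ [j, Suc j] @ [Suc (Suc j)..<k]"
    using assms(2) upt_add_eq_append[of 0 j "k - j"] by (simp add: upt_conv_Cons)
  have l: "[0..<j] \<in> lists {..<n}" "[Suc (Suc j)..<k] \<in> lists {..<n}" "[j] \<in> lists {..<n}"
      "[Suc j] \<in> lists {..<n}"
    using assms by (auto intro!: upt_in_lists)
  have "[Suc (Suc j)..<k] @ [j] \<doteq> [j] @ [Suc (Suc j)..<k]"
    using l by (intro commute_far) auto
  from cong[OF this, of "[0..<j] @ [j, Suc j]" "[]"] l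
  have "[0..<k] @ [j] \<doteq> [0..<j] @ [j, Suc j, j] @ [Suc (Suc j)..<k]"
    by (simp add: k)
  also have "\<dots> \<doteq> [0..<j] @ [Suc j, j, Suc j] @ [Suc (Suc j)..<k]"
  proof (intro cong l)
    show "[j, Suc j, j] \<doteq> [Suc j, j, Suc j]"
      using assms by (intro braid[of j "Suc j"]) (auto simp: linear_coxeter_matrix_def eval_nat_numeral)
  qed
  also have "\<dots> \<doteq> [Suc j] @ [0..<k]"
  proof -
    have "[0..<j] @ [Suc j] \<doteq> [Suc j] @ [0..<j]"
      using l by (intro commute_far) auto
    from cong[OF this, of "[]" "[j, Suc j] @ [Suc (Suc j)..<k]"] l show ?thesis by (simp add: k)
  qed
  finally show ?thesis .
qed

text \<open>Each letter of the descending run drops by one; \<open>i < k\<close> keeps the lowest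
  one from falling below 0.\<close>

lemma shift_rev_upt:
  assumes "k \<le> n" "\<And>j. Suc j < k \<Longrightarrow> e j = 3" "i < k"
  shows "rev [k - i..<k] @ [0..<k] \<doteq> [0..<k] @ rev [k - Suc i..<k - 1]"
  using assms(3)
proof (induction i)
  case 0
  then show ?case using assms(1) upt_in_lists by simp
next
  case (Suc i)
  have l: "[0..<k] \<in> lists {..<n}" using assms(1) by (rule upt_in_lists)
  have r: "rev [k - i..<k] \<in> lists {..<n}" "rev [k - Suc i..<k - 1] \<in> lists {..<n}"
    using assms(1) by (auto simp: in_lists_conv_set)
  have j: "k - Suc i = Suc (k - Suc (Suc i))" using Suc.prems by simp
  have "rev [k - Suc i..<k] @ [0..<k] = rev [k - i..<k] @ [k - Suc i] @ [0..<k]"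
    using Suc.prems by (simp add: upt_conv_Cons Suc_diff_Suc)
  also have "\<dots> \<doteq> rev [k - i..<k] @ [0..<k] @ [k - Suc (Suc i)]"
    using cong[OF coxeter_eq.sym[OF shift_letter[of k "k - Suc (Suc i)"]], of "rev [k - i..<k]" "[]"]
      Suc.prems assms(1,2) r unfolding j by simp
  also have "\<dots> \<doteq> [0..<k] @ rev [k - Suc i..<k - 1] @ [k - Suc (Suc i)]"
    using cong[OF Suc.IH, of "[]" "[k - Suc (Suc i)]"] Suc.prems assms(1) by simp
  also have "rev [k - Suc i..<k - 1] @ [k - Suc (Suc i)] = rev [k - Suc (Suc i)..<k - 1]"
    using upt_conv_Cons[of "k - Suc (Suc i)" "k - 1"] Suc.prems j by simp
  finally show ?case .
qed

text \<open>Each further factor is pulled to the left of the descending run, which drops by one. The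
  factor splits as \<open>[0..<k] @ [k]\<close>, and its last letter extends the run again.\<close>

lemma upt_power_split:
  assumes "Suc k \<le> n" "\<And>j. j < k \<Longrightarrow> e j = 3" "i \<le> Suc k"
  shows "word_power [0..<Suc k] i \<doteq> word_power [0..<k] i @ rev [Suc k - i..<Suc k]"
  using assms(3)
proof (induction i)
  case (Suc i)
  have l: "[0..<k] \<in> lists {..<n}" "[0..<Suc k] \<in> lists {..<n}"
    using assms(1) by (auto intro!: upt_in_lists)
  have "word_power [0..<Suc k] (Suc i) \<doteq> (word_power [0..<k] i @ rev [Suc k - i..<Suc k]) @ [0..<Suc k]"
    unfolding word_power_Suc2 using cong[OF Suc.IH _ l(2), of "[]"] Suc.prems by simp
  also have "\<dots> \<doteq> word_power [0..<k] i @ [0..<Suc k] @ rev [Suc k - Suc i..<Suc k - 1]"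
    using cong[OF shift_rev_upt[of "Suc k" i] word_power_in_lists[OF l(1)], of "[]"] Suc.prems assms(1,2)
    by simp
  also have "\<dots> = word_power [0..<k] (Suc i) @ rev [Suc k - Suc i..<Suc k]"
    unfolding word_power_Suc2 using Suc.prems by simp
  finally show ?case .
qed simp

text \<open>In the splitting with exponent \<open>Suc k\<close> the power of the shorter product
  vanishes by induction, and the remaining run is the reversed word. So c^(k+1) = c^-1 for the
  product c of \<open>k + 1\<close> letters.\<close>

lemma upt_power_eq_Nil:
  assumes "k \<le> n" "\<And>j. Suc j < k \<Longrightarrow> e j = 3"
  shows "word_power [0..<k] (Suc k) \<doteq> []"
  using assms
proof (induction k)
  case (Suc k)
  have l: "[0..<Suc k] \<in> lists {..<n}"
    using Suc.prems(1) by (rule upt_in_lists)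
  have "word_power [0..<Suc k] (Suc k) \<doteq> word_power [0..<k] (Suc k) @ rev [0..<Suc k]"
    using upt_power_split[of k "Suc k"] Suc.prems by simp
  also have "\<dots> \<doteq> rev [0..<Suc k]"
    using cong[OF Suc.IH _ rev_in_lists[OF l], of "[]"] Suc.prems by simp
  finally have "word_power [0..<Suc k] (Suc k) \<doteq> rev [0..<Suc k]" .
  from cong[OF this _ l, of "[]"]
  have "word_power [0..<Suc k] (Suc (Suc k)) \<doteq> rev [0..<Suc k] @ [0..<Suc k]"
    unfolding word_power_Suc2[of "Suc k"] by simp
  also have "\<dots> \<doteq> []" by (rule rev_self[OF l])
  finally show ?case .
qed simp

end

lemma coxeter_power_A: "coxeter_eq n matrix_A (word_power [0..<n] (n + 1)) []"
proof -
  interpret linear_diagram n "\<lambda>_. 3" .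
  show ?thesis using upt_power_eq_Nil[of n] by (simp add: matrix_A_def)
qed

text \<open>
  In type \<open>B\<close>, the reflections \<open>sign_word j\<close> change one sign each.  With \<open>a\<close> the Coxeter element of
  the subdiagram of type \<open>A\<close>, the \<open>n\<close>-th power of the Coxeter element is \<open>a\<^sup>n\<close> times the product
  of all sign changes, which is an involution.
\<close>

locale linear_diagram_B = linear_diagram "Suc N" e for N e +
  assumes e3: "Suc j < N \<Longrightarrow> e j = 3" and e4: "Suc j = N \<Longrightarrow> e j = 4"
begin

notation eq (infix "\<doteq>" 50)

definition sign_word :: "nat \<Rightarrow> nat list" where
  "sign_word j = [j..<N] @ [N] @ rev [j..<N]"

lemma sign_word_N: "sign_word N = [N]"
  by (simp add: sign_word_def)

lemma sign_word_rec: "j < N \<Longrightarrow> sign_word j = [j] @ sign_word (Suc j) @ [j]"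
  by (simp add: sign_word_def upt_conv_Cons)

lemma sign_word_in_lists: "sign_word j \<in> lists {..<Suc N}"
  by (auto simp: sign_word_def in_lists_conv_set)

lemma a_in_lists: "[0..<N] \<in> lists {..<Suc N}"
  by (auto simp: in_lists_conv_set)

lemma sign_word_sign_word: "sign_word j @ sign_word j \<doteq> []"
proof -
  have "rev (sign_word j) = sign_word j" by (simp add: sign_word_def)
  then show ?thesis using self_rev[OF sign_word_in_lists[of j]] by simp
qed

text \<open>Downward induction from \<open>N - 1\<close>: \<open>sign_word j\<close> is the
  conjugate of \<open>sign_word (Suc j)\<close> by the letter \<open>j\<close>, and this letter is
  shifted by \<open>shift_letter\<close>.\<close>

lemma sign_word_shift:
  assumes "j < N"
  shows "sign_word (Suc j) @ [0..<N] \<doteq> [0..<N] @ sign_word j"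
  using assms
proof (induction "N - Suc j" arbitrary: j)
  case 0
  then have N: "Suc j = N" by simp
  have u: "[0..<N] = [0..<j] @ [j]" by (simp flip: N)
  have j: "j < Suc N" "[0..<j] \<in> lists {..<Suc N}" using N by (auto simp: in_lists_conv_set)
  have "[N] @ [0..<j] \<doteq> [0..<j] @ [N]"
    using N j by (intro commute_far) auto
  from cong[OF this, of "[]" "[j]"] j
  have "sign_word (Suc j) @ [0..<N] \<doteq> [0..<j] @ [N, j]"
    by (simp add: N u sign_word_N)
  \<comment> \<open>Inserting \<open>j\<close> twice completes both the ascending product and the
    palindrome \<open>[j, N, j]\<close>.\<close>
  also have "\<dots> \<doteq> [0..<j] @ ([j] @ rev [j]) @ [N, j]"
    using cong[OF coxeter_eq.sym[OF self_rev[of "[j]"]], of "[0..<j]" "[N, j]"] j by simp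
  also have "\<dots> = [0..<N] @ sign_word j"
    using sign_word_rec[of j] N by (simp add: u sign_word_N)
  finally show ?case .
next
  case (Suc d)
  then have j: "Suc j < N" by simp
  have d: "d = N - Suc (Suc j)" using Suc by simp
  note l = a_in_lists sign_word_in_lists
  have jl: "[j] \<in> lists {..<Suc N}" "[Suc j] \<in> lists {..<Suc N}" using j by auto
  have sh: "[Suc j] @ [0..<N] \<doteq> [0..<N] @ [j]"
    using j e3 by (intro coxeter_eq.sym[OF shift_letter]) auto
  have "sign_word (Suc j) @ [0..<N] = [Suc j] @ sign_word (Suc (Suc j)) @ [Suc j] @ [0..<N]"
    using j by (simp add: sign_word_rec)
  also have "\<dots> \<doteq> [Suc j] @ sign_word (Suc (Suc j)) @ [0..<N] @ [j]"
    using cong[OF sh, of "[Suc j] @ sign_word (Suc (Suc j))" "[]"] l jl by simp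
  also have "\<dots> \<doteq> [Suc j] @ [0..<N] @ sign_word (Suc j) @ [j]"
    using cong[OF Suc.hyps(1)[OF d j] jl(2,1)] by simp
  also have "\<dots> \<doteq> [0..<N] @ [j] @ sign_word (Suc j) @ [j]"
    using cong[OF sh, of "[]" "sign_word (Suc j) @ [j]"] l jl by simp
  also have "\<dots> = [0..<N] @ sign_word j"
    using j by (simp add: sign_word_rec)
  finally show ?case .
qed

text \<open>The label 4 is the case \<open>j = N - 1\<close>; for smaller \<open>j\<close> one
  conjugates by letters that commute with \<open>N\<close>.\<close>

lemma sign_word_commute_last:
  assumes "j < N"
  shows "sign_word j @ [N] \<doteq> [N] @ sign_word j"
  using assms
proof (induction "N - Suc j" arbitrary: j)
  case 0
  then have N: "Suc j = N" "j < N" by simp_all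
  then have "[j, N, j, N] \<doteq> [N, j, N, j]"
    using e4[of j] by (intro braid[of j N]) (auto simp: linear_coxeter_matrix_def eval_nat_numeral)
  then show ?case by (simp add: sign_word_rec[OF N(2)] N(1) sign_word_N)
next
  case (Suc d)
  then have j: "Suc j < N" "j < N" by simp_all
  have d: "d = N - Suc (Suc j)" using Suc by simp
  have l: "[j] \<in> lists {..<Suc N}" "[N] \<in> lists {..<Suc N}" using j by auto
  have c: "[j] @ [N] \<doteq> [N] @ [j]" using j by (intro commute_far) auto
  have "sign_word j @ [N] = [j] @ sign_word (Suc j) @ [j] @ [N]"
    using j by (simp add: sign_word_rec)
  also have "\<dots> \<doteq> [j] @ sign_word (Suc j) @ [N] @ [j]"
    using cong[OF c, of "[j] @ sign_word (Suc j)" "[]"] l sign_word_in_lists by simp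
  also have "\<dots> \<doteq> [j] @ [N] @ sign_word (Suc j) @ [j]"
    using cong[OF Suc.hyps(1)[OF d j(1)] l(1,1)] by simp
  also have "\<dots> \<doteq> [N] @ [j] @ sign_word (Suc j) @ [j]"
    using cong[OF c, of "[]" "sign_word (Suc j) @ [j]"] l sign_word_in_lists by simp
  also have "\<dots> = [N] @ sign_word j"
    using j by (simp add: sign_word_rec)
  finally show ?case .
qed

lemma cancel_left:
  assumes "u @ v \<doteq> u @ w"
  shows "v \<doteq> w"
proof -
  have l: "u \<in> lists {..<Suc N}" "v \<in> lists {..<Suc N}" "w \<in> lists {..<Suc N}"
    using coxeter_eq_lists[OF assms] by simp_all
  have "v \<doteq> rev u @ u @ v"
    using cong[OF coxeter_eq.sym[OF rev_self[OF l(1)]], of "[]" v] l by simp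
  also have "\<dots> \<doteq> rev u @ u @ w"
    using cong[OF assms rev_in_lists[OF l(1)], of "[]"] by simp
  also have "\<dots> \<doteq> w"
    using cong[OF rev_self[OF l(1)], of "[]" w] l by simp
  finally show ?thesis .
qed

text \<open>Conjugation by \<open>[0..<N]\<close> raises both indices until the larger one is
  \<open>N\<close>.\<close>

lemma sign_word_commute:
  assumes "i < j" "j \<le> N"
  shows "sign_word i @ sign_word j \<doteq> sign_word j @ sign_word i"
  using assms
proof (induction "N - j" arbitrary: i j)
  case 0
  then have j: "j = N" "i < N" by simp_all
  show ?case using sign_word_commute_last[OF j(2)] unfolding j(1) sign_word_N .
next
  case (Suc d)
  then have j: "j < N" "i < N" by simp_all
  have IH: "sign_word (Suc i) @ sign_word (Suc j) \<doteq> sign_word (Suc j) @ sign_word (Suc i)"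
    using Suc by simp
  have sh: "[0..<N] @ sign_word i' @ sign_word j' \<doteq> sign_word (Suc i') @ sign_word (Suc j') @ [0..<N]"
    if "i' < N" "j' < N" for i' j'
  proof -
    note l = sign_word_in_lists
    have "[0..<N] @ sign_word i' @ sign_word j' \<doteq> sign_word (Suc i') @ [0..<N] @ sign_word j'"
      using cong[OF coxeter_eq.sym[OF sign_word_shift[OF that(1)]] _ l, of "[]"] by simp
    also have "\<dots> \<doteq> sign_word (Suc i') @ sign_word (Suc j') @ [0..<N]"
      using cong[OF coxeter_eq.sym[OF sign_word_shift[OF that(2)]] l, of "[]"] by simp
    finally show ?thesis .
  qed
  have "[0..<N] @ sign_word i @ sign_word j \<doteq> sign_word (Suc i) @ sign_word (Suc j) @ [0..<N]"
    using sh j by blast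
  also have "\<dots> \<doteq> sign_word (Suc j) @ sign_word (Suc i) @ [0..<N]"
    using cong[OF IH _ a_in_lists, of "[]"] by simp
  also have "\<dots> \<doteq> [0..<N] @ sign_word j @ sign_word i"
    by (rule coxeter_eq.sym[OF sh[OF j]])
  finally show ?case by (rule cancel_left)
qed

lemma sign_words_in_lists: "concat (map sign_word js) \<in> lists {..<Suc N}"
  using sign_word_in_lists by (induction js) auto

lemma sign_word_commute_list:
  assumes "\<And>j. j \<in> set js \<Longrightarrow> i < j \<and> j \<le> N"
  shows "sign_word i @ concat (map sign_word js) \<doteq> concat (map sign_word js) @ sign_word i"
  using assms
proof (induction js)
  case (Cons j js)
  note l = sign_word_in_lists sign_words_in_lists
  have "sign_word i @ concat (map sign_word (j # js)) \<doteq> sign_word j @ sign_word i @ concat (map sign_word js)"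
    using cong[OF sign_word_commute[of i j] _ sign_words_in_lists, of "[]"] Cons.prems by simp
  also have "\<dots> \<doteq> sign_word j @ concat (map sign_word js) @ sign_word i"
    using cong[OF Cons.IH sign_word_in_lists, of "[]"] Cons.prems by simp
  finally show ?case by simp
qed (simp add: sign_word_in_lists)

text \<open>A product of commuting involutions is an involution.\<close>

lemma sign_words_square:
  "i \<le> Suc N \<Longrightarrow> concat (map sign_word [i..<Suc N]) @ concat (map sign_word [i..<Suc N]) \<doteq> []"
proof (induction i rule: inc_induct)
  case (step i)
  let ?U = "concat (map sign_word [Suc i..<Suc N])"
  have i: "[i..<Suc N] = i # [Suc i..<Suc N]" using step by (simp add: upt_conv_Cons)
  note l = sign_word_in_lists sign_words_in_lists
  have "?U @ sign_word i \<doteq> sign_word i @ ?U"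
    by (rule coxeter_eq.sym[OF sign_word_commute_list]) auto
  from cong[OF this l(1,2)]
  have "(sign_word i @ ?U) @ (sign_word i @ ?U) \<doteq> (sign_word i @ sign_word i) @ ?U @ ?U"
    by simp
  also have "\<dots> \<doteq> ?U @ ?U"
    using cong[OF sign_word_sign_word[of i], of "[]" "?U @ ?U"] l by simp
  also have "\<dots> \<doteq> []" by (rule step.IH)
  finally show ?case by (simp only: i list.map concat.simps)
qed simp

lemma sign_words_shift:
  assumes "i \<le> N"
  shows "concat (map sign_word [Suc i..<Suc N]) @ [0..<N] \<doteq> [0..<N] @ concat (map sign_word [i..<N])"
  using assms
proof (induction i rule: inc_induct)
  case (step i)
  note l = sign_word_in_lists sign_words_in_lists
  have i: "[Suc i..<Suc N] = Suc i # [Suc (Suc i)..<Suc N]" "[i..<N] = i # [Suc i..<N]"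
    using step by (simp_all add: upt_conv_Cons del: upt_Suc)
  have "concat (map sign_word [Suc i..<Suc N]) @ [0..<N]
      \<doteq> sign_word (Suc i) @ [0..<N] @ concat (map sign_word [Suc i..<N])"
    using cong[OF step.IH l(1), of "[]"] by (simp add: i del: upt_Suc)
  also have "\<dots> \<doteq> [0..<N] @ sign_word i @ concat (map sign_word [Suc i..<N])"
    using cong[OF sign_word_shift _ l(2), of _ "[]"] step by simp
  finally show ?case by (simp add: i del: upt_Suc)
qed (simp add: a_in_lists)

text \<open>The analogue of \<open>upt_power_split\<close> with sign changes in place of letters:
  each new factor \<open>[0..<N] @ [N]\<close> moves the accumulated sign changes one index down and
  adds the one with index \<open>N\<close>.\<close>

lemma power_split:
  assumes "i \<le> Suc N"
  shows "word_power [0..<Suc N] i \<doteq> word_power [0..<N] i @ concat (map sign_word [Suc N - i..<Suc N])"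
  using assms
proof (induction i)
  case (Suc i)
  let ?U = "concat (map sign_word [Suc N - i..<Suc N])"
  have c: "[0..<Suc N] \<in> lists {..<Suc N}" "[N] \<in> lists {..<Suc N}"
    by (auto simp: in_lists_conv_set)
  have S: "Suc N - i = Suc (N - i)" using Suc.prems by simp
  note a = word_power_in_lists[OF a_in_lists]
  have "word_power [0..<Suc N] (Suc i) \<doteq> word_power [0..<N] i @ ?U @ [0..<Suc N]"
    unfolding word_power_Suc2 using cong[OF Suc.IH _ c(1), of "[]"] Suc.prems by simp
  also have "\<dots> = word_power [0..<N] i @ (?U @ [0..<N]) @ [N]" by simp
  also have "\<dots> \<doteq> word_power [0..<N] i @ ([0..<N] @ concat (map sign_word [N - i..<N])) @ [N]"
    unfolding S by (intro cong sign_words_shift a c) simp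
  also have "\<dots> = word_power [0..<N] (Suc i) @ concat (map sign_word [Suc N - Suc i..<Suc N])"
    unfolding word_power_Suc2 using Suc.prems by (simp add: sign_word_N)
  finally show ?case .
qed simp

text \<open>The product of the first \<open>N\<close> generators is of type A, so its power with
  exponent \<open>N + 1\<close> vanishes. The same power of the full product is therefore the
  product of all sign changes, geometrically the central inversion.\<close>

lemma power_eq_Nil: "word_power [0..<Suc N] (2 * Suc N) \<doteq> []"
proof -
  let ?U = "concat (map sign_word [0..<Suc N])"
  have "word_power [0..<Suc N] (Suc N) \<doteq> word_power [0..<N] (Suc N) @ ?U"
    using power_split[of "Suc N"] by simp
  also have "\<dots> \<doteq> ?U"
    using cong[OF upt_power_eq_Nil[of N] _ sign_words_in_lists[of "[0..<Suc N]"], of "[]"] e3 by simp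
  finally have "word_power [0..<Suc N] (Suc N) @ word_power [0..<Suc N] (Suc N) \<doteq> ?U @ ?U"
    by (intro coxeter_eq_append)
  also have "\<dots> \<doteq> []" using sign_words_square[of 0] by simp
  finally show ?thesis by (simp only: mult_2 replicate_add concat_append)
qed

end

lemma coxeter_power_B:
  assumes "1 \<le> n"
  shows "coxeter_eq n (matrix_B n) (word_power [0..<n] (2 * n)) []"
proof -
  obtain N where n: "n = Suc N" using assms by (cases n) auto
  interpret linear_diagram_B N "\<lambda>i. if i + 2 = n then 4 else 3"
    by unfold_locales (auto simp: n)
  show ?thesis using power_eq_Nil by (simp add: matrix_B_def n)
qed

text \<open>
  The overlaps of left-hand sides were found by Knuth--Bendix completion for the shortlex order; resolving
  them in turn yields enough rules to reduce the power of the Coxeter element to the empty word.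
\<close>

lemma coxeter_power_F4: "coxeter_eq 4 matrix_F (word_power [0..<4] 12) []"
  unfolding matrix_F_def
proof (rule linear_coxeter_power_by_rewriting)
  let ?C = "[([3,2], [3], [1]),
      ([3,2,1], [3], [0]),
      ([2,1,2], [1], [0,1]),
      ([3,2,1], [3], [2,3]),
      ([3,2,1,0], [3], [2,3]),
      ([3,2,1,0,2,3], [2], [1,2,1]),
      ([3,2,1,0,2,1], [3,2,1,2], [3,2])] :: (nat list \<times> nat list \<times> nat list) list"
  show "list_all (\<lambda>(u, v, w). list_all (\<lambda>i. i < 4) (u @ v @ w)) ?C" by simp
  show "normal_form (fold add_critical_pair ?C (braid_rules 4 (linear_coxeter_matrix (\<lambda>i. if i = 1 then 4 else 3))))
    (word_power [0..<4] 12) = []"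
    by code_simp
qed simp

lemma coxeter_power_H3: "coxeter_eq 3 matrix_H (word_power [0..<3] 10) []"
  unfolding matrix_H_def
proof (rule linear_coxeter_power_by_rewriting)
  let ?C = "[([2,1], [2], [0]),
      ([2,1,0], [2], [1,2])] :: (nat list \<times> nat list \<times> nat list) list"
  show "list_all (\<lambda>(u, v, w). list_all (\<lambda>i. i < 3) (u @ v @ w)) ?C" by simp
  show "normal_form (fold add_critical_pair ?C (braid_rules 3 (linear_coxeter_matrix (\<lambda>i. if i = 0 then 5 else 3))))
    (word_power [0..<3] 10) = []"
    by code_simp
qed simp

lemma coxeter_power_H4: "coxeter_eq 4 matrix_H (word_power [0..<4] 30) []"
  unfolding matrix_H_def
proof (rule linear_coxeter_power_by_rewriting)
  let ?C = "[([2,1], [2], [0]),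
      ([3,2], [3], [1]),
      ([3,2,1], [3], [0]),
      ([2,1,0], [2], [1,2]),
      ([3,2,1,0], [3], [1]),
      ([3,2,1,0,1], [3], [0]),
      ([3,2,1,0,1], [3], [2,3]),
      ([3,2,1,0,1,0], [3], [2,3]),
      ([2,1,0,1,2], [1], [0,1,0,1]),
      ([3,2,1,0,1,0,2,3], [2], [1,2]),
      ([3,2,1,0,1,0,2,1,3,2], [1], [0,1,0,1]),
      ([3,2,1,0,1,0,2,1,0,3], [2,1,0,1,0], [2,1,0,1,0]),
      ([3,2,1,0,1,0,2,1,0,1], [3,2,1,0,1,0,2,1,0,1], [3,2,1,0,1,0,2,1,0,1]),
      ([3,2,1,0,1,0,2,1,0,1,2,3,2,1,0,1,0,2,1,0,1], [3,2,1,0,1,0,2,1,0], [3,2,1,0,1,0]),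
      ([3,2,1,0,1,0,2,1,0,1,2,3,2,1,0,1,0,2,1,0,1,2,3,2,1,0,1,0,2,1,0,3], [2,1,0,1], [2,1]),
      ([3,2,1,0,1,0,2,1,0,1,2,3,2,1,0,1,0,2,1,0,1,2,3,2,1,0,1,0,2,1,0,1], [3,2,1,0,1,2], [3,2])] :: (nat list \<times> nat list \<times> nat list) list"
  show "list_all (\<lambda>(u, v, w). list_all (\<lambda>i. i < 4) (u @ v @ w)) ?C" by simp
  show "normal_form (fold add_critical_pair ?C (braid_rules 4 (linear_coxeter_matrix (\<lambda>i. if i = 0 then 5 else 3))))
    (word_power [0..<4] 30) = []"
    by code_simp
qed simp

section \<open>Zigzags in regular face posets\<close>

text \<open>The equivalence, rather than an implication, makes the inverse map preserve faces
  too.\<close>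

definition face_automorphism :: "nat \<Rightarrow> (nat \<Rightarrow> 'a set set) \<Rightarrow> ('a \<Rightarrow> 'a) \<Rightarrow> bool" where
  "face_automorphism n P g \<longleftrightarrow> bij g \<and> (\<forall>k<n. \<forall>X. g ` X \<in> P k \<longleftrightarrow> X \<in> P k)"

lemma image_compose_eq: "(f \<circ> g) ` A = f ` g ` A"
  by (simp only: image_comp)

lemma face_automorphism_id: "face_automorphism n P id"
  by (simp add: face_automorphism_def)

lemma face_automorphism_comp:
  "face_automorphism n P g \<Longrightarrow> face_automorphism n P h \<Longrightarrow> face_automorphism n P (g \<circ> h)"
  unfolding face_automorphism_def image_compose_eq by (simp add: bij_comp)

lemma face_automorphism_word_map:
  "(\<And>i. i < n \<Longrightarrow> face_automorphism n P (r i)) \<Longrightarrow> w \<in> lists {..<n} \<Longrightarrow> face_automorphism n P (word_map r w)"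
proof (induction w)
  case Nil
  show ?case by (simp only: word_map_Nil face_automorphism_id)
next
  case (Cons i w)
  then show ?case unfolding word_map_Cons by (intro face_automorphism_comp) auto
qed

lemma face_automorphism_flags:
  assumes "face_automorphism n P g"
  shows "map (image g) X \<in> flags n P \<longleftrightarrow> X \<in> flags n P"
proof (cases "length X = n")
  case True
  have "inj g" using assms by (simp add: face_automorphism_def bij_def)
  then have "g ` A \<subset> g ` B \<longleftrightarrow> A \<subset> B" for A B
    by (simp add: image_strict_mono inj_image_subset_iff psubset_eq inj_image_eq_iff)
  then show ?thesis
    using assms True by (auto simp: flags_def face_automorphism_def)
qed (simp add: flags_def)

text \<open>\<open>diamond\<close> is demanded at the base flag alone; \<open>transitive\<close>
  carries it to all others. \<open>rigid\<close> speaks of words, since a general automorphism may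
  also permute points outside the polytope.\<close>

locale regular_flags =
  fixes n :: nat and P :: "nat \<Rightarrow> 'a set set" and r :: "nat \<Rightarrow> 'a \<Rightarrow> 'a" and F :: "nat \<Rightarrow> 'a set"
  assumes base_face: "k < n \<Longrightarrow> F k \<in> P k"
    and base_chain: "Suc k < n \<Longrightarrow> F k \<subset> F (Suc k)"
    and automorphism: "i < n \<Longrightarrow> face_automorphism n P (r i)"
    and move_same: "i < n \<Longrightarrow> k < n \<Longrightarrow> k \<noteq> i \<Longrightarrow> r i ` F k = F k"
    and move_other: "i < n \<Longrightarrow> r i ` F i \<noteq> F i"
    and diamond: "Y \<in> flags n P \<Longrightarrow> i < n \<Longrightarrow> (\<And>k. k < n \<Longrightarrow> k \<noteq> i \<Longrightarrow> Y ! k = F k) \<Longrightarrow>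
        Y ! i = F i \<or> Y ! i = r i ` F i"
    and transitive: "X \<in> flags n P \<Longrightarrow> \<exists>g. face_automorphism n P g \<and> (\<forall>k<n. X ! k = g ` F k)"
    and rigid: "w \<in> lists {..<n} \<Longrightarrow> (\<And>k. k < n \<Longrightarrow> word_map r w ` F k = F k) \<Longrightarrow> word_map r w = id"
begin

definition flag :: "('a \<Rightarrow> 'a) \<Rightarrow> 'a set list" where
  "flag g = map (\<lambda>k. g ` F k) [0..<n]"

lemma length_flag [simp]: "length (flag g) = n"
  and nth_flag [simp]: "k < n \<Longrightarrow> flag g ! k = g ` F k"
  by (simp_all add: flag_def)

lemma flag_in_flags: "face_automorphism n P g \<Longrightarrow> flag g \<in> flags n P"
proof -
  assume g: "face_automorphism n P g"
  have "flag id \<in> flags n P" using base_face base_chain by (simp add: flags_def)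
  moreover have "flag g = map (image g) (flag id)" by (simp add: flag_def)
  ultimately show ?thesis using face_automorphism_flags[OF g] by simp
qed

text \<open>Automorphisms commute with passing to the adjacent flag: a competitor is pulled back by
  \<open>g\<close> to the base flag, where \<open>diamond\<close> leaves one choice. The move
  therefore multiplies \<open>g\<close> on the right.\<close>

lemma flag_swap_flag:
  assumes g: "face_automorphism n P g" and i: "i < n"
  shows "flag_swap n P i (flag g) = flag (g \<circ> r i)"
  unfolding flag_swap_def
proof (rule the_equality)
  have bij: "bij g" using g by (simp add: face_automorphism_def)
  then have "inj g" by (simp add: bij_def)
  have "flag (g \<circ> r i) \<in> flags n P"
    by (rule flag_in_flags[OF face_automorphism_comp[OF g automorphism[OF i]]])
  moreover have nth: "flag (g \<circ> r i) ! j = g ` r i ` F j" if "j < n" for j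
    unfolding nth_flag[OF that] image_compose_eq ..
  ultimately show "flag (g \<circ> r i) \<in> flags n P \<and> flag (g \<circ> r i) ! i \<noteq> flag g ! i \<and>
      (\<forall>j<n. j \<noteq> i \<longrightarrow> flag (g \<circ> r i) ! j = flag g ! j)"
    using move_same[OF i] move_other[OF i] \<open>inj g\<close> i by (simp add: inj_image_eq_iff)
  fix Y assume Y: "Y \<in> flags n P \<and> Y ! i \<noteq> flag g ! i \<and> (\<forall>j<n. j \<noteq> i \<longrightarrow> Y ! j = flag g ! j)"
  then have lY: "length Y = n" by (simp add: flags_def)
  define Z where "Z = map (image (inv_into UNIV g)) Y"
  have gZ: "map (image g) Z = Y"
    unfolding Z_def map_map using bij by (intro map_idI) (simp add: image_f_inv_f bij_is_surj)
  have Zk: "Y ! k = g ` (Z ! k)" if "k < n" for k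
    using that lY unfolding gZ[symmetric] by simp
  have "Z \<in> flags n P" using face_automorphism_flags[OF g, of Z] gZ Y by simp
  moreover have Zj: "Z ! j = F j" if "j < n" "j \<noteq> i" for j
    using Y Zk[of j] that \<open>inj g\<close> by (simp add: inj_image_eq_iff)
  moreover have "Z ! i \<noteq> F i" using Y Zk[OF i] i by auto
  ultimately have Zi: "Z ! i = r i ` F i" using diamond[OF _ i] by blast
  show "Y = flag (g \<circ> r i)"
  proof (rule nth_equalityI)
    fix k assume "k < length Y"
    then show "Y ! k = flag (g \<circ> r i) ! k"
      using lY Zk[of k] Zj[of k] Zi move_same[OF i] nth[of k] by (cases "k = i") simp_all
  qed (simp add: lY)
qed

text \<open>Since moves multiply on the right, the swap performed first stands leftmost in the word,
  although the swaps themselves compose in the opposite order.\<close>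

lemma fold_flag_swap:
  assumes "face_automorphism n P g" "\<forall>k\<in>set ks. \<delta> k < n"
  shows "fold (\<lambda>k. flag_swap n P (\<delta> k)) ks (flag g) = flag (g \<circ> word_map r (map \<delta> ks))"
  using assms
proof (induction ks arbitrary: g)
  case (Cons k ks)
  then have k: "\<delta> k < n" by simp
  have "fold (\<lambda>k. flag_swap n P (\<delta> k)) (k # ks) (flag g)
      = fold (\<lambda>k. flag_swap n P (\<delta> k)) ks (flag (g \<circ> r (\<delta> k)))"
    using Cons.prems by (simp only: fold_simps flag_swap_flag[OF Cons.prems(1) k])
  also have "\<dots> = flag (g \<circ> r (\<delta> k) \<circ> word_map r (map \<delta> ks))"
    using Cons.prems by (intro Cons.IH face_automorphism_comp automorphism[OF k]) simp_all
  finally show ?case by (simp only: list.map word_map_Cons comp_assoc)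
qed (simp only: list.map word_map_Nil fold_simps comp_id)

lemma zigzag_length_eq:
  assumes \<delta>: "\<delta> permutes {..<n}" and X: "X \<in> flags n P" and "0 < h"
    and h: "\<And>k. word_map r (map \<delta> [0..<n]) ^^ k = id \<longleftrightarrow> h dvd k"
  shows "zigzag_length n P \<delta> X = h"
proof -
  let ?w = "map \<delta> [0..<n]"
  have w: "?w \<in> lists {..<n}" and \<delta>n: "\<forall>k\<in>set [0..<n]. \<delta> k < n"
    using permutes_in_image[OF \<delta>] by (auto simp: in_lists_conv_set)
  obtain g where g: "face_automorphism n P g" "\<forall>k<n. X ! k = g ` F k"
    using transitive[OF X] by blast
  have "length X = n" using X by (simp add: flags_def)
  then have Xg: "X = flag g" using g(2) by (intro nth_equalityI) simp_all
  have iter: "(zigzag_map n P \<delta> ^^ l) X = flag (g \<circ> word_map r ?w ^^ l)" for l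
  proof (induction l)
    case (Suc l)
    have "face_automorphism n P (g \<circ> word_map r (word_power ?w l))"
      by (intro face_automorphism_comp g face_automorphism_word_map automorphism word_power_in_lists w)
    then have g': "face_automorphism n P (g \<circ> word_map r ?w ^^ l)" by (simp only: word_map_power)
    have "(zigzag_map n P \<delta> ^^ Suc l) X = zigzag_map n P \<delta> ((zigzag_map n P \<delta> ^^ l) X)" by simp
    also have "\<dots> = zigzag_map n P \<delta> (flag (g \<circ> word_map r ?w ^^ l))" by (simp only: Suc)
    also have "\<dots> = flag (g \<circ> word_map r ?w ^^ l \<circ> word_map r ?w)"
      unfolding zigzag_map_def by (rule fold_flag_swap[OF g' \<delta>n])
    finally show ?case by (simp only: comp_assoc funpow_Suc_right)
  qed (use Xg in simp)
  \<comment> \<open>Cancelling the injective \<open>g\<close> leaves a word that fixes the base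
    flag, and \<open>rigid\<close> makes it the identity.\<close>
  have period: "(zigzag_map n P \<delta> ^^ l) X = X \<longleftrightarrow> h dvd l" for l
  proof
    assume "(zigzag_map n P \<delta> ^^ l) X = X"
    then have "flag (g \<circ> word_map r ?w ^^ l) = flag g" using iter[of l] Xg by simp
    then have "(g \<circ> word_map r ?w ^^ l) ` F k = g ` F k" if "k < n" for k
      using that nth_flag by metis
    moreover have "inj g" using g(1) by (simp add: face_automorphism_def bij_def)
    ultimately have "(word_map r ?w ^^ l) ` F k = F k" if "k < n" for k
      using that unfolding image_compose_eq by (simp add: inj_image_eq_iff)
    then have "word_map r ?w ^^ l = id"
      using rigid[OF word_power_in_lists[OF w, of l]] by (simp only: word_map_power)
    then show "h dvd l" using h by simp
  next
    assume "h dvd l"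
    then have "word_map r ?w ^^ l = id" using h by simp
    then show "(zigzag_map n P \<delta> ^^ l) X = X" unfolding iter using Xg by simp
  qed
  then show ?thesis
    unfolding zigzag_length_def using \<open>0 < h\<close> by (intro Least_equality) (auto intro: dvd_imp_le)
qed

text \<open>
  \<open>\<rho>\<close> numbers the nodes of the diagram, which may run against the ranks of the faces.
\<close>

lemma zigzag_length_eq_coxeter_number:
  fixes e :: "nat \<Rightarrow> nat"
  defines "m \<equiv> linear_coxeter_matrix e"
  assumes "0 < h" and pow: "coxeter_eq n m (word_power [0..<n] h) []"
    and rep: "coxeter_rep n m (r \<circ> \<rho>)" and \<rho>: "\<rho> permutes {..<n}"
    and low: "\<And>k. 0 < k \<Longrightarrow> k < h \<Longrightarrow> word_map r [0..<n] ^^ k \<noteq> id"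
  shows "\<delta> permutes {..<n} \<Longrightarrow> X \<in> flags n P \<Longrightarrow> zigzag_length n P \<delta> X = coxeter_number n m"
    and "coxeter_number n m = h"
proof -
  have \<rho>': "inv_into UNIV \<rho> permutes {..<n}" by (rule permutes_inv[OF \<rho>])
  \<comment> \<open>Words in ranks become words in nodes under the inverse relabelling; both
    describe the same map.\<close>
  have tr: "word_map (r \<circ> \<rho>) (map (inv_into UNIV \<rho>) w) = word_map r w" for w
    using permutes_inverses(1)[OF \<rho>] by (simp add: word_map_map comp_assoc o_def)
  let ?w0 = "map (inv_into UNIV \<rho>) [0..<n]"
  have w0: "distinct ?w0" "set ?w0 = {..<n}" by (rule permutes_word[OF \<rho>'])+
  have low': "word_map (r \<circ> \<rho>) ?w0 ^^ k \<noteq> id" if "0 < k" "k < h" for k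
    using low[OF that] tr by simp
  show *: "coxeter_number n m = h"
    using linear_coxeter_number[of h n e, folded m_def, OF \<open>0 < h\<close> pow rep w0 low'] .
  assume \<delta>: "\<delta> permutes {..<n}" and X: "X \<in> flags n P"
  have "word_map (r \<circ> \<rho>) (map (inv_into UNIV \<rho>) (map \<delta> [0..<n])) ^^ k = id \<longleftrightarrow> h dvd k" for k
  proof (rule linear_coxeter_powers(1)[of h n e, folded m_def, OF \<open>0 < h\<close> pow rep w0 low'])
    show "distinct (map (inv_into UNIV \<rho>) (map \<delta> [0..<n]))" "set (map (inv_into UNIV \<rho>) (map \<delta> [0..<n])) = {..<n}"
      using permutes_word[OF permutes_compose[OF \<delta> \<rho>']] by simp_all
  qed
  then show "zigzag_length n P \<delta> X = coxeter_number n m"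
    unfolding * tr by (intro zigzag_length_eq[OF \<delta> X \<open>0 < h\<close>]) simp
qed

end

text \<open>The product in the other order is the conjugate by \<open>t\<close>.\<close>

lemma involution_pow_swap:
  assumes "s \<circ> s = id" "t \<circ> t = id" "(s \<circ> t) ^^ k = id"
  shows "(t \<circ> s) ^^ k = id"
proof -
  have *: "(t \<circ> s) ^^ k = t \<circ> (s \<circ> t) ^^ k \<circ> t" for k
  proof (induction k)
    case (Suc k)
    have "(t \<circ> s) ^^ Suc k = t \<circ> s \<circ> t \<circ> (s \<circ> t) ^^ k \<circ> t"
      by (simp only: Suc funpow.simps comp_assoc)
    then show ?case by (simp only: funpow.simps comp_assoc)
  qed (simp only: funpow.simps comp_id assms)
  show ?thesis by (simp only: * assms comp_id)
qed

lemma coxeter_rep_linearI: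
  assumes inv: "\<And>i. i < n \<Longrightarrow> r i \<circ> r i = id"
    and near: "\<And>i. Suc i < n \<Longrightarrow> (r i \<circ> r (Suc i)) ^^ e i = id"
    and far: "\<And>i j. Suc i < j \<Longrightarrow> j < n \<Longrightarrow> r i \<circ> r j = r j \<circ> r i"
  shows "coxeter_rep n (linear_coxeter_matrix e) r"
  unfolding coxeter_rep_def
proof (intro allI impI)
  fix i j assume ij: "i < n" "j < n"
  have comm: "(r i \<circ> r j) ^^ 2 = id" if "r i \<circ> r j = r j \<circ> r i"
  proof -
    have "(r i \<circ> r j) ^^ 2 = r i \<circ> (r j \<circ> r i) \<circ> r j"
      by (simp only: numeral_2_eq_2 funpow.simps comp_assoc comp_id)
    also have "\<dots> = (r i \<circ> r i) \<circ> (r j \<circ> r j)"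
      unfolding that[symmetric] by (simp only: comp_assoc)
    finally show ?thesis by (simp only: inv ij comp_id)
  qed
  consider "i = j" | "j = Suc i" | "i = Suc j" | "Suc i < j" | "Suc j < i"
    by linarith
  then show "(r i \<circ> r j) ^^ linear_coxeter_matrix e i j = id"
  proof cases
    case 1
    then show ?thesis using inv[OF ij(1)] by (simp add: linear_coxeter_matrix_def del: o_apply)
  next
    case 2
    then show ?thesis using near[of i] ij by (simp add: linear_coxeter_matrix_def)
  next
    case 3
    then have "Suc j < n" using ij by simp
    from involution_pow_swap[OF inv[OF ij(2)] inv[OF this] near[OF this]] show ?thesis
      using 3 by (simp add: linear_coxeter_matrix_def)
  next
    case 4
    then show ?thesis using comm far[OF 4 ij(2)] by (simp add: linear_coxeter_matrix_far)
  next
    case 5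
    then show ?thesis using comm far[OF 5 ij(1)] by (simp add: linear_coxeter_matrix_far)
  qed
qed

section \<open>The simplex\<close>

lemma between_insert_two:
  assumes "B \<subseteq> A" "A \<subseteq> insert x (insert y B)" "card A = Suc (card B)" "finite B"
  shows "A = insert x B \<or> A = insert y B"
proof -
  have "card (A - B) = 1" using assms by (simp add: card_Diff_subset)
  then obtain z where z: "A - B = {z}" by (rule card_1_singletonE)
  then have "z = x \<or> z = y" using assms(2) by auto
  moreover have "A = insert z B" using z assms(1) by auto
  ultimately show ?thesis by auto
qed

lemma fixed_point_of_difference:
  assumes "inj g" "g ` A = A" "g ` B = B" "B - A = {x}"
  shows "g x = x"
proof -
  have "g ` (B - A) = B - A" using image_set_diff[OF assms(1), of B A] assms(2,3) by simp
  then show ?thesis using assms(4) by simp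
qed

lemma insert_if_card_Suc:
  assumes "B \<subseteq> A" "card A = Suc (card B)" "finite A"
  shows "\<exists>x. x \<notin> B \<and> A = insert x B"
proof -
  have "card (A - B) = 1" using assms finite_subset[OF assms(1,3)] by (simp add: card_Diff_subset)
  then obtain z where "A - B = {z}" by (rule card_1_singletonE)
  then show ?thesis using assms(1) by (intro exI[of _ z]) auto
qed

lemma simplex_face_automorphism:
  assumes "g permutes {1..n+1}"
  shows "face_automorphism n (simplex_faces n) g"
proof -
  have "inj g" by (rule permutes_inj[OF assms])
  moreover have "g ` X \<subset> {1..n+1} \<longleftrightarrow> X \<subset> {1..n+1}" for X
    using inj_image_subset_iff[OF \<open>inj g\<close>, of X "{1..n+1}"] inj_image_eq_iff[OF \<open>inj g\<close>, of X "{1..n+1}"]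
    unfolding permutes_image[OF assms] psubset_eq by blast
  ultimately show ?thesis
    unfolding face_automorphism_def simplex_faces_def simplicial_faces_def
    using permutes_bij[OF assms] card_image[OF inj_on_subset[OF \<open>inj g\<close> subset_UNIV]] by simp
qed

text \<open>The vertex gained at rank \<open>m\<close> is \<open>g y\<close> for some
  \<open>y\<close>. Precomposing with the transposition of \<open>m + 1\<close> and \<open>y\<close>
  sends \<open>m + 1\<close> to it and leaves the lower ranks alone, as both points lie outside
  \<open>{1..m}\<close>.\<close>

lemma simplex_flag_prefix:
  assumes X: "X \<in> flags n (simplex_faces n)" and "m \<le> n"
  shows "\<exists>g. g permutes {1..n+1} \<and> (\<forall>k<m. X ! k = g ` {1..k+1})"
  using assms(2)
proof (induction m)
  case 0
  show ?case using permutes_id by blast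
next
  case (Suc m)
  then obtain g where g: "g permutes {1..n+1}" "\<forall>k<m. X ! k = g ` {1..k+1}" by auto
  have inj: "inj g" by (rule permutes_inj[OF g(1)])
  have Xm: "X ! m \<subset> {1..n+1}" "card (X ! m) = Suc m"
    using X Suc.prems by (auto simp: flags_def simplex_faces_def simplicial_faces_def)
  have "g ` {1..m} \<subseteq> X ! m"
  proof (cases m)
    case (Suc l)
    then have "X ! l \<subset> X ! m" using X \<open>Suc m \<le> n\<close> by (simp add: flags_def)
    then show ?thesis using g(2) Suc by simp
  qed simp
  moreover have "card (g ` {1..m}) = m" using inj by (simp add: card_image inj_on_subset)
  ultimately obtain x where x: "x \<notin> g ` {1..m}" "X ! m = insert x (g ` {1..m})"
    using insert_if_card_Suc[of "g ` {1..m}" "X ! m"] Xm finite_subset[of "X ! m" "{1..n+1}"] by auto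
  then have "x \<in> g ` {1..n+1}" using Xm unfolding permutes_image[OF g(1)] by blast
  then obtain y where y: "x = g y" "y \<in> {1..n+1}" by auto
  let ?t = "Transposition.transpose (m + 1) y" and ?g = "g \<circ> Transposition.transpose (m + 1) y"
  have ym: "y \<notin> {1..m}" using x y by auto
  have t: "?t ` A = A" if "A \<subseteq> {1..m}" for A
    using that ym by (force simp: Transposition.transpose_def image_iff)
  have "?g permutes {1..n+1}"
    using g(1) y(2) Suc.prems by (intro permutes_compose permutes_swap_id) auto
  moreover have "X ! k = ?g ` {1..k+1}" if "k < Suc m" for k
  proof (cases "k = m")
    case True
    have "{1..m + 1} = insert (m + 1) {1..m}" by auto
    then have "?t ` {1..m + 1} = insert y {1..m}"
      using t[of "{1..m}"] by simp
    then show ?thesis unfolding image_compose_eq True x(2) y(1) by simp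
  next
    case False
    then show ?thesis unfolding image_compose_eq using t[of "{1..k+1}"] g(2) that by simp
  qed
  ultimately show ?case by blast
qed

definition simplex_move :: "nat \<Rightarrow> nat \<Rightarrow> nat" where
  "simplex_move i = Transposition.transpose (i + 1) (i + 2)"

lemma simplex_move_permutes: "i < n \<Longrightarrow> simplex_move i permutes {1..n+1}"
  unfolding simplex_move_def by (rule permutes_swap_id) auto

lemma simplex_move_image: "k \<noteq> i \<Longrightarrow> simplex_move i ` {1..k+1} = {1..k+1}"
  by (cases "k < i") (auto simp: simplex_move_def Transposition.transpose_def image_iff intro: permutes_image)

lemma simplex_move_image_same: "simplex_move i ` {1..i+1} = insert (i + 2) {1..i}"
proof -
  have "{1..i+1} = insert (i + 1) {1..i}" by auto
  moreover have "simplex_move i ` {1..i} = {1..i}" by (auto simp: simplex_move_def Transposition.transpose_def image_iff)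
  ultimately show ?thesis by (simp add: simplex_move_def)
qed

lemma simplex_word_map_permutes:
  "w \<in> lists {..<n} \<Longrightarrow> word_map simplex_move w permutes {1..n+1}"
proof (induction w)
  case Nil
  show ?case unfolding word_map_Nil by (rule permutes_id)
next
  case (Cons i w)
  then show ?case unfolding word_map_Cons by (intro permutes_compose simplex_move_permutes) auto
qed

interpretation simplex: regular_flags n "simplex_faces n" simplex_move "\<lambda>k. {1..k+1}" for n
proof
  show "{1..k+1} \<in> simplex_faces n k" if "k < n" for k
    using that by (auto simp: simplex_faces_def simplicial_faces_def)
  show "{1..k+1} \<subset> {1..Suc k + 1}" for k :: nat by auto
  show "face_automorphism n (simplex_faces n) (simplex_move i)" if "i < n" for i
    by (rule simplex_face_automorphism[OF simplex_move_permutes[OF that]])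
  show "simplex_move i ` {1..k+1} = {1..k+1}" if "k \<noteq> i" for i k
    by (rule simplex_move_image[OF that])
  show "simplex_move i ` {1..i+1} \<noteq> {1..i+1}" for i
  proof -
    have "i + 2 \<notin> {1..i+1}" by simp
    then show ?thesis unfolding simplex_move_image_same by blast
  qed
  show "\<exists>g. face_automorphism n (simplex_faces n) g \<and> (\<forall>k<n. X ! k = g ` {1..k+1})"
    if "X \<in> flags n (simplex_faces n)" for X
    using simplex_flag_prefix[OF that order.refl] simplex_face_automorphism by blast
next
  fix Y i assume Y: "Y \<in> flags n (simplex_faces n)" and i: "i < n"
    and same: "\<And>k. k < n \<Longrightarrow> k \<noteq> i \<Longrightarrow> Y ! k = {1..k+1}"
  have Yi: "Y ! i \<subset> {1..n+1}" "card (Y ! i) = Suc i"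
    using Y i by (auto simp: flags_def simplex_faces_def simplicial_faces_def)
  have chain: "Y ! k \<subset> Y ! Suc k" if "Suc k < n" for k
    using Y that by (simp add: flags_def)
  have "{1..i} \<subseteq> Y ! i"
    using chain[of "i - 1"] same[of "i - 1"] i by (cases i) auto
  moreover have "Y ! i \<subseteq> {1..i+2}"
  proof (cases "Suc i < n")
    case True
    then have "Y ! i \<subset> {1..Suc i + 1}" using chain[OF True] same[OF True] by simp
    then show ?thesis by auto
  next
    case False
    \<comment> \<open>At the top rank no member lies above, and the full vertex set gives the bound
      instead.\<close>
    then have "n + 1 = i + 2" using i by simp
    then show ?thesis using Yi(1) by (metis psubset_imp_subset)
  qed
  then have "Y ! i \<subseteq> insert (i + 1) (insert (i + 2) {1..i})" by force
  ultimately have "Y ! i = insert (i + 1) {1..i} \<or> Y ! i = insert (i + 2) {1..i}"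
    using Yi(2) by (intro between_insert_two) auto
  moreover have "{1..i+1} = insert (i + 1) {1..i}" by auto
  ultimately show "Y ! i = {1..i+1} \<or> Y ! i = simplex_move i ` {1..i+1}"
    unfolding simplex_move_image_same by metis
next
  fix w assume w: "w \<in> lists {..<n}" and fixes_flag: "\<And>k. k < n \<Longrightarrow> word_map simplex_move w ` {1..k+1} = {1..k+1}"
  let ?g = "word_map simplex_move w"
  have g: "?g permutes {1..n+1}" by (rule simplex_word_map_permutes[OF w])
  \<comment> \<open>The empty set and the full vertex set complete the flag, so that every vertex is
    the difference of two consecutive sets.\<close>
  have im: "?g ` {1..k} = {1..k}" if k: "k \<le> n + 1" for k
  proof -
    consider "k = 0" | "k = n + 1" | "k = (k - 1) + 1" "k - 1 < n"
      using k by linarith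
    then show ?thesis
    proof cases
      case 3
      from fixes_flag[OF 3(2)] show ?thesis unfolding 3(1)[symmetric] .
    qed (simp, simp only: permutes_image[OF g])
  qed
  show "?g = id"
  proof
    fix x
    show "?g x = id x"
    proof (cases "x \<in> {1..n+1}")
      case True
      then have "{1..x} - {1..x - 1} = {x}" and x: "x \<le> n + 1" "x - 1 \<le> n + 1" by auto
      then have "?g x = x" by (intro fixed_point_of_difference[OF permutes_inj[OF g] im[OF x(2)] im[OF x(1)]])
      then show ?thesis by simp
    next
      case False
      show ?thesis using permutes_not_in[OF g False] by simp
    qed
  qed
qed

text \<open>The product of the adjacent transpositions is the cycle 1 -> 2 -> ... -> m + 1 ->
  1.\<close>

lemma simplex_word_map_upt:
  "word_map simplex_move [0..<m] x = (if x = 0 \<or> m + 1 < x then x else if x = m + 1 then 1 else x + 1)"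
proof (induction m arbitrary: x)
  case (Suc m)
  show ?case using Suc by (auto simp: simplex_move_def Transposition.transpose_def)
qed auto

lemma simplex_coxeter_rep: "coxeter_rep n matrix_A simplex_move"
  unfolding matrix_A_def
proof (rule coxeter_rep_linearI)
  show "simplex_move i \<circ> simplex_move i = id" for i
    by (auto simp: fun_eq_iff simplex_move_def)
  show "(simplex_move i \<circ> simplex_move (Suc i)) ^^ 3 = id" for i
    by (auto simp: fun_eq_iff simplex_move_def Transposition.transpose_def eval_nat_numeral)
  show "simplex_move i \<circ> simplex_move j = simplex_move j \<circ> simplex_move i" if "Suc i < j" for i j
    using that by (auto simp: fun_eq_iff simplex_move_def Transposition.transpose_def)
qed

text \<open>Vertex 1 runs through all \<open>n + 1\<close> vertices before it returns.\<close>

lemma simplex_powers_ne_id: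
  assumes "0 < k" "k < n + 1"
  shows "word_map simplex_move [0..<n] ^^ k \<noteq> id"
proof -
  have "j \<le> n \<Longrightarrow> (word_map simplex_move [0..<n] ^^ j) 1 = 1 + j" for j
    by (induction j) (auto simp: simplex_word_map_upt)
  from this[of k] show ?thesis using assms by (auto simp: fun_eq_iff intro!: exI[of _ 1])
qed

lemmas simplex_zigzag =
  simplex.zigzag_length_eq_coxeter_number[where h = "n + 1" and e = "\<lambda>_. 3" and \<rho> = id and n = n for n,
    folded matrix_A_def, unfolded comp_id, OF _ coxeter_power_A simplex_coxeter_rep permutes_id
    simplex_powers_ne_id, simplified]

section \<open>The cross-polytope\<close>

definition signed_swap :: "int \<Rightarrow> int \<Rightarrow> int \<Rightarrow> int" where
  "signed_swap a b x = (if x = a then b else if x = b then a else if x = - a then - b else if x = - b then - a else x)"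

text \<open>For \<open>b = - a\<close> this is the sign change of \<open>a\<close>.\<close>

definition cross_vertices :: "nat \<Rightarrow> int set" where
  "cross_vertices n = {- int n..int n} - {0}"

definition signed_permutation :: "nat \<Rightarrow> (int \<Rightarrow> int) \<Rightarrow> bool" where
  "signed_permutation n g \<longleftrightarrow> g permutes cross_vertices n \<and> (\<forall>x. g (- x) = - g x)"

lemma signed_permutation_id: "signed_permutation n id"
  by (simp add: signed_permutation_def permutes_id)

lemma signed_permutation_comp:
  "signed_permutation n g \<Longrightarrow> signed_permutation n h \<Longrightarrow> signed_permutation n (g \<circ> h)"
  by (simp add: signed_permutation_def permutes_compose)

lemma signed_swap_involution: "a \<noteq> 0 \<Longrightarrow> b \<noteq> 0 \<Longrightarrow> signed_swap a b (signed_swap a b x) = x"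
  by (auto simp: signed_swap_def)

lemma signed_permutation_signed_swap:
  assumes "a \<in> cross_vertices n" "b \<in> cross_vertices n"
  shows "signed_permutation n (signed_swap a b)"
proof -
  have ab: "a \<noteq> 0" "b \<noteq> 0" using assms by (auto simp: cross_vertices_def)
  have "signed_swap a b permutes cross_vertices n"
  proof (rule bij_imp_permutes)
    have "signed_swap a b ` cross_vertices n \<subseteq> cross_vertices n"
      using assms by (auto simp: signed_swap_def cross_vertices_def)
    then show "bij_betw (signed_swap a b) (cross_vertices n) (cross_vertices n)"
      using signed_swap_involution[OF ab] by (intro bij_betwI[where g = "signed_swap a b"]) auto
    show "signed_swap a b x = x" if "x \<notin> cross_vertices n" for x
      using assms that by (auto simp: signed_swap_def cross_vertices_def)
  qed
  moreover have "signed_swap a b (- x) = - signed_swap a b x" for x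
    using ab by (auto simp: signed_swap_def)
  ultimately show ?thesis by (simp add: signed_permutation_def)
qed

lemma cross_faces_iff:
  "X \<in> cross_polytope_faces n k \<longleftrightarrow> X \<subseteq> cross_vertices n \<and> (\<forall>i. \<not> (i \<in> X \<and> - i \<in> X)) \<and> card X = Suc k"
  by (auto simp: cross_polytope_faces_def simplicial_faces_def cross_vertices_def)

lemma cross_face_automorphism:
  assumes "signed_permutation n g"
  shows "face_automorphism n (cross_polytope_faces n) g"
proof -
  have g: "g permutes cross_vertices n" and odd: "g (- x) = - g x" for x
    using assms by (auto simp: signed_permutation_def)
  have inj: "inj g" by (rule permutes_inj[OF g])
  have sub: "g ` X \<subseteq> cross_vertices n \<longleftrightarrow> X \<subseteq> cross_vertices n" for X
    using inj_image_subset_iff[OF inj, of X "cross_vertices n"] unfolding permutes_image[OF g] .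
  have "i \<in> g ` X \<and> - i \<in> g ` X \<longleftrightarrow> (\<exists>x. i = g x \<and> x \<in> X \<and> - x \<in> X)" for i X
  proof
    assume "i \<in> g ` X \<and> - i \<in> g ` X"
    then obtain x y where xy: "i = g x" "x \<in> X" "- i = g y" "y \<in> X" by auto
    then have "g y = g (- x)" unfolding odd[of x] by simp
    then have "y = - x" by (rule injD[OF inj])
    then show "\<exists>x. i = g x \<and> x \<in> X \<and> - x \<in> X" using xy by blast
  next
    assume "\<exists>x. i = g x \<and> x \<in> X \<and> - x \<in> X"
    then show "i \<in> g ` X \<and> - i \<in> g ` X" using odd by (metis imageI)
  qed
  then have anti: "(\<forall>i. \<not> (i \<in> g ` X \<and> - i \<in> g ` X)) \<longleftrightarrow> (\<forall>i. \<not> (i \<in> X \<and> - i \<in> X))" for X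
    by metis
  show ?thesis
    unfolding face_automorphism_def cross_faces_iff sub anti
    using permutes_bij[OF g] card_image[OF inj_on_subset[OF inj subset_UNIV]] by simp
qed

lemma cross_flag_prefix:
  assumes X: "X \<in> flags n (cross_polytope_faces n)" and "m \<le> n"
  shows "\<exists>g. signed_permutation n g \<and> (\<forall>k<m. X ! k = g ` {1..int k+1})"
  using assms(2)
proof (induction m)
  case 0
  show ?case using signed_permutation_id by blast
next
  case (Suc m)
  then obtain g where g: "signed_permutation n g" "\<forall>k<m. X ! k = g ` {1..int k+1}" by auto
  have gp: "g permutes cross_vertices n" and odd: "g (- x) = - g x" for x
    using g(1) by (auto simp: signed_permutation_def)
  have inj: "inj g" by (rule permutes_inj[OF gp])
  have "X ! m \<in> cross_polytope_faces n m"
    using X Suc.prems by (simp add: flags_def)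
  then have Xm: "X ! m \<subseteq> cross_vertices n" "card (X ! m) = Suc m" "\<And>i. \<not> (i \<in> X ! m \<and> - i \<in> X ! m)"
    by (auto simp: cross_faces_iff)
  have "g ` {1..int m} \<subseteq> X ! m"
  proof (cases m)
    case (Suc l)
    then have "X ! l \<subset> X ! m" using X \<open>Suc m \<le> n\<close> by (simp add: flags_def)
    then show ?thesis using g(2) Suc by (simp add: add.commute)
  qed simp
  moreover have "card (g ` {1..int m}) = m" using inj by (simp add: card_image inj_on_subset)
  moreover have "finite (X ! m)" using Xm(2) card.infinite by fastforce
  ultimately obtain x where x: "x \<notin> g ` {1..int m}" "X ! m = insert x (g ` {1..int m})"
    using insert_if_card_Suc[of "g ` {1..int m}" "X ! m"] Xm(2) by auto
  then have "x \<in> g ` cross_vertices n" using Xm unfolding permutes_image[OF gp] by blast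
  then obtain y where y: "x = g y" "y \<in> cross_vertices n" by auto
  have ym: "y \<notin> {1..int m}" using x y by auto
  \<comment> \<open>New in comparison with the simplex: the swap also moves \<open>- y\<close>,
    which must not be among the vertices already placed. This holds because a face contains no
    antipodal pair.\<close>
  have ym': "- y \<notin> {1..int m}"
  proof
    assume "- y \<in> {1..int m}"
    then have "g (- y) \<in> X ! m" unfolding x(2) by blast
    then show False using Xm(3)[of x] odd[of y] x(2) y(1) by auto
  qed
  let ?t = "signed_swap (int m + 1) y" and ?g = "g \<circ> signed_swap (int m + 1) y"
  have t: "?t ` A = A" if A: "A \<subseteq> {1..int m}" for A
  proof -
    have "?t z = z" if "z \<in> A" for z
    proof -
      have "z \<in> {1..int m}" using A that by blast
      then show ?thesis using ym ym' by (auto simp: signed_swap_def)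
    qed
    then show ?thesis by force
  qed
  have "signed_permutation n ?g"
    using g(1) y(2) Suc.prems
    by (intro signed_permutation_comp signed_permutation_signed_swap) (auto simp: cross_vertices_def)
  moreover have "X ! k = ?g ` {1..int k+1}" if "k < Suc m" for k
  proof (cases "k = m")
    case True
    have "{1..int m + 1} = insert (int m + 1) {1..int m}" by auto
    moreover have "?t (int m + 1) = y" by (simp add: signed_swap_def)
    ultimately have "?t ` {1..int m + 1} = insert y {1..int m}"
      using t[of "{1..int m}"] by (simp only: image_insert order.refl)
    then show ?thesis unfolding image_compose_eq True x(2) y(1) by simp
  next
    case False
    then show ?thesis unfolding image_compose_eq using t[of "{1..int k+1}"] g(2) that by simp
  qed
  ultimately show ?case by blast
qed

text \<open>The last move has no vertex \<open>n + 1\<close> to swap with; it exchanges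
  \<open>n\<close> and \<open>- n\<close>.\<close>

definition cross_move :: "nat \<Rightarrow> nat \<Rightarrow> int \<Rightarrow> int" where
  "cross_move n i = signed_swap (int i + 1) (if Suc i = n then - (int i + 1) else int i + 2)"

lemma cross_move_signed_permutation: "i < n \<Longrightarrow> signed_permutation n (cross_move n i)"
  unfolding cross_move_def
  by (intro signed_permutation_signed_swap) (auto simp: cross_vertices_def)

lemma cross_move_image:
  assumes "k < n" "k \<noteq> i" "i < n"
  shows "cross_move n i ` {1..int k+1} = {1..int k+1}"
proof -
  have sub: "cross_move n i ` {1..int k+1} \<subseteq> {1..int k+1}"
    using assms by (auto simp: cross_move_def signed_swap_def)
  moreover have "{1..int k+1} \<subseteq> cross_move n i ` {1..int k+1}"
  proof
    fix x assume "x \<in> {1..int k+1}"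
    then have "cross_move n i x \<in> {1..int k+1}" using sub by blast
    moreover have "cross_move n i (cross_move n i x) = x"
      unfolding cross_move_def by (rule signed_swap_involution) auto
    ultimately show "x \<in> cross_move n i ` {1..int k+1}" by (metis imageI)
  qed
  ultimately show ?thesis by (rule subset_antisym)
qed

lemma cross_move_image_same:
  "cross_move n i ` {1..int i+1} = insert (if Suc i = n then - (int i + 1) else int i + 2) {1..int i}"
proof -
  have "{1..int i+1} = insert (int i + 1) {1..int i}" by auto
  moreover have "cross_move n i ` {1..int i} = {1..int i}"
  proof -
    have "cross_move n i z = z" if "z \<in> {1..int i}" for z
      using that by (auto simp: cross_move_def signed_swap_def)
    then show ?thesis by force
  qed
  moreover have "cross_move n i (int i + 1) = (if Suc i = n then - (int i + 1) else int i + 2)"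
    by (simp add: cross_move_def signed_swap_def)
  ultimately show ?thesis by (simp only: image_insert)
qed

lemma cross_word_map_signed_permutation:
  "w \<in> lists {..<n} \<Longrightarrow> signed_permutation n (word_map (cross_move n) w)"
proof (induction w)
  case Nil
  show ?case unfolding word_map_Nil by (rule signed_permutation_id)
next
  case (Cons i w)
  then show ?case
    unfolding word_map_Cons by (intro signed_permutation_comp cross_move_signed_permutation) auto
qed

interpretation cross: regular_flags n "cross_polytope_faces n" "cross_move n" "\<lambda>k. {1..int k+1}" for n
proof
  show "{1..int k+1} \<in> cross_polytope_faces n k" if "k < n" for k
    using that by (auto simp: cross_faces_iff cross_vertices_def)
  show "{1..int k+1} \<subset> {1..int (Suc k) + 1}" for k :: nat by auto
  show "face_automorphism n (cross_polytope_faces n) (cross_move n i)" if "i < n" for i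
    by (rule cross_face_automorphism[OF cross_move_signed_permutation[OF that]])
  show "cross_move n i ` {1..int k+1} = {1..int k+1}" if "i < n" "k < n" "k \<noteq> i" for i k
    using that by (intro cross_move_image)
  show "cross_move n i ` {1..int i+1} \<noteq> {1..int i+1}" for i
  proof -
    have "(if Suc i = n then - (int i + 1) else int i + 2) \<notin> {1..int i+1}" by simp
    then show ?thesis unfolding cross_move_image_same by blast
  qed
  show "\<exists>g. face_automorphism n (cross_polytope_faces n) g \<and> (\<forall>k<n. X ! k = g ` {1..int k+1})"
    if "X \<in> flags n (cross_polytope_faces n)" for X
    using cross_flag_prefix[OF that order.refl] cross_face_automorphism by blast
next
  fix Y i assume Y: "Y \<in> flags n (cross_polytope_faces n)" and i: "i < n"
    and same: "\<And>k. k < n \<Longrightarrow> k \<noteq> i \<Longrightarrow> Y ! k = {1..int k+1}"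
  let ?b = "if Suc i = n then - (int i + 1) else int i + 2"
  have "Y ! i \<in> cross_polytope_faces n i" using Y i by (simp add: flags_def)
  then have Yi: "Y ! i \<subseteq> cross_vertices n" "card (Y ! i) = Suc i" "\<And>j. \<not> (j \<in> Y ! i \<and> - j \<in> Y ! i)"
    by (auto simp: cross_faces_iff)
  have chain: "Y ! k \<subset> Y ! Suc k" if "Suc k < n" for k
    using Y that by (simp add: flags_def)
  have sub: "{1..int i} \<subseteq> Y ! i"
  proof (cases i)
    case (Suc l)
    then have "Y ! l = {1..int i}" using same[of l] i by (simp add: add.commute)
    then show ?thesis using chain[of l] Suc i by auto
  qed simp
  moreover have "Y ! i \<subseteq> insert (int i + 1) (insert ?b {1..int i})"
  proof (cases "Suc i = n")
    case True
    \<comment> \<open>At the top rank the antipodes of the vertices already present are excluded,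
      which leaves only \<open>n\<close> and \<open>- n\<close> as further vertices.\<close>
    show ?thesis
    proof
      fix x assume x: "x \<in> Y ! i"
      then have "- x \<notin> {1..int i}" using Yi(3)[of x] sub by blast
      moreover have "x \<in> cross_vertices n" using x Yi(1) by blast
      ultimately show "x \<in> insert (int i + 1) (insert ?b {1..int i})"
        using True by (auto simp: cross_vertices_def)
    qed
  next
    case False
    then have "Y ! i \<subset> {1..int (Suc i) + 1}" using chain[of i] same[of "Suc i"] i by simp
    then show ?thesis using False by auto
  qed
  ultimately have "Y ! i = insert (int i + 1) {1..int i} \<or> Y ! i = insert ?b {1..int i}"
    using Yi(2) by (intro between_insert_two) auto
  moreover have "{1..int i+1} = insert (int i + 1) {1..int i}" by auto
  ultimately show "Y ! i = {1..int i+1} \<or> Y ! i = cross_move n i ` {1..int i+1}"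
    unfolding cross_move_image_same by metis
next
  fix w assume w: "w \<in> lists {..<n}"
    and fixes_flag: "\<And>k. k < n \<Longrightarrow> word_map (cross_move n) w ` {1..int k+1} = {1..int k+1}"
  let ?g = "word_map (cross_move n) w"
  have g: "?g permutes cross_vertices n" and odd: "?g (- x) = - ?g x" for x
    using cross_word_map_signed_permutation[OF w] by (auto simp: signed_permutation_def)
  have im: "?g ` {1..int k} = {1..int k}" if "k \<le> n" for k
  proof (cases k)
    case (Suc j)
    then show ?thesis using fixes_flag[of j] that by (simp add: add.commute)
  qed simp
  have pos: "?g x = x" if "1 \<le> x" "x \<le> int n" for x
  proof (rule fixed_point_of_difference[OF permutes_inj[OF g]])
    show "?g ` {1..int (nat x - 1)} = {1..int (nat x - 1)}" using that by (intro im) simp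
    show "?g ` {1..int (nat x)} = {1..int (nat x)}" using that by (intro im) simp
    show "{1..int (nat x)} - {1..int (nat x - 1)} = {x}" using that by auto
  qed
  show "?g = id"
  proof
    fix x
    have "x \<notin> cross_vertices n \<or> (1 \<le> x \<and> x \<le> int n) \<or> (1 \<le> - x \<and> - x \<le> int n)"
      by (auto simp: cross_vertices_def)
    then consider "x \<notin> cross_vertices n" | "1 \<le> x" "x \<le> int n" | "1 \<le> - x" "- x \<le> int n"
      by blast
    then show "?g x = id x"
    proof cases
      case 1
      then show ?thesis using permutes_not_in[OF g] by simp
    next
      case 2
      then show ?thesis using pos by simp
    next
      case 3
      then show ?thesis using pos[of "- x"] odd[of x] by simp
    qed
  qed
qed

lemma cross_word_map_upt:
  assumes "m < n" "0 < x"
  shows "word_map (cross_move n) [0..<m] x = (if int m + 1 < x then x else if x = int m + 1 then 1 else x + 1)"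
  using assms
proof (induction m arbitrary: x)
  case (Suc m)
  then show ?case by (auto simp: cross_move_def signed_swap_def)
qed auto

text \<open>With oddness this is the cycle 1 -> 2 -> ... -> n -> -1 -> ... -> -n -> 1 through all
  vertices.\<close>

lemma cross_coxeter_element:
  assumes "1 \<le> n" "0 < x" "x \<le> int n"
  shows "word_map (cross_move n) [0..<n] x = (if x = int n then - 1 else x + 1)"
proof -
  obtain m where m: "n = Suc m" using assms(1) by (cases n) auto
  let ?g = "word_map (cross_move n) [0..<m]"
  have "[0..<m] \<in> lists {..<n}" by (auto simp: in_lists_conv_set m)
  then have odd: "?g (- x) = - ?g x" for x
    using cross_word_map_signed_permutation by (simp add: signed_permutation_def)
  have "word_map (cross_move n) [0..<n] x = ?g (cross_move n m x)" by (simp add: m)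
  also have "cross_move n m x = (if x = int n then - int n else x)"
    using assms by (auto simp: cross_move_def signed_swap_def m)
  finally show ?thesis
    using odd[of "int n"] cross_word_map_upt[of m n] assms by (auto simp: m)
qed

text \<open>Vertex 1 passes through the positive vertices, then through their negatives, before it
  returns after \<open>2 * n\<close> steps.\<close>

lemma cross_powers_ne_id:
  assumes "1 \<le> n" "0 < k" "k < 2 * n"
  shows "word_map (cross_move n) [0..<n] ^^ k \<noteq> id"
proof -
  let ?c = "word_map (cross_move n) [0..<n]"
  have "[0..<n] \<in> lists {..<n}" by (auto simp: in_lists_conv_set)
  then have odd: "?c (- x) = - ?c x" for x
    using cross_word_map_signed_permutation by (simp add: signed_permutation_def)
  have 1: "j < n \<Longrightarrow> (?c ^^ j) 1 = 1 + int j" for j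
  proof (induction j)
    case (Suc j)
    then show ?case using cross_coxeter_element[OF assms(1), of "1 + int j"] by simp
  qed simp
  have 2: "j < n \<Longrightarrow> (?c ^^ (n + j)) 1 = - (1 + int j)" for j
  proof (induction j)
    case 0
    obtain m where m: "n = Suc m" using assms(1) by (cases n) auto
    have "?c (1 + int m) = - 1"
      using cross_coxeter_element[OF assms(1), of "1 + int m"] m by simp
    moreover have "(?c ^^ m) 1 = 1 + int m" using m by (intro 1) simp
    moreover have "n + 0 = Suc m" using m by simp
    ultimately show ?case by (simp only: funpow.simps comp_apply)
  next
    case (Suc j)
    then show ?case using cross_coxeter_element[OF assms(1), of "1 + int j"] odd[of "1 + int j"] by simp
  qed
  have "(?c ^^ k) 1 \<noteq> 1" using 1[of k] 2[of "k - n"] assms by (cases "k < n") auto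
  then show ?thesis by (auto simp: fun_eq_iff)
qed

text \<open>The product is a pair of opposite 3-cycles; \<open>0 < a\<close> keeps the six points
  distinct.\<close>

lemma signed_swap_braid_3:
  assumes "0 < a"
  shows "(signed_swap a (a + 1) \<circ> signed_swap (a + 1) (a + 2)) ^^ 3 = id"
proof
  fix x
  let ?f = "\<lambda>x. signed_swap a (a + 1) (signed_swap (a + 1) (a + 2) x)"
  have f: "?f a = a + 1" "?f (a + 1) = a + 2" "?f (a + 2) = a"
      "?f (- a) = - (a + 1)" "?f (- (a + 1)) = - (a + 2)" "?f (- (a + 2)) = - a"
    using assms by (simp_all add: signed_swap_def)
  have f': "?f x = x" if "x \<notin> {a, a + 1, a + 2, - a, - (a + 1), - (a + 2)}"
    using that by (simp add: signed_swap_def)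
  have "?f (?f (?f x)) = x"
  proof (cases "x \<in> {a, a + 1, a + 2, - a, - (a + 1), - (a + 2)}")
    case True
    then show ?thesis by (elim insertE) (simp_all only: f empty_iff)
  next
    case False
    then show ?thesis by (simp only: f'[OF False])
  qed
  then show "((signed_swap a (a + 1) \<circ> signed_swap (a + 1) (a + 2)) ^^ 3) x = id x"
    by (simp add: numeral_3_eq_3)
qed

text \<open>The product is the 4-cycle a -> a + 1 -> -a -> -(a + 1) -> a, whence the label
  4.\<close>

lemma signed_swap_braid_4:
  assumes "0 < a"
  shows "(signed_swap a (a + 1) \<circ> signed_swap (a + 1) (- (a + 1))) ^^ 4 = id"
proof
  fix x
  let ?f = "\<lambda>x. signed_swap a (a + 1) (signed_swap (a + 1) (- (a + 1)) x)"
  have f: "?f a = a + 1" "?f (a + 1) = - a" "?f (- a) = - (a + 1)" "?f (- (a + 1)) = a"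
    using assms by (simp_all add: signed_swap_def)
  have f': "?f x = x" if "x \<notin> {a, a + 1, - a, - (a + 1)}"
    using that by (simp add: signed_swap_def)
  have "?f (?f (?f (?f x))) = x"
  proof (cases "x \<in> {a, a + 1, - a, - (a + 1)}")
    case True
    then show ?thesis by (elim insertE) (simp_all only: f empty_iff)
  next
    case False
    then show ?thesis by (simp only: f'[OF False])
  qed
  then show "((signed_swap a (a + 1) \<circ> signed_swap (a + 1) (- (a + 1))) ^^ 4) x = id x"
    by (simp add: eval_nat_numeral)
qed

lemma cross_coxeter_rep: "coxeter_rep n (matrix_B n) (cross_move n)"
  unfolding matrix_B_def
proof (rule coxeter_rep_linearI)
  show "cross_move n i \<circ> cross_move n i = id" for i
    by (auto simp: fun_eq_iff cross_move_def intro!: signed_swap_involution)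
  show "cross_move n i \<circ> cross_move n j = cross_move n j \<circ> cross_move n i" if "Suc i < j" "j < n" for i j
    using that by (auto simp: fun_eq_iff cross_move_def signed_swap_def)
next
  fix i assume i: "Suc i < n"
  show "(cross_move n i \<circ> cross_move n (Suc i)) ^^ (if i + 2 = n then 4 else 3) = id"
  proof (cases "i + 2 = n")
    case True
    then have "cross_move n i = signed_swap (int i + 1) (int i + 1 + 1)"
        "cross_move n (Suc i) = signed_swap (int i + 1 + 1) (- (int i + 1 + 1))"
      by (auto simp: cross_move_def algebra_simps)
    then show ?thesis using True signed_swap_braid_4[of "int i + 1"] by simp
  next
    case False
    then have "cross_move n i = signed_swap (int i + 1) (int i + 1 + 1)"
        "cross_move n (Suc i) = signed_swap (int i + 1 + 1) (int i + 1 + 2)"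
      using i by (auto simp: cross_move_def algebra_simps)
    then show ?thesis using False signed_swap_braid_3[of "int i + 1"] by simp
  qed
qed

lemmas cross_zigzag =
  cross.zigzag_length_eq_coxeter_number[where h = "2 * n" and e = "\<lambda>i. if i + 2 = n then 4 else 3" and \<rho> = id
    and n = n for n, folded matrix_B_def, unfolded comp_id, OF _ coxeter_power_B cross_coxeter_rep permutes_id
    cross_powers_ne_id]

section \<open>Convex hulls of reflection orbits\<close>

text \<open>A face of the hull of a finite set is the hull of some of its points, and these must lie
  on the hyperplane.\<close>

lemma convex_hull_Int_supporting_hyperplane:
  fixes S :: "'a::euclidean_space set"
  assumes "finite S" "\<And>x. x \<in> S \<Longrightarrow> u \<bullet> x \<le> b"
  shows "convex hull S \<inter> {x. u \<bullet> x = b} = convex hull (S \<inter> {x. u \<bullet> x = b})"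
proof
  have "convex hull S \<subseteq> {x. u \<bullet> x \<le> b}"
    using assms(2) by (intro hull_minimal) (auto simp: convex_halfspace_le)
  then have "(convex hull S \<inter> {x. u \<bullet> x = b}) face_of convex hull S"
    by (intro face_of_Int_supporting_hyperplane_le) auto
  then obtain T where T: "T \<subseteq> S" "convex hull S \<inter> {x. u \<bullet> x = b} = convex hull T"
    using face_of_convex_hull_subset[OF finite_imp_compact[OF assms(1)]] by metis
  then have "T \<subseteq> S \<inter> {x. u \<bullet> x = b}" using hull_subset[of T convex] by blast
  then show "convex hull S \<inter> {x. u \<bullet> x = b} \<subseteq> convex hull (S \<inter> {x. u \<bullet> x = b})"
    unfolding T(2) by (rule hull_mono)
  have "convex hull (S \<inter> {x. u \<bullet> x = b}) \<subseteq> {x. u \<bullet> x = b}"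
    by (intro hull_minimal) (auto simp: convex_hyperplane)
  then show "convex hull (S \<inter> {x. u \<bullet> x = b}) \<subseteq> convex hull S \<inter> {x. u \<bullet> x = b}"
    using hull_mono[of "S \<inter> {x. u \<bullet> x = b}" S convex] by blast
qed

text \<open>For \<open>a = 0\<close> the quotient is 0 and the map is the identity, so isometry and
  involutivity hold for every \<open>a\<close>.\<close>

definition reflect :: "'a::euclidean_space \<Rightarrow> 'a \<Rightarrow> 'a" where
  "reflect a x = x - (2 * (x \<bullet> a) / (a \<bullet> a)) *\<^sub>R a"

lemma linear_reflect: "linear (reflect a)"
  by (intro linearI) (simp_all add: reflect_def algebra_simps inner_add_left add_divide_distrib)

lemma inner_reflect_left: "reflect a x \<bullet> y = x \<bullet> y - 2 * (x \<bullet> a) * (a \<bullet> y) / (a \<bullet> a)"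
  by (simp add: reflect_def inner_diff_left)

lemma inner_reflect_right: "y \<bullet> reflect a x = y \<bullet> x - 2 * (x \<bullet> a) * (y \<bullet> a) / (a \<bullet> a)"
  by (simp add: reflect_def inner_diff_right)

lemma inner_reflect: "reflect a x \<bullet> reflect a y = x \<bullet> y"
  by (cases "a = 0") (simp_all add: inner_reflect_left inner_reflect_right inner_commute field_simps)

lemma reflect_reflect: "reflect a (reflect a x) = x"
proof (cases "a = 0")
  case False
  then have "reflect a x \<bullet> a = - (x \<bullet> a)" by (simp add: inner_reflect_left)
  then show ?thesis unfolding reflect_def[of a "reflect a x"] by (simp add: reflect_def)
qed (simp add: reflect_def)

lemma reflect_eq_self: "x \<bullet> a = 0 \<Longrightarrow> reflect a x = x"
  by (simp add: reflect_def)

lemma bij_reflect: "bij (reflect a)"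
  by (rule involuntory_imp_bij) (rule reflect_reflect)

lemma linear_word_map: "(\<And>i. linear (r i)) \<Longrightarrow> linear (word_map r u)"
proof (induction u)
  case (Cons i u)
  show ?case unfolding word_map_Cons by (intro linear_compose Cons)
qed (simp only: word_map_Nil linear_id)

text \<open>
  \<open>a\<close> are simple roots of a linear diagram, \<open>w\<close> is a positive multiple of the dual basis, and the
  vertices \<open>V\<close> turn out to be the orbit of \<open>v\<^sub>0\<close>.
\<close>

locale wythoff =
  fixes n :: nat and V :: "'a::euclidean_space set" and a w :: "nat \<Rightarrow> 'a" and v0 :: 'a
  assumes dim: "DIM('a) = n"
    and finite_V: "finite V" and v0_in_V: "v0 \<in> V"
    and dual: "i < n \<Longrightarrow> j < n \<Longrightarrow> i \<noteq> j \<Longrightarrow> w i \<bullet> a j = 0"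
    and dual_pos: "i < n \<Longrightarrow> 0 < w i \<bullet> a i"
    and obtuse: "Suc i < n \<Longrightarrow> a i \<bullet> a (Suc i) < 0"
    and orth: "Suc i < j \<Longrightarrow> j < n \<Longrightarrow> a i \<bullet> a j = 0"
    and v0_first: "0 < v0 \<bullet> a 0" and v0_other: "0 < i \<Longrightarrow> i < n \<Longrightarrow> v0 \<bullet> a i = 0"
    and reflect_V: "i < n \<Longrightarrow> x \<in> V \<Longrightarrow> reflect (a i) x \<in> V"
    and below: "i < n \<Longrightarrow> x \<in> V \<Longrightarrow> w i \<bullet> x \<le> w i \<bullet> v0"
    and w_v0: "i < n \<Longrightarrow> 0 < w i \<bullet> v0"
    and norm_V: "x \<in> V \<Longrightarrow> x \<bullet> x = v0 \<bullet> v0"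
begin

abbreviation R :: "nat \<Rightarrow> 'a \<Rightarrow> 'a" where "R i \<equiv> reflect (a i)"
abbreviation word :: "nat list \<Rightarrow> 'a \<Rightarrow> 'a" where "word \<equiv> word_map R"

lemma root_pos: "i < n \<Longrightarrow> 0 < a i \<bullet> a i"
  using dual_pos[of i] by fastforce

lemma word_linear: "linear (word u)"
  by (rule linear_word_map) (rule linear_reflect)

lemma word_inner: "word u x \<bullet> word u y = x \<bullet> y"
  by (induction u) (simp_all add: inner_reflect)

lemma word_V: "u \<in> lists {..<n} \<Longrightarrow> x \<in> V \<Longrightarrow> word u x \<in> V"
  by (induction u) (auto intro: reflect_V)

lemma word_rev: "word u (word (rev u) x) = x"
  by (induction u arbitrary: x) (simp_all add: reflect_reflect)

lemma word_rev': "word (rev u) (word u x) = x"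
  using word_rev[of "rev u"] by simp

lemma bij_word: "bij (word u)"
  by (rule o_bij[of "word (rev u)"]) (simp_all add: fun_eq_iff word_rev word_rev')

lemma word_V_image: "u \<in> lists {..<n} \<Longrightarrow> word u ` V = V"
proof
  assume u: "u \<in> lists {..<n}"
  then show "word u ` V \<subseteq> V" using word_V by blast
  show "V \<subseteq> word u ` V"
  proof
    fix x assume "x \<in> V"
    then have "word (rev u) x \<in> V" using u by (intro word_V rev_in_lists)
    then show "x \<in> word u ` V" using word_rev[of u x] by (metis imageI)
  qed
qed

text \<open>Pairing with the dual vectors reads off the coefficients of a linear relation, so the
  \<open>n\<close> roots are independent.\<close>

lemma span_roots: "span (a ` {..<n}) = UNIV"
proof -
  have inj: "inj_on a {..<n}"
  proof (rule inj_onI)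
    fix i j assume "i \<in> {..<n}" "j \<in> {..<n}" "a i = a j"
    then show "i = j" using dual[of i j] dual_pos[of i] by force
  qed
  have "independent (a ` {..<n})"
  proof (rule independent_if_scalars_zero)
    fix f x assume f: "(\<Sum>x\<in>a ` {..<n}. f x *\<^sub>R x) = 0" and "x \<in> a ` {..<n}"
    then obtain j where j: "j < n" "x = a j" by auto
    have "0 = w j \<bullet> (\<Sum>i<n. f (a i) *\<^sub>R a i)"
      using f by (simp add: sum.reindex[OF inj])
    also have "\<dots> = (\<Sum>i<n. if i = j then f (a j) * (w j \<bullet> a j) else 0)"
      unfolding inner_sum_right using dual j by (intro sum.cong) auto
    finally show "f x = 0" using j dual_pos[of j] by simp
  qed simp
  then have "dim (a ` {..<n}) = n"
    using card_image[OF inj] by (simp add: dim_eq_card_independent)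
  then show ?thesis using dim dim_eq_full[of "a ` {..<n}"] by simp
qed

text \<open>Dividing by \<open>w i \<bullet> a i\<close> turns the multiple \<open>w i\<close> of a
  dual vector into the true coordinate along \<open>a i\<close>.\<close>

definition coef :: "nat \<Rightarrow> 'a \<Rightarrow> real" where
  "coef i x = (w i \<bullet> x) / (w i \<bullet> a i)"

lemma expand: "x = (\<Sum>i<n. coef i x *\<^sub>R a i)"
proof -
  have "x \<in> span (a ` {..<n})" by (simp add: span_roots)
  then have "\<exists>c. x = (\<Sum>i<n. c i *\<^sub>R a i)"
  proof (induction rule: span_induct_alt)
    case base
    show ?case by (rule exI[of _ "\<lambda>_. 0"]) simp
  next
    case (step t y z)
    then obtain i c where i: "i < n" "y = a i" and c: "z = (\<Sum>i<n. c i *\<^sub>R a i)" by auto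
    have "(\<Sum>k<n. (c k + (if k = i then t else 0)) *\<^sub>R a k)
        = (\<Sum>k<n. c k *\<^sub>R a k) + (\<Sum>k<n. if k = i then t *\<^sub>R a k else 0)"
      unfolding sum.distrib[symmetric] by (intro sum.cong) (auto simp: scaleR_add_left)
    then have "t *\<^sub>R y + z = (\<Sum>k<n. (c k + (if k = i then t else 0)) *\<^sub>R a k)"
      using i c by (simp add: add.commute)
    then show ?case by (rule exI[of _ "\<lambda>k. c k + (if k = i then t else 0)"])
  qed
  then obtain c where c: "x = (\<Sum>i<n. c i *\<^sub>R a i)" ..
  have "coef j x = c j" if j: "j < n" for j
  proof -
    have "w j \<bullet> x = (\<Sum>i<n. if i = j then c j * (w j \<bullet> a j) else 0)"
      unfolding c inner_sum_right using dual j by (intro sum.cong) auto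
    then show ?thesis using dual_pos[OF j] j by (simp add: coef_def)
  qed
  then show ?thesis using c by simp
qed

lemma inner_expand: "x \<bullet> y = (\<Sum>i<n. coef i x * (a i \<bullet> y))"
  by (subst expand[of x]) (simp add: inner_sum_left)

lemma eq_0_if_orthogonal:
  assumes "\<And>i. i < n \<Longrightarrow> x \<bullet> a i = 0"
  shows "x = 0"
proof -
  have "x \<bullet> x = 0" unfolding inner_expand[of x x] using assms by (simp add: inner_commute)
  then show ?thesis by simp
qed

text \<open>In the root order, \<open>v0\<close> is the highest vertex: it exceeds the others by
  nonnegative combinations of simple roots.\<close>

lemma coef_defect_nonneg: "i < n \<Longrightarrow> x \<in> V \<Longrightarrow> 0 \<le> coef i (v0 - x)"
  using below[of i x] dual_pos[of i] by (simp add: coef_def inner_diff_right)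

lemma v0_nonneg: "i < n \<Longrightarrow> 0 \<le> v0 \<bullet> a i"
  using v0_first v0_other[of i] by (cases "i = 0") auto

text \<open>Equal norms make p = v0 - x orthogonal to v0 + x. Expanded in roots, this product is a
  sum of nonnegative terms, so each term vanishes, and differences of them add up to p . p. Where
  \<open>x\<close> fails to be dominant, the coordinate of p is zero by hypothesis.\<close>

lemma dominant_eq_v0:
  assumes x: "x \<in> V" and dom: "\<And>i. i < n \<Longrightarrow> w i \<bullet> x = w i \<bullet> v0 \<or> 0 \<le> x \<bullet> a i"
  shows "x = v0"
proof -
  define p where "p = v0 - x"
  have terms: "0 \<le> coef i p * (a i \<bullet> v0)" "0 \<le> coef i p * (a i \<bullet> x)" if "i < n" for i
  proof -
    have c: "0 \<le> coef i p" unfolding p_def by (rule coef_defect_nonneg[OF that x])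
    then show "0 \<le> coef i p * (a i \<bullet> v0)" using v0_nonneg[OF that] by (simp add: inner_commute)
    have "coef i p = 0 \<or> 0 \<le> a i \<bullet> x"
      using dom[OF that] by (auto simp: p_def coef_def inner_diff_right inner_commute)
    then show "0 \<le> coef i p * (a i \<bullet> x)" using c by auto
  qed
  have "(\<Sum>i<n. coef i p * (a i \<bullet> v0) + coef i p * (a i \<bullet> x)) = p \<bullet> (v0 + x)"
    unfolding inner_expand[of p] by (simp add: inner_add_right distrib_left)
  also have "\<dots> = 0"
    using norm_V[OF x] by (simp add: p_def inner_diff_left inner_diff_right inner_add_right inner_commute)
  finally have "coef i p * (a i \<bullet> v0) + coef i p * (a i \<bullet> x) = 0" if "i < n" for i
    using that terms by (subst (asm) sum_nonneg_eq_0_iff) auto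
  then have "coef i p * (a i \<bullet> p) = 0" if "i < n" for i
    using terms[OF that] that unfolding p_def inner_diff_right right_diff_distrib
    by (metis add_nonneg_eq_0_iff diff_self p_def)
  then have "p \<bullet> p = 0" unfolding inner_expand[of p p] by (intro sum.neutral) simp
  then show ?thesis by (simp add: p_def)
qed

text \<open>Reflecting in a root of \<open>J\<close> that has negative product with \<open>x\<close>
  raises the sum of all \<open>w i \<bullet> x\<close> and alters only a coordinate in
  \<open>J\<close>. After finitely many steps \<open>dominant_eq_v0\<close> applies; the measure
  counts the vertices with a larger sum.\<close>

lemma orbit_v0:
  assumes "x \<in> V" "J \<subseteq> {..<n}" "\<And>i. i < n \<Longrightarrow> i \<notin> J \<Longrightarrow> w i \<bullet> x = w i \<bullet> v0"
  shows "\<exists>u\<in>lists J. x = word u v0"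
  using assms(1,3)
proof (induction "card {y \<in> V. (\<Sum>i<n. w i \<bullet> x) < (\<Sum>i<n. w i \<bullet> y)}" arbitrary: x rule: less_induct)
  case less
  define f where "f y = (\<Sum>i<n. w i \<bullet> y)" for y
  show ?case
  proof (cases "\<forall>i\<in>J. 0 \<le> x \<bullet> a i")
    case True
    then have "x = v0" using less.prems by (intro dominant_eq_v0) auto
    then show ?thesis by (intro bexI[of _ "[]"]) auto
  next
    case False
    then obtain i where i: "i \<in> J" "x \<bullet> a i < 0" "i < n" using assms(2) by force
    let ?x = "R i x"
    have x': "?x \<in> V" using less.prems(1) i by (intro reflect_V)
    have w: "w j \<bullet> ?x = w j \<bullet> x + (if j = i then - 2 * (x \<bullet> a i) * (w i \<bullet> a i) / (a i \<bullet> a i) else 0)" if "j < n" for j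
      using that dual[of j i] i by (simp add: inner_reflect_right)
    have "f ?x = f x - 2 * (x \<bullet> a i) * (w i \<bullet> a i) / (a i \<bullet> a i)"
      unfolding f_def using i(3) by (simp add: w sum.distrib)
    moreover have "2 * (x \<bullet> a i) * (w i \<bullet> a i) / (a i \<bullet> a i) < 0"
      using mult_neg_pos[OF i(2) dual_pos[OF i(3)]] by (intro divide_neg_pos root_pos i(3)) linarith
    ultimately have "f x < f ?x" by linarith
    then have "{y \<in> V. f ?x < f y} \<subset> {y \<in> V. f x < f y}" using x' by fastforce
    then have "card {y \<in> V. f ?x < f y} < card {y \<in> V. f x < f y}"
      using finite_V by (intro psubset_card_mono) auto
    moreover have "w j \<bullet> ?x = w j \<bullet> v0" if "j < n" "j \<notin> J" for j
      using w[OF that(1)] less.prems(2)[OF that] that i(1) by auto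
    ultimately obtain u where u: "u \<in> lists J" "?x = word u v0"
      using less.hyps[of ?x] x' unfolding f_def by blast
    then have "x = word (i # u) v0" using reflect_reflect[of "a i" x] by simp
    then show ?thesis using u i by (intro bexI[of _ "i # u"]) auto
  qed
qed

text \<open>The vertices that differ from \<open>v0\<close> by a combination of the first
  \<open>k\<close> roots; they are the orbit of \<open>v0\<close> under the first \<open>k\<close>
  reflections.\<close>

definition level :: "nat \<Rightarrow> 'a set" where
  "level k = {x \<in> V. \<forall>i. k \<le> i \<longrightarrow> i < n \<longrightarrow> w i \<bullet> x = w i \<bullet> v0}"

definition face :: "nat \<Rightarrow> 'a set" where
  "face k = convex hull level k"

lemma level_subset_V: "level k \<subseteq> V" and finite_level: "finite (level k)"
  using finite_V by (auto simp: level_def)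

lemma level_mono: "k \<le> m \<Longrightarrow> level k \<subseteq> level m"
  by (auto simp: level_def)

lemma level_n: "level n = V"
  by (auto simp: level_def)

lemma v0_in_level: "v0 \<in> level k"
  using v0_in_V by (simp add: level_def)

lemma R_level: "j < k \<Longrightarrow> j < n \<Longrightarrow> x \<in> level k \<Longrightarrow> R j x \<in> level k"
  using dual[of _ j] by (auto simp: level_def inner_reflect_right intro: reflect_V)

lemma inner_defect:
  assumes "x \<in> level k" "j < n"
  shows "(v0 - x) \<bullet> a j = (\<Sum>i<min k n. coef i (v0 - x) * (a i \<bullet> a j))"
proof -
  have "coef i (v0 - x) = 0" if "k \<le> i" "i < n" for i
    using assms(1) that by (simp add: level_def coef_def inner_diff_right)
  then show ?thesis unfolding inner_expand[of "v0 - x" "a j"]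
    by (intro sum.mono_neutral_right) auto
qed

text \<open>The difference \<open>v0 - x\<close> involves only roots before \<open>k\<close>, and in
  a path these are orthogonal to all roots after \<open>k\<close>.\<close>

lemma level_orthogonal:
  assumes "x \<in> level k" "k < j" "j < n"
  shows "x \<bullet> a j = 0"
proof -
  have "(v0 - x) \<bullet> a j = 0"
    unfolding inner_defect[OF assms(1,3)] using assms orth[of _ j] by (intro sum.neutral) auto
  then show ?thesis using v0_other[of j] assms by (simp add: inner_diff_left)
qed

lemma word_level:
  assumes "u \<in> lists ({..<n} - {k})" "x \<in> level k"
  shows "word u x \<in> level k"
  using assms(1)
proof (induction u)
  case (Cons i u)
  then have "i < n" "i \<noteq> k" "word u x \<in> level k" by auto
  then show ?case
    using R_level[of i k "word u x"] reflect_eq_self[OF level_orthogonal[of "word u x" k i]]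
    by (cases "i < k") auto
qed (simp add: assms)

text \<open>A single functional suffices: the vertices that maximize \<open>w k\<close> are reached
  from \<open>v0\<close> by reflections other than \<open>R k\<close>. Those before \<open>k\<close>
  preserve the level, and those after \<open>k\<close> fix it pointwise.\<close>

lemma level_eq: "k < n \<Longrightarrow> level k = V \<inter> {x. w k \<bullet> x = w k \<bullet> v0}"
proof (intro subset_antisym subsetI)
  fix x assume k: "k < n" and "x \<in> V \<inter> {x. w k \<bullet> x = w k \<bullet> v0}"
  then obtain u where "u \<in> lists ({..<n} - {k})" "x = word u v0"
    using orbit_v0[of x "{..<n} - {k}"] by auto
  then show "x \<in> level k" using word_level v0_in_level by simp
qed (auto simp: level_def)

lemma word_level_image:
  assumes "u \<in> lists ({..<n} - {k})"
  shows "word u ` level k = level k"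
proof
  show "word u ` level k \<subseteq> level k" using word_level[OF assms] by blast
  show "level k \<subseteq> word u ` level k"
    using word_level[OF rev_in_lists[OF assms]] word_rev[of u] by (metis imageI subsetI)
qed

lemma word_hull: "word u ` (convex hull S) = convex hull (word u ` S)"
  by (rule convex_hull_linear_image[OF word_linear])

lemma word_face_image: "u \<in> lists ({..<n} - {k}) \<Longrightarrow> word u ` face k = face k"
  unfolding face_def word_hull by (simp only: word_level_image)

lemma lists_below: "u \<in> lists {..<m} \<Longrightarrow> m \<le> k \<Longrightarrow> m \<le> n \<Longrightarrow> u \<in> lists ({..<n} - {k})"
  by (auto simp: in_lists_conv_set)

lemma face_eq:
  assumes "k < n" "k \<le> m"
  shows "face k = face m \<inter> {x. w k \<bullet> x = w k \<bullet> v0}"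
proof -
  have "level k = level m \<inter> {x. w k \<bullet> x = w k \<bullet> v0}"
    using level_eq[OF assms(1)] level_mono[OF assms(2)] level_subset_V by blast
  then show ?thesis
    unfolding face_def using below[OF assms(1)] level_subset_V[of m] finite_level
    by (subst convex_hull_Int_supporting_hyperplane) auto
qed

lemma face_le: "k < n \<Longrightarrow> x \<in> face m \<Longrightarrow> w k \<bullet> x \<le> w k \<bullet> v0"
proof -
  assume k: "k < n" and "x \<in> face m"
  moreover have "face m \<subseteq> {x. w k \<bullet> x \<le> w k \<bullet> v0}"
    unfolding face_def using below[OF k] level_subset_V
    by (intro hull_minimal) (auto simp: convex_halfspace_le)
  ultimately show ?thesis by auto
qed

lemma face_face_of:
  assumes "k \<le> m" "m \<le> n"
  shows "face k face_of face m"
proof (cases "k < n")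
  case True
  then show ?thesis
    unfolding face_eq[OF True assms(1)] using face_le[OF True]
    by (intro face_of_Int_supporting_hyperplane_le) (auto simp: face_def)
next
  case False
  then have "k = m" using assms by simp
  then show ?thesis by (simp add: face_of_refl face_def)
qed

text \<open>Induction along the path: a vertex with smaller value of \<open>w k\<close> has, by
  obtuseness, positive product with the next root, so reflecting it in that root lowers the next
  functional.\<close>

lemma level_new: "k < n \<Longrightarrow> \<exists>x\<in>level (Suc k). w k \<bullet> x < w k \<bullet> v0"
proof (induction k)
  case 0
  have "R 0 v0 \<in> level (Suc 0)" using 0 v0_in_level by (intro R_level) auto
  moreover have "w 0 \<bullet> R 0 v0 < w 0 \<bullet> v0"
    using dual_pos[OF 0] root_pos[OF 0] v0_first by (simp add: inner_reflect_right)
  ultimately show ?case by blast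
next
  case (Suc k)
  then obtain y where y: "y \<in> level (Suc k)" "w k \<bullet> y < w k \<bullet> v0" by auto
  let ?j = "Suc k"
  have "(v0 - y) \<bullet> a ?j = (\<Sum>i<?j. coef i (v0 - y) * (a i \<bullet> a ?j))"
    using inner_defect[OF y(1) Suc.prems] Suc.prems by simp
  also have "\<dots> = coef k (v0 - y) * (a k \<bullet> a ?j)"
    using orth[of _ ?j] Suc.prems by simp
  also have "\<dots> < 0"
    unfolding coef_def inner_diff_right using y(2) Suc.prems
    by (intro mult_pos_neg divide_pos_pos obtuse dual_pos) simp_all
  finally have pos: "0 < y \<bullet> a ?j" using v0_other[of ?j] Suc.prems by (simp add: inner_diff_left)
  have "R ?j y \<in> level (Suc ?j)"
    using y(1) level_mono[of ?j "Suc ?j"] Suc.prems by (intro R_level) auto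
  moreover have "w ?j \<bullet> R ?j y < w ?j \<bullet> v0"
    using pos dual_pos[OF Suc.prems] root_pos[OF Suc.prems] y(1) Suc.prems
    by (simp add: inner_reflect_right level_def)
  ultimately show ?case by blast
qed

lemma aff_dim_level_Suc: "k < n \<Longrightarrow> aff_dim (level k) + 1 \<le> aff_dim (level (Suc k))"
proof -
  assume k: "k < n"
  obtain x where x: "x \<in> level (Suc k)" "w k \<bullet> x < w k \<bullet> v0" using level_new[OF k] by blast
  have "affine hull (level k) \<subseteq> {y. w k \<bullet> y = w k \<bullet> v0}"
    using level_eq[OF k] by (intro hull_minimal) (auto simp: affine_hyperplane)
  then have "x \<notin> affine hull (level k)" using x by auto
  then have "aff_dim (level k) + 1 = aff_dim (insert x (level k))" by (simp add: aff_dim_insert)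
  also have "\<dots> \<le> aff_dim (level (Suc k))"
    using x level_mono[of k "Suc k"] by (intro aff_dim_subset) auto
  finally show ?thesis .
qed

text \<open>The dimension grows by at least one at each of the \<open>n\<close> steps and cannot
  exceed \<open>n\<close> at the end, so every step adds exactly one.\<close>

lemma aff_dim_face: "k \<le> n \<Longrightarrow> aff_dim (face k) = int k"
proof -
  assume k: "k \<le> n"
  have "int j \<le> aff_dim (level j)" if "j \<le> n" for j
    using that
  proof (induction j)
    case 0
    have "aff_dim {v0} \<le> aff_dim (level 0)" using v0_in_level by (intro aff_dim_subset) auto
    then show ?case by simp
  next
    case (Suc j)
    then show ?case using aff_dim_level_Suc[of j] by simp
  qed
  moreover have "aff_dim (level k) + int (m - k) \<le> aff_dim (level m)" if "k \<le> m" "m \<le> n" for m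
    using that
  proof (induction m rule: dec_induct)
    case (step m)
    then show ?case using aff_dim_level_Suc[of m] by (simp add: Suc_diff_le)
  qed simp
  from this[of n] have "aff_dim (level k) + int (n - k) \<le> int n"
    using k aff_dim_le_DIM[of "level n"] dim by simp
  ultimately show ?thesis using k by (simp add: face_def aff_dim_convex_hull of_nat_diff antisym)
qed

section \<open>Finiteness of the group, the fundamental chamber and facets\<close>

lemma span_V: "span V = UNIV"
proof -
  have "aff_dim V = int DIM('a)"
    using aff_dim_face[of n] dim by (simp add: face_def level_n aff_dim_convex_hull)
  then show ?thesis using aff_dim_eq_full affine_hull_subset_span by blast
qed

text \<open>A word is determined by its restriction to the spanning set \<open>V\<close>, and
  \<open>V\<close> has finitely many self-maps.\<close>

lemma finite_words: "finite (word ` lists {..<n})"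
proof (rule finite_imageD)
  have "(\<lambda>h. restrict h V) ` word ` lists {..<n} \<subseteq> V \<rightarrow>\<^sub>E V"
  proof (intro image_subsetI, elim imageE)
    fix h u assume "u \<in> lists {..<n}" "h = word u"
    then show "restrict h V \<in> V \<rightarrow>\<^sub>E V" using word_V by (simp add: PiE_iff)
  qed
  then show "finite ((\<lambda>h. restrict h V) ` word ` lists {..<n})"
    using finite_PiE[of V "\<lambda>_. V"] finite_V by (meson finite_subset)
  show "inj_on (\<lambda>h. restrict h V) (word ` lists {..<n})"
  proof (rule inj_onI)
    fix g h assume gh: "g \<in> word ` lists {..<n}" "h \<in> word ` lists {..<n}" "restrict g V = restrict h V"
    then have lin: "linear g" "linear h" using word_linear by auto
    have eqV: "g x = h x" if "x \<in> V" for x using gh(3) that by (metis restrict_apply')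
    show "g = h"
    proof
      fix x
      show "g x = h x" using linear_eq_on_span[OF lin eqV] span_V by blast
    qed
  qed
qed

text \<open>Among the images of \<open>z\<close> one takes the largest product with a vector
  \<open>\<rho>\<close> that is positive on all simple roots. A negative product with a root would
  let a reflection increase it further.\<close>

lemma dominant_word:
  assumes "m \<le> n"
  shows "\<exists>u\<in>lists {..<m}. \<forall>i<m. 0 \<le> word u z \<bullet> a i"
proof -
  define \<rho> where "\<rho> = (\<Sum>i<n. w i)"
  have \<rho>: "0 < \<rho> \<bullet> a i" if "i < n" for i
  proof -
    have "\<rho> \<bullet> a i = (\<Sum>j<n. if j = i then w i \<bullet> a i else 0)"
      unfolding \<rho>_def inner_sum_left using dual that by (intro sum.cong) auto
    then show ?thesis using dual_pos[OF that] that by simp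
  qed
  let ?W = "(\<lambda>u. word u z \<bullet> \<rho>) ` lists {..<m}"
  have "lists {..<m} \<subseteq> lists {..<n}" using assms by (intro lists_mono) auto
  then have "word ` lists {..<m} \<subseteq> word ` lists {..<n}" by blast
  then have "finite (word ` lists {..<m})" using finite_words finite_subset by blast
  then have "finite ((\<lambda>h. h z \<bullet> \<rho>) ` word ` lists {..<m})" by (rule finite_imageI)
  then have fin: "finite ?W" by (simp add: image_image)
  have "[] \<in> lists {..<m}" by simp
  then have "?W \<noteq> {}" by blast
  then obtain u where u: "u \<in> lists {..<m}" "word u z \<bullet> \<rho> = Max ?W"
    using Max_in[OF fin] by fastforce
  have "0 \<le> word u z \<bullet> a i" if i: "i < m" for i
  proof (rule ccontr)
    assume neg: "\<not> 0 \<le> word u z \<bullet> a i"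
    have "word (i # u) z \<bullet> \<rho> \<in> ?W" using u(1) i by (intro imageI) auto
    then have "word (i # u) z \<bullet> \<rho> \<le> word u z \<bullet> \<rho>" unfolding u(2) by (rule Max_ge[OF fin])
    moreover have "word (i # u) z \<bullet> \<rho> = word u z \<bullet> \<rho> - 2 * (word u z \<bullet> a i) * (\<rho> \<bullet> a i) / (a i \<bullet> a i)"
      by (simp add: inner_reflect_left inner_commute[of "a i" \<rho>])
    moreover have "2 * (word u z \<bullet> a i) * (\<rho> \<bullet> a i) / (a i \<bullet> a i) < 0"
    proof (rule divide_neg_pos)
      have "(word u z \<bullet> a i) * (\<rho> \<bullet> a i) < 0"
        using neg \<rho>[of i] i assms by (intro mult_neg_pos) simp_all
      then show "2 * (word u z \<bullet> a i) * (\<rho> \<bullet> a i) < 0" by linarith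
    qed (use root_pos[of i] i assms in simp)
    ultimately show False by linarith
  qed
  then show ?thesis using u(1) by blast
qed

text \<open>Once the exposing functional is dominant, its maximum is attained at \<open>v0\<close>,
  and no maximizer differs from \<open>v0\<close> in a root \<open>a k\<close> on which the
  functional is positive. So the facet lies in \<open>face k\<close>, and its dimension forces
  \<open>k = m\<close>.\<close>

lemma facet_of_face:
  assumes m: "m < n" and Q: "Q face_of face (Suc m)" "aff_dim Q = int m"
  shows "\<exists>u\<in>lists {..<Suc m}. Q = word u ` face m"
proof -
  have poly: "polyhedron (face (Suc m))"
    unfolding face_def by (intro polyhedron_convex_hull finite_level)
  then have "Q exposed_face_of face (Suc m)" using Q(1) exposed_face_of_polyhedron by blast
  moreover have "Q \<noteq> {}" using Q(2) by auto
  moreover have "Q \<noteq> face (Suc m)" using Q(2) aff_dim_face[of "Suc m"] m by auto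
  ultimately obtain z b where z: "face (Suc m) \<subseteq> {x. z \<bullet> x \<le> b}" "Q = face (Suc m) \<inter> {x. z \<bullet> x = b}"
    unfolding exposed_face_of by blast
  obtain u where u: "u \<in> lists {..<Suc m}" and dom: "\<forall>i<Suc m. 0 \<le> word u z \<bullet> a i"
    using dominant_word[of "Suc m" z] m by auto
  define z' where "z' = word u z"
  have u_face: "word u ` face (Suc m) = face (Suc m)"
    using m by (intro word_face_image lists_below[OF u]) auto
  have uQ: "word u ` Q = face (Suc m) \<inter> {x. z' \<bullet> x = b}"
  proof
    show "word u ` Q \<subseteq> face (Suc m) \<inter> {x. z' \<bullet> x = b}"
      using u_face by (auto simp: z(2) z'_def word_inner)
    show "face (Suc m) \<inter> {x. z' \<bullet> x = b} \<subseteq> word u ` Q"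
    proof
      fix x assume x: "x \<in> face (Suc m) \<inter> {x. z' \<bullet> x = b}"
      then have "x \<in> word u ` face (Suc m)" unfolding u_face by blast
      then obtain y where "y \<in> face (Suc m)" "x = word u y" by blast
      with x show "x \<in> word u ` Q" by (auto simp: z(2) z'_def word_inner)
    qed
  qed
  have le_b: "z' \<bullet> x \<le> b" if "x \<in> face (Suc m)" for x
  proof -
    have "x \<in> word u ` face (Suc m)" unfolding u_face by (rule that)
    then obtain y where "y \<in> face (Suc m)" "x = word u y" by blast
    then show ?thesis using z(1) by (auto simp: z'_def word_inner)
  qed
  have level_face: "level (Suc m) \<subseteq> face (Suc m)" unfolding face_def by (rule hull_subset)
  have uQ_hull: "word u ` Q = convex hull (level (Suc m) \<inter> {x. z' \<bullet> x = b})"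
    unfolding uQ unfolding face_def
    using le_b level_face finite_level by (intro convex_hull_Int_supporting_hyperplane) auto
  have defect: "z' \<bullet> (v0 - x) = (\<Sum>i<Suc m. coef i (v0 - x) * (z' \<bullet> a i))" if "x \<in> level (Suc m)" for x
  proof -
    have "coef i (v0 - x) = 0" if "i \<in> {..<n} - {..<Suc m}" for i
      using that \<open>x \<in> level (Suc m)\<close> by (simp add: level_def coef_def inner_diff_right)
    then show ?thesis unfolding inner_commute[of z'] inner_expand[of "v0 - x" z']
      using m by (intro sum.mono_neutral_right) auto
  qed
  have coef_nonneg: "0 \<le> coef i (v0 - x)" if "x \<in> level (Suc m)" "i < Suc m" for x i
    using coef_defect_nonneg[of i x] level_subset_V that m by auto
  have z'_nonneg: "0 \<le> z' \<bullet> a i" if "i < Suc m" for i using dom that by (simp add: z'_def)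
  have nonempty: "level (Suc m) \<inter> {x. z' \<bullet> x = b} \<noteq> {}"
  proof
    assume "level (Suc m) \<inter> {x. z' \<bullet> x = b} = {}"
    then have "word u ` Q = {}" using uQ_hull by simp
    then show False using \<open>Q \<noteq> {}\<close> by simp
  qed
  \<comment> \<open>If all these products vanished, \<open>z'\<close> would be constant on the level
    and \<open>Q\<close> would be the whole face.\<close>
  have "\<exists>k<Suc m. 0 < z' \<bullet> a k"
  proof (rule ccontr)
    assume "\<not> (\<exists>k<Suc m. 0 < z' \<bullet> a k)"
    then have zero: "z' \<bullet> a k = 0" if "k < Suc m" for k using z'_nonneg that by force
    have const: "z' \<bullet> x = z' \<bullet> v0" if "x \<in> level (Suc m)" for x
      using defect[OF that] zero by (simp add: inner_diff_right)
    from nonempty have "level (Suc m) \<inter> {x. z' \<bullet> x = b} = level (Suc m)" using const by force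
    then have "word u ` Q = word u ` face (Suc m)" using uQ_hull u_face by (simp add: face_def)
    then show False using \<open>Q \<noteq> face (Suc m)\<close> bij_word[of u] by (simp add: bij_def inj_image_eq_iff)
  qed
  then obtain k where k: "k < Suc m" "0 < z' \<bullet> a k" by blast
  have b_le: "b \<le> z' \<bullet> v0"
  proof -
    obtain x where x: "x \<in> level (Suc m)" "z' \<bullet> x = b"
      using nonempty by blast
    have "0 \<le> z' \<bullet> (v0 - x)"
      unfolding defect[OF x(1)] using coef_nonneg[OF x(1)] z'_nonneg by (intro sum_nonneg) auto
    then show ?thesis using x(2) by (simp add: inner_diff_right)
  qed
  have "level (Suc m) \<inter> {x. z' \<bullet> x = b} \<subseteq> level k"
  proof
    fix x assume x: "x \<in> level (Suc m) \<inter> {x. z' \<bullet> x = b}"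
    then have "(\<Sum>i<Suc m. coef i (v0 - x) * (z' \<bullet> a i)) \<le> 0"
      using defect[of x] b_le le_b[of v0] level_face v0_in_level[of "Suc m"] by (auto simp: inner_diff_right)
    moreover have nn: "0 \<le> coef i (v0 - x) * (z' \<bullet> a i)" if "i < Suc m" for i
      using coef_nonneg[of x i] z'_nonneg[of i] x that by simp
    moreover have "coef k (v0 - x) * (z' \<bullet> a k) \<le> (\<Sum>i<Suc m. coef i (v0 - x) * (z' \<bullet> a i))"
      using k(1) nn by (intro member_le_sum) auto
    ultimately have "coef k (v0 - x) * (z' \<bullet> a k) = 0" using nn[OF k(1)] by linarith
    then have "w k \<bullet> x = w k \<bullet> v0"
      using k dual_pos[of k] m by (simp add: coef_def inner_diff_right)
    then show "x \<in> level k" using level_eq[of k] level_subset_V x k m by auto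
  qed
  then have sub_k: "word u ` Q \<subseteq> face k" unfolding uQ_hull face_def by (rule hull_mono)
  have dim_uQ: "aff_dim (word u ` Q) = int m"
    using Q(2) aff_dim_injective_linear_image[OF word_linear] bij_word[of u] by (simp add: bij_def)
  have "int m \<le> int k"
    using aff_dim_subset[OF sub_k] dim_uQ aff_dim_face[of k] k m by simp
  then have km: "k = m" using k by simp
  have "face (Suc m) \<inter> {x. z' \<bullet> x = b} face_of face (Suc m)"
    using le_b by (intro face_of_Int_supporting_hyperplane_le) (auto simp: face_def)
  then have "word u ` Q face_of face m"
    unfolding uQ[symmetric] using face_of_face[OF face_face_of[of m "Suc m"]] sub_k km m by auto
  then have "word u ` Q = face m"
    using face_of_aff_dim_lt[of "face m" "word u ` Q"] dim_uQ aff_dim_face[of m] m by (force simp: face_def)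
  moreover have "word (rev u) ` word u ` Q = Q" by (simp add: image_image word_rev')
  ultimately have "Q = word (rev u) ` face m" by simp
  then show ?thesis using rev_in_lists[OF u] by blast
qed

text \<open>Downward induction on the rank: once the members above rank \<open>m\<close> are
  standard, the next one is a facet of \<open>face (Suc m)\<close>. The correcting word has letters
  at most \<open>m\<close>, so it preserves every \<open>face k\<close> with
  \<open>k > m\<close>.\<close>

lemma flag_transitive:
  assumes X: "X \<in> flags n (convex_polytope_faces (face n))"
  shows "\<exists>u\<in>lists {..<n}. \<forall>k<n. X ! k = word u ` face k"
proof -
  have Xk: "X ! k face_of face n" "aff_dim (X ! k) = int k" if "k < n" for k
    using X that by (auto simp: flags_def convex_polytope_faces_def)
  have "\<exists>u\<in>lists {..<n}. \<forall>k. m \<le> k \<longrightarrow> k < n \<longrightarrow> X ! k = word u ` face k" if "m \<le> n" for m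
    using that
  proof (induction m rule: inc_induct)
    case base
    show ?case by (intro bexI[of _ "[]"]) auto
  next
    case (step m)
    then obtain u where u: "u \<in> lists {..<n}" "\<And>k. Suc m \<le> k \<Longrightarrow> k < n \<Longrightarrow> X ! k = word u ` face k"
      by blast
    let ?Q = "word (rev u) ` (X ! m)"
    have inj: "inj (word (rev u))" using bij_word by (simp add: bij_def)
    have undo: "word u ` word (rev u) ` A = A" for A by (simp add: image_image word_rev)
    have "X ! m \<subseteq> word u ` face (Suc m)"
    proof (cases "Suc m < n")
      case True
      then have "X ! m \<subset> X ! Suc m" using X by (simp add: flags_def)
      then show ?thesis using u(2)[of "Suc m"] True by auto
    next
      case False
      \<comment> \<open>At the top the enclosing face is the polytope itself, which words
        preserve.\<close>
      then have "Suc m = n" using step by simp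
      moreover have "word u ` face n = face n"
        unfolding face_def word_hull level_n by (simp only: word_V_image[OF u(1)])
      ultimately show ?thesis using face_of_imp_subset[OF Xk(1)] step by simp
    qed
    then have sub: "?Q \<subseteq> face (Suc m)" by (force simp: word_rev')
    have "?Q face_of word (rev u) ` face n"
      using Xk(1)[of m] step face_of_linear_image[OF word_linear inj] by simp
    then have "?Q face_of face n"
      unfolding face_def word_hull level_n by (simp only: word_V_image[OF rev_in_lists[OF u(1)]])
    then have "?Q face_of face (Suc m)"
      using face_of_face[OF face_face_of[of "Suc m" n]] sub step by simp
    moreover have "aff_dim ?Q = int m"
      using Xk(2)[of m] step aff_dim_injective_linear_image[OF word_linear inj] by simp
    ultimately obtain u' where u': "u' \<in> lists {..<Suc m}" "?Q = word u' ` face m"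
      using facet_of_face[of m ?Q] step by auto
    have "X ! k = word (u @ u') ` face k" if "m \<le> k" "k < n" for k
    proof (cases "k = m")
      case True
      then show ?thesis using undo[of "X ! m"] u'(2) unfolding word_map_append image_compose_eq by simp
    next
      case False
      then have "word u' ` face k = face k"
        using u'(1) that by (intro word_face_image lists_below[of _ "Suc m"]) auto
      then show ?thesis using u(2)[of k] False that unfolding word_map_append image_compose_eq by simp
    qed
    moreover have "u @ u' \<in> lists {..<n}"
      using u(1) u'(1) step by (auto simp: in_lists_conv_set)
    ultimately show ?case by blast
  qed
  from this[of 0] show ?thesis by simp
qed

text \<open>
  Barycentres of the faces of the base flag: the centre of \<open>face j\<close> spans the line orthogonal to
  all roots except \<open>a j\<close>.
\<close>

definition centre :: "nat \<Rightarrow> 'a" where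
  "centre j = (\<Sum>x\<in>level j. x)"

text \<open>A word that preserves \<open>face j\<close> permutes its vertices and hence fixes their
  sum.\<close>

lemma centre_fixed:
  assumes "u \<in> lists {..<n}" "j < n" "word u ` face j = face j"
  shows "word u (centre j) = centre j"
proof -
  have lvl: "level j = V \<inter> face j"
  proof
    have "face j \<subseteq> {x. w j \<bullet> x = w j \<bullet> v0}" using face_eq[OF assms(2) order.refl] by blast
    then show "V \<inter> face j \<subseteq> level j" using level_eq[OF assms(2)] by blast
    show "level j \<subseteq> V \<inter> face j"
      using level_subset_V hull_subset[of "level j" convex] by (auto simp: face_def)
  qed
  have inj: "inj (word u)" using bij_word by (simp add: bij_def)
  have "word u ` level j = level j"
    unfolding lvl image_Int[OF inj] word_V_image[OF assms(1)] assms(3) ..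
  moreover have "word u (centre j) = (\<Sum>x\<in>level j. word u x)"
    unfolding centre_def by (rule linear_sum[OF word_linear])
  moreover have "(\<Sum>x\<in>level j. word u x) = (\<Sum>x\<in>word u ` level j. x)"
    using inj by (subst sum.reindex) (auto intro: inj_on_subset)
  ultimately show ?thesis by (simp add: centre_def)
qed

lemma centre_orthogonal:
  assumes "i < n" "j < n" "i \<noteq> j"
  shows "centre j \<bullet> a i = 0"
proof -
  have "word [i] (centre j) = centre j"
    using assms by (intro centre_fixed word_face_image) auto
  then have "R i (centre j) = centre j" by simp
  then have "R i (centre j) \<bullet> a i = centre j \<bullet> a i" by simp
  then show ?thesis using root_pos[OF assms(1)] by (simp add: inner_reflect_left)
qed

text \<open>\<open>w j\<close> is constant and positive on the level, so the centre is not zero;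
  being orthogonal to all other roots, it cannot be orthogonal to \<open>a j\<close> as
  well.\<close>

lemma centre_own: "j < n \<Longrightarrow> centre j \<bullet> a j \<noteq> 0"
proof
  assume j: "j < n" and zero: "centre j \<bullet> a j = 0"
  have "centre j = 0"
  proof (rule eq_0_if_orthogonal)
    fix i assume "i < n"
    then show "centre j \<bullet> a i = 0" using zero centre_orthogonal[of i j] j by (cases "i = j") auto
  qed
  moreover have "w j \<bullet> centre j = real (card (level j)) * (w j \<bullet> v0)"
    unfolding centre_def inner_sum_right using level_eq[OF j] by simp
  moreover have "level j \<noteq> {}" using v0_in_level by blast
  ultimately show False using w_v0[OF j] finite_level by simp
qed

lemma coef_0_if_centre: "j < n \<Longrightarrow> y \<bullet> centre j = 0 \<Longrightarrow> coef j y = 0"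
proof -
  assume j: "j < n" and "y \<bullet> centre j = 0"
  moreover have "y \<bullet> centre j = (\<Sum>i<n. if i = j then coef j y * (a j \<bullet> centre j) else 0)"
    unfolding inner_expand[of y] using centre_orthogonal[of _ j] j
    by (intro sum.cong) (auto simp: inner_commute)
  ultimately show "coef j y = 0" using centre_own[OF j] j by (simp add: inner_commute)
qed

lemma eq_0_if_coef: "(\<And>i. i < n \<Longrightarrow> coef i y = 0) \<Longrightarrow> y = 0"
  using expand[of y] by simp

text \<open>An isometry that fixes the centres displaces every vector by something orthogonal to all
  of them, and only 0 is.\<close>

lemma word_eq_id:
  assumes u: "u \<in> lists {..<n}" and fixes_face: "\<And>k. k < n \<Longrightarrow> word u ` face k = face k"
  shows "word u = id"
proof
  fix x
  have "(word u x - x) \<bullet> centre j = 0" if "j < n" for j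
    using word_inner[of u x "centre j"] centre_fixed[OF u that fixes_face[OF that]]
    by (simp add: inner_diff_left)
  then have "word u x - x = 0" by (intro eq_0_if_coef coef_0_if_centre)
  then show "word u x = id x" by simp
qed

text \<open>\<open>a i\<close> is orthogonal to the fixed centres, so its image is a multiple of
  \<open>a i\<close>, and by isometry it is \<open>a i\<close> or its negative. The negative case is
  reduced to the other by composing with \<open>R i\<close>.\<close>

lemma word_eq_id_or_move:
  assumes u: "u \<in> lists {..<n}" and i: "i < n"
    and fixes_face: "\<And>k. k < n \<Longrightarrow> k \<noteq> i \<Longrightarrow> word u ` face k = face k"
  shows "word u = id \<or> word u = R i"
proof -
  have fixes_centre: "word u (centre j) = centre j" if "j < n" "j \<noteq> i" for j
    using centre_fixed[OF u that(1) fixes_face[OF that]] .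
  have "coef j (word u (a i)) = 0" if "j < n" "j \<noteq> i" for j
    using word_inner[of u "a i" "centre j"] fixes_centre[OF that] centre_orthogonal[of i j] that i
    by (intro coef_0_if_centre) (simp_all add: inner_commute)
  then have "(\<Sum>j<n. coef j (word u (a i)) *\<^sub>R a j) = (\<Sum>j<n. if j = i then coef i (word u (a i)) *\<^sub>R a i else 0)"
    by (intro sum.cong) auto
  then obtain t where t: "word u (a i) = t *\<^sub>R a i" using expand[of "word u (a i)"] i by auto
  then have "t * t * (a i \<bullet> a i) = a i \<bullet> a i" using word_inner[of u "a i" "a i"] by simp
  then have "t * t = 1" using root_pos[OF i] by simp
  then have "t = 1 \<or> t = - 1" by (simp add: square_eq_1_iff)
  have id_if: "word u' = id"
    if u': "\<And>j. j < n \<Longrightarrow> j \<noteq> i \<Longrightarrow> word u' (centre j) = centre j" "word u' (a i) = a i" for u'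
  proof
    fix x
    let ?y = "word u' x - x"
    have "coef j ?y = 0" if "j < n" "j \<noteq> i" for j
      using word_inner[of u' x "centre j"] u'(1)[OF that] that
      by (intro coef_0_if_centre) (simp_all add: inner_diff_left)
    then have "(\<Sum>j<n. coef j ?y *\<^sub>R a j) = (\<Sum>j<n. if j = i then coef i ?y *\<^sub>R a i else 0)"
      by (intro sum.cong) auto
    then have y: "?y = coef i ?y *\<^sub>R a i" using expand[of ?y] i by simp
    moreover have "?y \<bullet> a i = 0" using word_inner[of u' x "a i"] u'(2) by (simp add: inner_diff_left)
    ultimately have "coef i ?y * (a i \<bullet> a i) = 0" by (metis inner_scaleR_left)
    then have "?y = 0" using root_pos[OF i] y by simp
    then show "word u' x = id x" by simp
  qed
  show ?thesis
  proof (cases "t = 1")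
    case True
    then show ?thesis using id_if[of u] fixes_centre t by simp
  next
    case False
    then have "t = - 1" using \<open>t = 1 \<or> t = - 1\<close> by simp
    have "word (i # u) = id"
    proof (rule id_if)
      show "word (i # u) (centre j) = centre j" if "j < n" "j \<noteq> i" for j
        using fixes_centre[OF that] centre_orthogonal[of i j] that i by (simp add: reflect_eq_self)
      show "word (i # u) (a i) = a i"
        using t \<open>t = - 1\<close> root_pos[OF i] by (simp add: reflect_def scaleR_2)
    qed
    then have "R i (word u x) = x" for x by (simp add: fun_eq_iff)
    then have "word u x = R i x" for x using reflect_reflect[of "a i" "word u x"] by simp
    then show ?thesis by auto
  qed
qed

sublocale regular_flags n "convex_polytope_faces (face n)" R face
proof
  show "face k \<in> convex_polytope_faces (face n) k" if "k < n" for k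
    using that face_face_of[of k n] aff_dim_face[of k] by (simp add: convex_polytope_faces_def)
  show "face k \<subset> face (Suc k)" if "Suc k < n" for k
  proof -
    have "face k \<noteq> face (Suc k)"
      using aff_dim_face[of k] aff_dim_face[of "Suc k"] that by auto
    then show ?thesis using face_of_imp_subset[OF face_face_of[of k "Suc k"]] that by auto
  qed
  show "face_automorphism n (convex_polytope_faces (face n)) (R i)" if i: "i < n" for i
  proof -
    have inj: "inj (R i)" using bij_reflect by (rule bij_is_inj)
    have "word [i] ` face n = face n"
      unfolding face_def word_hull level_n using i word_V_image[of "[i]"] by (simp del: word_map_Cons)
    then have "R i ` face n = face n" by simp
    then show ?thesis
      unfolding face_automorphism_def convex_polytope_faces_def
      using face_of_linear_image[OF linear_reflect inj, of _ "face n"]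
        aff_dim_injective_linear_image[OF linear_reflect inj] bij_reflect by auto
  qed
  show same: "R i ` face k = face k" if "i < n" "k < n" "k \<noteq> i" for i k
    using word_face_image[of "[i]" k] that by simp
  show "R i ` face i \<noteq> face i" if i: "i < n" for i
  proof
    assume "R i ` face i = face i"
    then have "word [i] = id"
    proof (intro word_eq_id)
      show "word [i] ` face k = face k" if "k < n" for k
        using same[OF i that] \<open>R i ` face i = face i\<close> by (cases "k = i") simp_all
    qed (use i in simp)
    then have "R i (a i) = a i" by (simp add: fun_eq_iff)
    then show False using root_pos[OF i] by (simp add: reflect_def)
  qed
  show "word u = id" if "u \<in> lists {..<n}" "\<And>k. k < n \<Longrightarrow> word u ` face k = face k" for u
    using that by (rule word_eq_id)
  have automorphism_word: "face_automorphism n (convex_polytope_faces (face n)) (word u)" if "u \<in> lists {..<n}" for u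
    by (intro face_automorphism_word_map that) fact
  show "\<exists>g. face_automorphism n (convex_polytope_faces (face n)) g \<and> (\<forall>k<n. X ! k = g ` face k)"
    if "X \<in> flags n (convex_polytope_faces (face n))" for X
    using flag_transitive[OF that] automorphism_word by blast
  show "Y ! i = face i \<or> Y ! i = R i ` face i"
    if Y: "Y \<in> flags n (convex_polytope_faces (face n))" and i: "i < n"
      and same: "\<And>k. k < n \<Longrightarrow> k \<noteq> i \<Longrightarrow> Y ! k = face k" for Y i
  proof -
    \<comment> \<open>The adjacent flag is itself the image of the base flag under a word, and this
      word preserves all members but one.\<close>
    obtain u where u: "u \<in> lists {..<n}" "\<forall>k<n. Y ! k = word u ` face k"
      using flag_transitive[OF Y] by blast
    have "word u = id \<or> word u = R i"
      using u same by (intro word_eq_id_or_move[OF u(1) i]) metis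
    then show ?thesis using u(2) i by auto
  qed
qed

end

section \<open>Orders of products of two reflections\<close>

lemma reflect_commute: "a \<bullet> b = 0 \<Longrightarrow> reflect a \<circ> reflect b = reflect b \<circ> reflect a"
  by (simp add: fun_eq_iff reflect_def inner_diff_left inner_commute algebra_simps)

text \<open>Words in two reflections move \<open>x\<close> within its translate of the span of
  \<open>a\<close> and \<open>b\<close>, so only the coefficients \<open>s\<close> and
  \<open>t\<close> have to be tracked.\<close>

lemma reflect_combination:
  assumes "a \<noteq> 0"
  shows "reflect a (x - s *\<^sub>R a - t *\<^sub>R b)
    = x - (2 * (x \<bullet> a) / (a \<bullet> a) - s - 2 * (a \<bullet> b) / (a \<bullet> a) * t) *\<^sub>R a - t *\<^sub>R b"
proof -
  have *: "2 * ((x - s *\<^sub>R a - t *\<^sub>R b) \<bullet> a) / (a \<bullet> a)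
      = 2 * (x \<bullet> a) / (a \<bullet> a) - s - s - 2 * (a \<bullet> b) / (a \<bullet> a) * t"
    using assms by (simp add: inner_diff_left inner_add_left inner_commute[of b a] field_simps)
  have "(s * 2) *\<^sub>R a = s *\<^sub>R a + s *\<^sub>R a" by (simp only: mult_2_right scaleR_add_left)
  then show ?thesis unfolding reflect_def * by (simp add: algebra_simps)
qed

lemma reflect_combination':
  assumes "b \<noteq> 0"
  shows "reflect b (x - s *\<^sub>R a - t *\<^sub>R b)
    = x - s *\<^sub>R a - (2 * (x \<bullet> b) / (b \<bullet> b) - 2 * (a \<bullet> b) / (b \<bullet> b) * s - t) *\<^sub>R b"
  using reflect_combination[OF assms, of x t s a] by (simp add: inner_commute algebra_simps)

context
  fixes a b :: "'a::euclidean_space"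
  assumes a: "a \<noteq> 0" and b: "b \<noteq> 0"
begin

lemma reflect_order_3:
  assumes "2 * (a \<bullet> b) = - (a \<bullet> a)" "2 * (a \<bullet> b) = - (b \<bullet> b)"
  shows "(reflect a \<circ> reflect b) ^^ 3 = id"
proof
  fix x
  have "2 * (a \<bullet> b) / (a \<bullet> a) = - 1" unfolding assms(1) using a by simp
  moreover have "2 * (a \<bullet> b) / (b \<bullet> b) = - 1" unfolding assms(2) using b by simp
  ultimately have pq: "2 * (a \<bullet> b) / (a \<bullet> a) = - 1" "2 * (a \<bullet> b) / (b \<bullet> b) = - 1" .
  note step = reflect_combination[OF a, of x _ _ b, unfolded pq] reflect_combination'[OF b, of x _ a, unfolded pq]
  have "x = x - 0 *\<^sub>R a - 0 *\<^sub>R b" by simp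
  then have "((reflect a \<circ> reflect b) ^^ 3) x = ((reflect a \<circ> reflect b) ^^ 3) (x - 0 *\<^sub>R a - 0 *\<^sub>R b)"
    by (rule arg_cong)
  also have "\<dots> = x"
    unfolding numeral_3_eq_3 funpow.simps comp_apply id_apply step by simp
  finally show "((reflect a \<circ> reflect b) ^^ 3) x = id x" by simp
qed

lemma reflect_order_4:
  assumes "a \<bullet> b = - (a \<bullet> a)" "2 * (a \<bullet> b) = - (b \<bullet> b)"
  shows "(reflect a \<circ> reflect b) ^^ 4 = id"
proof
  fix x
  have "2 * (a \<bullet> b) / (a \<bullet> a) = - 2" unfolding assms(1) using a by simp
  moreover have "2 * (a \<bullet> b) / (b \<bullet> b) = - 1" unfolding assms(2) using b by simp
  ultimately have pq: "2 * (a \<bullet> b) / (a \<bullet> a) = - 2" "2 * (a \<bullet> b) / (b \<bullet> b) = - 1" .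
  have four: "(4 :: nat) = Suc (Suc (Suc (Suc 0)))" by simp
  note step = reflect_combination[OF a, of x _ _ b, unfolded pq] reflect_combination'[OF b, of x _ a, unfolded pq]
  have "x = x - 0 *\<^sub>R a - 0 *\<^sub>R b" by simp
  then have "((reflect a \<circ> reflect b) ^^ 4) x = ((reflect a \<circ> reflect b) ^^ 4) (x - 0 *\<^sub>R a - 0 *\<^sub>R b)"
    by (rule arg_cong)
  also have "\<dots> = x"
    unfolding four funpow.simps comp_apply id_apply step by simp
  finally show "((reflect a \<circ> reflect b) ^^ 4) x = id x" by simp
qed

end

section \<open>Arithmetic of the golden ratio and the label 5\<close>

lemma golden_ratio_square: "golden_ratio * golden_ratio = golden_ratio + 1"
  by (simp add: golden_ratio_def field_simps)

text \<open>Successive Fibonacci quotients, close enough together for all sign tests that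
  follow.\<close>

lemma golden_ratio_bounds: "8 / 5 < golden_ratio" "golden_ratio < 13 / 8"
proof -
  have "11 / 5 < sqrt 5" by (rule real_less_rsqrt) (simp add: power2_eq_square)
  then show "8 / 5 < golden_ratio" by (simp add: golden_ratio_def)
  have "sqrt 5 < 9 / 4" by (rule real_less_lsqrt) (simp_all add: power2_eq_square)
  then show "golden_ratio < 13 / 8" by (simp add: golden_ratio_def)
qed

text \<open>The right-nested form lets the simplifier find the square inside normalized
  products.\<close>

lemma golden_ratio_identity:
  defines "g \<equiv> golden_ratio"
  shows "g * (g * c) = g * c + c"
  using golden_ratio_square by (metis g_def distrib_right mult.assoc mult_1)

text \<open>The roots have equal length and the cosine of their angle is -phi/2 = -cos(pi/5), so the
  product is a rotation of order 5 in their plane.\<close>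

lemma reflect_order_5:
  assumes a: "a \<noteq> 0" and b: "b \<noteq> 0"
    and "2 * (a \<bullet> b) = - golden_ratio * (a \<bullet> a)" "2 * (a \<bullet> b) = - golden_ratio * (b \<bullet> b)"
  shows "(reflect a \<circ> reflect b) ^^ 5 = id"
proof
  fix x
  define g where "g = golden_ratio"
  have g: "g * g = g + 1" "g * (g * c) = g * c + c" for c
    unfolding g_def by (rule golden_ratio_square, rule golden_ratio_identity)
  have "2 * (a \<bullet> b) / (a \<bullet> a) = - g" unfolding assms(3) using a by (simp add: g_def)
  moreover have "2 * (a \<bullet> b) / (b \<bullet> b) = - g" unfolding assms(4) using b by (simp add: g_def)
  ultimately have pq: "2 * (a \<bullet> b) / (a \<bullet> a) = - g" "2 * (a \<bullet> b) / (b \<bullet> b) = - g" .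
  have five: "(5 :: nat) = Suc (Suc (Suc (Suc (Suc 0))))" by simp
  define \<alpha> \<beta> where "\<alpha> = 2 * (x \<bullet> a) / (a \<bullet> a)" and "\<beta> = 2 * (x \<bullet> b) / (b \<bullet> b)"
  have A: "reflect a (x - s *\<^sub>R a - t *\<^sub>R b) = x - (\<alpha> - s + g * t) *\<^sub>R a - t *\<^sub>R b" for s t
    using reflect_combination[OF a, of x s t b] unfolding pq \<alpha>_def by simp
  have B: "reflect b (x - s *\<^sub>R a - t *\<^sub>R b) = x - s *\<^sub>R a - (\<beta> + g * s - t) *\<^sub>R b" for s t
    using reflect_combination'[OF b, of x s a t] unfolding pq \<beta>_def by simp
  have 1: "(reflect a \<circ> reflect b) (x - s *\<^sub>R a - t *\<^sub>R b)
      = x - (\<alpha> + g * \<beta> + g * s - g * t) *\<^sub>R a - (\<beta> + g * s - t) *\<^sub>R b" for s t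
    unfolding comp_apply A B by (simp add: algebra_simps g)
  have "((reflect a \<circ> reflect b) ^^ 5) x = ((reflect a \<circ> reflect b) ^^ 5) (x - 0 *\<^sub>R a - 0 *\<^sub>R b)"
    by simp
  also have "\<dots> = x - 0 *\<^sub>R a - 0 *\<^sub>R b"
    unfolding five funpow.simps comp_apply[of "reflect a \<circ> reflect b"] id_apply 1
    by (simp add: algebra_simps g)
  finally show "((reflect a \<circ> reflect b) ^^ 5) x = id x" by simp
qed

section \<open>Exact computation with coordinates in the ring generated by the golden ratio\<close>

text \<open>The pair \<open>(p, q)\<close> stands for \<open>p + q \<phi>\<close>.\<close>

type_synonym zphi = "int \<times> int"

definition zr :: "zphi \<Rightarrow> real" where
  "zr z = of_int (fst z) + of_int (snd z) * golden_ratio"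

definition zsub :: "zphi \<Rightarrow> zphi \<Rightarrow> zphi" where
  "zsub x y = (fst x - fst y, snd x - snd y)"

definition zmul :: "zphi \<Rightarrow> zphi \<Rightarrow> zphi" where
  "zmul x y = (fst x * fst y + snd x * snd y, fst x * snd y + snd x * fst y + snd x * snd y)"

text \<open>Sufficient for positivity, from \<open>8/5 < \<phi> < 13/8\<close>.\<close>

definition zpos :: "zphi \<Rightarrow> bool" where
  "zpos z = (if 0 \<le> snd z then 0 < 5 * fst z + 8 * snd z else 0 < 8 * fst z + 13 * snd z)"

lemma zr_zsub: "zr (zsub x y) = zr x - zr y"
  by (simp add: zr_def zsub_def algebra_simps)

lemma zr_zmul: "zr (zmul x y) = zr x * zr y"
proof -
  have "zr x * zr y = of_int (fst x) * of_int (fst y) + (of_int (fst x) * of_int (snd y) + of_int (snd x) * of_int (fst y)) * golden_ratio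
      + of_int (snd x) * of_int (snd y) * (golden_ratio * golden_ratio)"
    by (simp add: zr_def algebra_simps)
  then show ?thesis unfolding golden_ratio_square by (simp add: zr_def zmul_def algebra_simps)
qed

lemma zr_int [simp]: "zr (p, 0) = of_int p"
  by (simp add: zr_def)

lemma zpos_zr: "zpos z \<Longrightarrow> 0 < zr z"
proof -
  assume z: "zpos z"
  obtain p q where pq: "z = (p, q)" by (cases z)
  show "0 < zr z"
  proof (cases "0 \<le> q")
    case True
    then have "0 < 5 * p + 8 * q" using z by (simp add: zpos_def pq)
    then have "0 < real_of_int (5 * p + 8 * q)" by (simp only: of_int_0_less_iff)
    then have "0 < real_of_int p + real_of_int q * (8 / 5)" by simp
    also have "\<dots> \<le> zr z"
      using mult_left_mono[of "8 / 5" golden_ratio "real_of_int q"] golden_ratio_bounds True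
      by (simp add: zr_def pq)
    finally show ?thesis .
  next
    case False
    then have "0 < 8 * p + 13 * q" using z by (simp add: zpos_def pq)
    then have "0 < real_of_int (8 * p + 13 * q)" by (simp only: of_int_0_less_iff)
    then have "0 < real_of_int p + real_of_int q * (13 / 8)" by simp
    also have "\<dots> \<le> zr z"
      using mult_left_mono_neg[of golden_ratio "13 / 8" "real_of_int q"] golden_ratio_bounds False
      by (simp add: zr_def pq)
    finally show ?thesis .
  qed
qed

section \<open>Vectors with coordinates in the ring\<close>

fun zdot :: "zphi list \<Rightarrow> zphi list \<Rightarrow> zphi" where
  "zdot (x # xs) (y # ys) =
     (let z = zmul x y; w = zdot xs ys in (fst z + fst w, snd z + snd w))"
| "zdot _ _ = (0, 0)"

fun zaxpy :: "zphi \<Rightarrow> zphi list \<Rightarrow> zphi list \<Rightarrow> zphi list" where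
  "zaxpy c (x # xs) (y # ys) = zsub x (zmul c y) # zaxpy c xs ys"
| "zaxpy c _ _ = []"

fun zvec :: "(nat \<Rightarrow> 'a::real_vector) \<Rightarrow> zphi list \<Rightarrow> 'a" where
  "zvec e [] = 0"
| "zvec e (x # xs) = zr x *\<^sub>R e 0 + zvec (\<lambda>i. e (Suc i)) xs"

lemma zvec_zaxpy:
  "length xs = length ys \<Longrightarrow> zvec e (zaxpy c xs ys) = zvec e xs - zr c *\<^sub>R zvec e ys"
  by (induction c xs ys arbitrary: e rule: zaxpy.induct) (simp_all add: zr_zsub zr_zmul algebra_simps)

lemma length_zaxpy [simp]: "length (zaxpy c xs ys) = min (length xs) (length ys)"
  by (induction c xs ys rule: zaxpy.induct) simp_all

text \<open>The norm of the basis vectors absorbs a common denominator of the coordinates.\<close>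

definition scaled_basis :: "real \<Rightarrow> nat \<Rightarrow> (nat \<Rightarrow> 'a::euclidean_space) \<Rightarrow> bool" where
  "scaled_basis c n e \<longleftrightarrow> 0 < c \<and> (\<forall>i<n. \<forall>j<n. e i \<bullet> e j = (if i = j then c else 0))"

lemma inner_zvec_eq_0: "(\<And>i. i < length xs \<Longrightarrow> y \<bullet> e i = 0) \<Longrightarrow> y \<bullet> zvec e xs = 0"
proof (induction xs arbitrary: e)
  case (Cons x xs)
  then have "y \<bullet> zvec (\<lambda>i. e (Suc i)) xs = 0" by (intro Cons.IH) simp
  then show ?case using Cons.prems[of 0] by (simp add: inner_add_right)
qed simp

lemma inner_zvec:
  "scaled_basis c (length xs) e \<Longrightarrow> length ys = length xs \<Longrightarrow> zvec e xs \<bullet> zvec e ys = c * zr (zdot xs ys)"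
proof (induction xs ys arbitrary: e rule: zdot.induct)
  case (1 x xs y ys)
  let ?e = "\<lambda>i. e (Suc i)"
  have IH: "zvec ?e xs \<bullet> zvec ?e ys = c * zr (zdot xs ys)"
    using 1 by (intro "1.IH") (auto simp: scaled_basis_def)
  have 0: "e 0 \<bullet> zvec ?e ys = 0" "e 0 \<bullet> zvec ?e xs = 0"
    using "1.prems" by (auto intro!: inner_zvec_eq_0 simp: scaled_basis_def)
  moreover have "zvec ?e xs \<bullet> e 0 = 0" using 0(2) by (simp only: inner_commute)
  moreover have "e 0 \<bullet> e 0 = c" using "1.prems" by (simp add: scaled_basis_def)
  ultimately have "zvec e (x # xs) \<bullet> zvec e (y # ys) = c * (zr (zmul x y) + zr (zdot xs ys))"
    using IH by (simp add: inner_add_left inner_add_right zr_zmul algebra_simps)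
  then show ?case by (simp add: Let_def zr_def algebra_simps)
qed (simp_all add: zr_def)

text \<open>A root is stored with its squared length, which is a rational integer in all our cases.\<close>

type_synonym zroot = "zphi list \<times> int"

definition zcoef :: "zroot \<Rightarrow> zphi list \<Rightarrow> zphi" where
  "zcoef A X = (let d = zdot X (fst A) in (2 * fst d div snd A, 2 * snd d div snd A))"

text \<open>The quotients in \<open>zcoef\<close> are integer divisions; this condition makes them
  exact.\<close>

definition zexact :: "zroot \<Rightarrow> zphi list \<Rightarrow> bool" where
  "zexact A X = (let d = zdot X (fst A) in snd A dvd 2 * fst d \<and> snd A dvd 2 * snd d)"

definition zreflect :: "zroot \<Rightarrow> zphi list \<Rightarrow> zphi list" where
  "zreflect A X = zaxpy (zcoef A X) X (fst A)"

lemma zvec_zreflect: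
  assumes e: "scaled_basis c (length X) e" and l: "length (fst A) = length X"
    and N: "0 < snd A" "zdot (fst A) (fst A) = (snd A, 0)" and ex: "zexact A X"
  shows "zvec e (zreflect A X) = reflect (zvec e (fst A)) (zvec e X)"
proof -
  have c: "c > 0" using e by (simp add: scaled_basis_def)
  obtain p q where d: "zdot X (fst A) = (p, q)" by (cases "zdot X (fst A)")
  have "snd A dvd 2 * p" "snd A dvd 2 * q" using ex by (simp_all add: zexact_def d)
  then have "real_of_int (2 * p div snd A) = real_of_int (2 * p) / snd A"
      "real_of_int (2 * q div snd A) = real_of_int (2 * q) / snd A"
    by (simp_all only: real_of_int_div)
  then have "zr (zcoef A X) = 2 * zr (zdot X (fst A)) / snd A"
    by (simp add: zcoef_def d zr_def field_simps add_divide_distrib)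
  moreover have "zvec e X \<bullet> zvec e (fst A) = c * zr (zdot X (fst A))"
    using inner_zvec[OF e] l by simp
  moreover have "zvec e (fst A) \<bullet> zvec e (fst A) = c * snd A"
    using inner_zvec[of c "fst A" e "fst A"] e l N by simp
  ultimately show ?thesis
    using c l by (simp add: zreflect_def zvec_zaxpy reflect_def)
qed

text \<open>The vertices are given up to the signs of their coordinates.\<close>

definition zsigns :: "zphi list \<Rightarrow> zphi list list" where
  "zsigns xs = product_lists (map (\<lambda>x. if x = (0, 0) then [x] else [x, zsub (0, 0) x]) xs)"

definition zmatch :: "zphi list \<Rightarrow> zphi list \<Rightarrow> bool" where
  "zmatch X cs \<longleftrightarrow> list_all2 (\<lambda>x c. x = c \<or> x = zsub (0, 0) c) X cs"

lemma zmatch_iff: "zmatch X cs \<longleftrightarrow> X \<in> set (zsigns cs)"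
proof -
  have "(x = c \<or> x = zsub (0, 0) c) = (x \<in> set (if c = (0, 0) then [c] else [c, zsub (0, 0) c]))" for x c
    by (auto simp: zsub_def)
  then show ?thesis by (simp add: zmatch_def zsigns_def product_lists_set list.rel_map)
qed

text \<open>The assumptions of \<open>wythoff\<close> in decidable form, together with exactness of
  the divisions in \<open>zreflect\<close>.\<close>

definition zcheck :: "nat \<Rightarrow> zroot list \<Rightarrow> zphi list list \<Rightarrow> zphi list \<Rightarrow> zphi list list \<Rightarrow> bool" where
  "zcheck n As Ws v ps \<longleftrightarrow>
     length As = n \<and> length Ws = n \<and> length v = n \<and> list_ex (zmatch v) ps \<and>
     list_all (\<lambda>A. length (fst A) = n \<and> 0 < snd A \<and> zdot (fst A) (fst A) = (snd A, 0)) As \<and>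
     list_all (\<lambda>W. length W = n \<and> zpos (zdot W v)) Ws \<and>
     list_all (\<lambda>i. list_all (\<lambda>j.
       if i = j then zpos (zdot (Ws ! i) (fst (As ! j))) else zdot (Ws ! i) (fst (As ! j)) = (0, 0)) [0..<n]) [0..<n] \<and>
     list_all (\<lambda>i. list_all (\<lambda>j. let d = zdot (fst (As ! i)) (fst (As ! j)) in
       if j = Suc i then zpos (zsub (0, 0) d) else d = (0, 0)) [Suc i..<n]) [0..<n] \<and>
     zpos (zdot v (fst (As ! 0))) \<and>
     list_all (\<lambda>i. zdot v (fst (As ! i)) = (0, 0)) [1..<n] \<and>
     list_all (\<lambda>cs. list_all (\<lambda>X. length X = n \<and> zdot X X = zdot v v \<and>
       list_all (\<lambda>A. zexact A X \<and> list_ex (zmatch (zreflect A X)) ps) As \<and>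
       list_all (\<lambda>W. let d = zsub (zdot W v) (zdot W X) in d = (0, 0) \<or> zpos d) Ws) (zsigns cs)) ps"

lemma zcheck_vertex:
  assumes "zcheck n As Ws v ps" "X \<in> set (concat (map zsigns ps))"
  shows "length X = n" "zdot X X = zdot v v"
    and "A \<in> set As \<Longrightarrow> zexact A X" "A \<in> set As \<Longrightarrow> zreflect A X \<in> set (concat (map zsigns ps))"
    and "W \<in> set Ws \<Longrightarrow> zsub (zdot W v) (zdot W X) = (0, 0) \<or> zpos (zsub (zdot W v) (zdot W X))"
  using assms unfolding zcheck_def list_all_iff list_ex_iff zmatch_iff Let_def set_concat set_map
  by blast+

text \<open>The three cases encode the hypotheses of \<open>reflect_order_3\<close>,
  \<open>reflect_order_4\<close> and \<open>reflect_order_5\<close>. For the label 4 the first root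
  has to be the shorter one.\<close>

definition zlabel :: "zroot \<Rightarrow> zroot \<Rightarrow> nat option" where
  "zlabel A B = (let d = zdot (fst A) (fst B); p = fst d; q = snd d in
     if q = 0 \<and> snd A = - 2 * p \<and> snd B = - 2 * p then Some 3
     else if q = 0 \<and> snd A = - p \<and> snd B = - 2 * p then Some 4
     else if p = 0 \<and> snd A = - 2 * q \<and> snd B = - 2 * q then Some 5
     else None)"

text \<open>At each power of the Coxeter element some functional in \<open>Ws\<close> falls strictly
  below its value at \<open>v\<close>. This certifies that the vectors, and not merely the
  coordinate lists, differ.\<close>

fun no_return :: "zroot list \<Rightarrow> zphi list list \<Rightarrow> zphi list \<Rightarrow> nat \<Rightarrow> zphi list \<Rightarrow> bool" where
  "no_return As Ws v 0 X = True"
| "no_return As Ws v (Suc k) X =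
     (let Y = foldr zreflect As X in
      list_ex (\<lambda>W. zpos (zsub (zdot W v) (zdot W Y))) Ws \<and> no_return As Ws v k Y)"

locale zphi_wythoff =
  fixes n :: nat and As :: "zroot list" and Ws :: "zphi list list" and v :: "zphi list"
    and ps :: "zphi list list" and c :: real and e :: "nat \<Rightarrow> 'a::euclidean_space"
  assumes check: "zcheck n As Ws v ps" and dimension: "DIM('a) = n" and basis: "scaled_basis c n e"
begin

abbreviation L :: "zphi list list" where "L \<equiv> concat (map zsigns ps)"
abbreviation root :: "nat \<Rightarrow> 'a" where "root i \<equiv> zvec e (fst (As ! i))"

lemma c_pos: "0 < c"
  using basis by (simp add: scaled_basis_def)

lemma inner_eq: "length X = n \<Longrightarrow> length Y = n \<Longrightarrow> zvec e X \<bullet> zvec e Y = c * zr (zdot X Y)"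
  using inner_zvec[of c X e Y] basis by simp

lemma lengths: "length As = n" "length Ws = n" "length v = n"
  and length_root: "i < n \<Longrightarrow> length (fst (As ! i)) = n"
  and length_dual: "i < n \<Longrightarrow> length (Ws ! i) = n"
  using check by (simp_all add: zcheck_def list_all_iff)

lemma length_vertex: "X \<in> set L \<Longrightarrow> length X = n"
  by (rule zcheck_vertex(1)[OF check])

lemma v_in_L: "v \<in> set L"
proof -
  have "list_ex (zmatch v) ps" using check by (simp add: zcheck_def)
  then show ?thesis by (simp add: list_ex_iff zmatch_iff)
qed

lemma zvec_reflect:
  assumes "X \<in> set L" "i < n"
  shows "zvec e (zreflect (As ! i) X) = reflect (root i) (zvec e X)" "zreflect (As ! i) X \<in> set L"
proof -
  have A: "As ! i \<in> set As" using assms(2) lengths by simp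
  then show "zreflect (As ! i) X \<in> set L"
    by (rule zcheck_vertex(4)[OF check assms(1)])
  have "zexact (As ! i) X" by (rule zcheck_vertex(3)[OF check assms(1) A])
  moreover have "length (fst (As ! i)) = n" "0 < snd (As ! i)" "zdot (fst (As ! i)) (fst (As ! i)) = (snd (As ! i), 0)"
    using check A unfolding zcheck_def list_all_iff by blast+
  ultimately show "zvec e (zreflect (As ! i) X) = reflect (root i) (zvec e X)"
    using basis length_vertex[OF assms(1)] by (intro zvec_zreflect[of c]) simp_all
qed

sublocale wythoff n "zvec e ` set L" root "\<lambda>i. zvec e (Ws ! i)" "zvec e v"
proof
  show "DIM('a) = n" by (rule dimension)
  show "finite (zvec e ` set L)" by simp
  show "zvec e v \<in> zvec e ` set L" by (rule imageI[OF v_in_L])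
  show "zvec e (Ws ! i) \<bullet> root j = 0" if "i < n" "j < n" "i \<noteq> j" for i j
    using check that by (simp add: inner_eq length_root length_dual zcheck_def list_all_iff zr_def)
  show "0 < zvec e (Ws ! i) \<bullet> root i" if "i < n" for i
    using check that zpos_zr c_pos by (simp add: inner_eq length_root length_dual zcheck_def list_all_iff)
  show "root i \<bullet> root (Suc i) < 0" if "Suc i < n" for i
  proof -
    have "zpos (zsub (0, 0) (zdot (fst (As ! i)) (fst (As ! Suc i))))"
      using check that by (force simp: zcheck_def list_all_iff Let_def)
    then have "zr (zdot (fst (As ! i)) (fst (As ! Suc i))) < 0"
      using zpos_zr by (fastforce simp: zr_zsub)
    then show ?thesis using c_pos that by (simp add: inner_eq length_root mult_pos_neg)
  qed
  show "root i \<bullet> root j = 0" if "Suc i < j" "j < n" for i j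
  proof -
    have "zdot (fst (As ! i)) (fst (As ! j)) = (0, 0)"
      using check that by (force simp: zcheck_def list_all_iff Let_def)
    then show ?thesis using that by (simp add: inner_eq length_root)
  qed
  show "0 < zvec e v \<bullet> root 0"
  proof -
    have "0 < n" using dimension by (metis DIM_positive)
    then show ?thesis using check zpos_zr c_pos by (simp add: inner_eq lengths length_root zcheck_def)
  qed
  show "zvec e v \<bullet> root i = 0" if "0 < i" "i < n" for i
    using check that by (simp add: inner_eq lengths length_root zcheck_def list_all_iff)
  show "reflect (root i) x \<in> zvec e ` set L" if i: "i < n" and x: "x \<in> zvec e ` set L" for i x
  proof -
    obtain X where X: "X \<in> set L" "x = zvec e X" using x by blast
    show ?thesis unfolding X(2) zvec_reflect(1)[OF X(1) i, symmetric]
      by (rule imageI[OF zvec_reflect(2)[OF X(1) i]])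
  qed
  show "zvec e (Ws ! i) \<bullet> x \<le> zvec e (Ws ! i) \<bullet> zvec e v" if i: "i < n" and x: "x \<in> zvec e ` set L" for i x
  proof -
    obtain X where X: "X \<in> set L" "x = zvec e X" using x by blast
    let ?d = "zsub (zdot (Ws ! i) v) (zdot (Ws ! i) X)"
    have "?d = (0, 0) \<or> zpos ?d"
      using i lengths by (intro zcheck_vertex(5)[OF check X(1)]) simp
    then have "0 \<le> zr ?d" using zpos_zr[of ?d] by auto
    then show ?thesis using c_pos X i by (simp add: zr_zsub inner_eq lengths length_dual length_vertex)
  qed
  show "0 < zvec e (Ws ! i) \<bullet> zvec e v" if "i < n" for i
    using check that zpos_zr c_pos lengths by (simp add: inner_eq length_dual zcheck_def list_all_iff)
  show "x \<bullet> x = zvec e v \<bullet> zvec e v" if x: "x \<in> zvec e ` set L" for x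
  proof -
    obtain X where X: "X \<in> set L" "x = zvec e X" using x by blast
    then have "zdot X X = zdot v v" by (intro zcheck_vertex(2)[OF check])
    then show ?thesis unfolding X(2) by (simp only: inner_eq lengths length_vertex[OF X(1)])
  qed
qed

lemma zvec_coxeter_element:
  assumes "X \<in> set L"
  shows "word_map R [0..<n] (zvec e X) = zvec e (foldr zreflect As X)" "foldr zreflect As X \<in> set L"
proof -
  have *: "word_map R is (zvec e X) = zvec e (foldr zreflect (map (\<lambda>i. As ! i) is) X) \<and>
      foldr zreflect (map (\<lambda>i. As ! i) is) X \<in> set L" if "is \<in> lists {..<n}" for "is"
    using that
  proof (induction "is" rule: list.induct)
    case (Cons i js)
    then show ?case using zvec_reflect[of "foldr zreflect (map (\<lambda>i. As ! i) js) X" i] by simp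
  qed (use assms in simp)
  have "[0..<n] \<in> lists {..<n}" by (auto simp: in_lists_conv_set)
  moreover have "map (\<lambda>i. As ! i) [0..<n] = As" using lengths by (metis map_nth)
  ultimately show "word_map R [0..<n] (zvec e X) = zvec e (foldr zreflect As X)" "foldr zreflect As X \<in> set L"
    using *[of "[0..<n]"] by simp_all
qed

lemma no_return_power:
  assumes "no_return As Ws v k X" "X \<in> set L" "0 < j" "j \<le> k"
  shows "(word_map R [0..<n] ^^ j) (zvec e X) \<noteq> zvec e v"
  using assms
proof (induction k arbitrary: X j)
  case (Suc k)
  let ?Y = "foldr zreflect As X"
  have Y: "?Y \<in> set L" "word_map R [0..<n] (zvec e X) = zvec e ?Y"
    using zvec_coxeter_element[OF Suc.prems(2)] by simp_all
  show ?case
  proof (cases "j = 1")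
    case True
    obtain W where W: "W \<in> set Ws" "zpos (zsub (zdot W v) (zdot W ?Y))"
      using Suc.prems(1) by (auto simp: Let_def list_ex_iff)
    then obtain i where i: "i < n" "W = Ws ! i" using lengths by (metis in_set_conv_nth)
    have "zvec e W \<bullet> zvec e ?Y < zvec e W \<bullet> zvec e v"
      using zpos_zr[OF W(2)] c_pos i Y
      by (simp add: inner_eq lengths length_dual length_vertex zr_zsub)
    then show ?thesis using True Y by auto
  next
    case False
    then have "(word_map R [0..<n] ^^ (j - 1)) (zvec e ?Y) \<noteq> zvec e v"
      using Suc.prems Y(1) by (intro Suc.IH) (auto simp: Let_def)
    moreover have "(word_map R [0..<n] ^^ j) (zvec e X) = (word_map R [0..<n] ^^ (j - 1)) (zvec e ?Y)"
      using Suc.prems(3) Y(2) by (cases j) (simp_all add: funpow_Suc_right del: funpow.simps)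
    ultimately show ?thesis by simp
  qed
qed simp

lemma powers_ne_id:
  assumes "no_return As Ws v k v" "0 < j" "j \<le> k"
  shows "word_map R [0..<n] ^^ j \<noteq> id"
proof -
  from no_return_power[OF assms(1) v_in_L assms(2,3)] show ?thesis by auto
qed

lemma root_nonzero: "i < n \<Longrightarrow> root i \<noteq> 0"
  using root_pos[of i] by auto

lemma inner_root: "i < n \<Longrightarrow> j < n \<Longrightarrow> root i \<bullet> root j = c * zr (zdot (fst (As ! i)) (fst (As ! j)))"
  by (simp add: inner_eq length_root)

lemma norm_root:
  assumes "i < n"
  shows "root i \<bullet> root i = c * snd (As ! i)"
proof -
  have "As ! i \<in> set As" using assms lengths by simp
  then have "zdot (fst (As ! i)) (fst (As ! i)) = (snd (As ! i), 0)"
    using check unfolding zcheck_def list_all_iff by blast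
  then show ?thesis using assms by (simp add: inner_root)
qed

lemma zlabel_order:
  assumes "i < n" "j < n" "zlabel (As ! i) (As ! j) = Some l"
  shows "(R i \<circ> R j) ^^ l = id"
proof -
  note inner = inner_root[OF assms(1,2)] norm_root[OF assms(1)] norm_root[OF assms(2)]
  define p q where "p = fst (zdot (fst (As ! i)) (fst (As ! j)))" and "q = snd (zdot (fst (As ! i)) (fst (As ! j)))"
  consider "l = 3" "q = 0" "snd (As ! i) = - 2 * p" "snd (As ! j) = - 2 * p"
    | "l = 4" "q = 0" "snd (As ! i) = - p" "snd (As ! j) = - 2 * p"
    | "l = 5" "p = 0" "snd (As ! i) = - 2 * q" "snd (As ! j) = - 2 * q"
    using assms(3) by (auto simp: zlabel_def Let_def p_def q_def split: if_splits)
  then show ?thesis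
  proof cases
    case 1
    then show ?thesis unfolding 1(1)
      by (intro reflect_order_3 root_nonzero assms(1,2)) (simp_all add: inner zr_def flip: p_def q_def)
  next
    case 2
    then show ?thesis unfolding 2(1)
      by (intro reflect_order_4 root_nonzero assms(1,2)) (simp_all add: inner zr_def flip: p_def q_def)
  next
    case 3
    then show ?thesis unfolding 3(1)
      by (intro reflect_order_5 root_nonzero assms(1,2)) (simp_all add: inner zr_def flip: p_def q_def)
  qed
qed

lemma reflections_coxeter_rep:
  assumes near: "list_all (\<lambda>i. zlabel (As ! \<rho> i) (As ! \<rho> (Suc i)) = Some (l i)) [0..<n - 1]"
    and \<rho>: "\<And>i. i < n \<Longrightarrow> \<rho> i < n"
      "\<And>i j. Suc i < j \<Longrightarrow> j < n \<Longrightarrow> Suc (\<rho> i) < \<rho> j \<or> Suc (\<rho> j) < \<rho> i"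
  shows "coxeter_rep n (linear_coxeter_matrix l) (R \<circ> \<rho>)"
proof (rule coxeter_rep_linearI)
  show "(R \<circ> \<rho>) i \<circ> (R \<circ> \<rho>) i = id" for i
    by (simp add: fun_eq_iff reflect_reflect)
  show "((R \<circ> \<rho>) i \<circ> (R \<circ> \<rho>) (Suc i)) ^^ l i = id" if "Suc i < n" for i
    using zlabel_order[OF \<rho>(1)[of i] \<rho>(1)[OF that]] near that
    by (simp add: list_all_iff comp_apply[of R \<rho>] del: comp_apply)
  show "(R \<circ> \<rho>) i \<circ> (R \<circ> \<rho>) j = (R \<circ> \<rho>) j \<circ> (R \<circ> \<rho>) i" if "Suc i < j" "j < n" for i j
    unfolding comp_apply[of R \<rho>] using \<rho>(1)[of i] \<rho>(1)[of j] \<rho>(2)[OF that] that orth[of "\<rho> i" "\<rho> j"] orth[of "\<rho> j" "\<rho> i"]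
    by (intro reflect_commute) (auto simp: inner_commute)
qed

end

section \<open>Vertex sets as sign patterns\<close>

definition coordinate_basis :: "'n list \<Rightarrow> real \<Rightarrow> nat \<Rightarrow> real ^ 'n" where
  "coordinate_basis ix t i = axis (ix ! i) t"

lemma scaled_coordinate_basis:
  assumes "distinct ix" "0 < t"
  shows "scaled_basis (t * t) (length ix) (coordinate_basis ix t)"
  using assms by (auto simp: scaled_basis_def coordinate_basis_def inner_axis_axis nth_eq_iff_index_eq)

lemma coordinate_basis_Cons:
  "coordinate_basis (k # ks) t 0 = axis k t"
  "(\<lambda>i. coordinate_basis (k # ks) t (Suc i)) = coordinate_basis ks t"
  by (simp_all add: fun_eq_iff coordinate_basis_def)

lemma zvec_coordinate_outside:
  "l \<notin> set ix \<Longrightarrow> length xs = length ix \<Longrightarrow> zvec (coordinate_basis ix t) xs $ l = 0"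
proof (induction xs arbitrary: ix)
  case (Cons x xs)
  then obtain k ks where "ix = k # ks" by (cases ix) auto
  then show ?case using Cons by (simp add: coordinate_basis_Cons axis_def)
qed simp

lemma zvec_coordinate:
  assumes "distinct ix" "length xs = length ix" "j < length ix"
  shows "zvec (coordinate_basis ix t) xs $ (ix ! j) = t * zr (xs ! j)"
  using assms
proof (induction xs arbitrary: ix j)
  case (Cons x xs)
  then obtain k ks where ix: "ix = k # ks" by (cases ix) auto
  show ?case
  proof (cases j)
    case 0
    then show ?thesis using Cons.prems zvec_coordinate_outside[of k ks xs t]
      by (simp add: ix coordinate_basis_Cons axis_def)
  next
    case (Suc i)
    then have "ks ! i \<noteq> k" using Cons.prems by (auto simp: ix)
    then show ?thesis using Cons.prems Cons.IH[of ks i] Suc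
      by (simp add: ix coordinate_basis_Cons axis_def)
  qed
qed simp

text \<open>The signs of the nonzero coordinates vary independently, so membership amounts to
  prescribed absolute values.\<close>

lemma zvec_zsigns:
  assumes ix: "distinct ix" "set ix = UNIV" and cs: "length cs = length ix" and t: "0 < t"
  shows "x \<in> zvec (coordinate_basis ix t) ` set (zsigns cs) \<longleftrightarrow>
    (\<forall>j<length ix. \<bar>x $ (ix ! j)\<bar> = \<bar>t * zr (cs ! j)\<bar>)"
proof -
  have mem: "X \<in> set (zsigns cs) \<longleftrightarrow>
      length X = length cs \<and> (\<forall>j<length cs. X ! j = cs ! j \<or> X ! j = zsub (0, 0) (cs ! j))" for X
    by (auto simp: zmatch_def list_all2_conv_all_nth simp flip: zmatch_iff)
  have neg: "zr (zsub (0, 0) c) = - zr c" for c by (simp add: zr_zsub)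
  show ?thesis
  proof
    assume "x \<in> zvec (coordinate_basis ix t) ` set (zsigns cs)"
    then obtain X where X: "X \<in> set (zsigns cs)" "x = zvec (coordinate_basis ix t) X" by blast
    show "\<forall>j<length ix. \<bar>x $ (ix ! j)\<bar> = \<bar>t * zr (cs ! j)\<bar>"
    proof (intro allI impI)
      fix j assume j: "j < length ix"
      then have "zr (X ! j) = zr (cs ! j) \<or> zr (X ! j) = - zr (cs ! j)"
        using X(1) cs neg unfolding mem by metis
      then show "\<bar>x $ (ix ! j)\<bar> = \<bar>t * zr (cs ! j)\<bar>"
        using zvec_coordinate[OF ix(1), of X j t] X cs j by (auto simp: mem)
    qed
  next
    assume abs: "\<forall>j<length ix. \<bar>x $ (ix ! j)\<bar> = \<bar>t * zr (cs ! j)\<bar>"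
    define X where "X = map (\<lambda>j. if x $ (ix ! j) = t * zr (cs ! j) then cs ! j else zsub (0, 0) (cs ! j)) [0..<length ix]"
    have X: "X \<in> set (zsigns cs)" unfolding mem by (simp add: X_def cs)
    have "x $ (ix ! j) = zvec (coordinate_basis ix t) X $ (ix ! j)" if "j < length ix" for j
    proof -
      have "x $ (ix ! j) = t * zr (X ! j)"
        using abs[rule_format, OF that] that by (auto simp: X_def neg abs_eq_iff)
      then show ?thesis using zvec_coordinate[OF ix(1), of X j t] that by (simp add: X_def)
    qed
    then have "x = zvec (coordinate_basis ix t) X"
      unfolding vec_eq_iff using ix(2) by (metis UNIV_I in_set_conv_nth)
    then show "x \<in> zvec (coordinate_basis ix t) ` set (zsigns cs)" using X by blast
  qed
qed

lemma zvec_patterns: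
  assumes "distinct ix" "set ix = UNIV" "0 < t" "list_all (\<lambda>cs. length cs = length ix) ps"
  shows "x \<in> zvec (coordinate_basis ix t) ` set (concat (map zsigns ps)) \<longleftrightarrow>
    list_ex (\<lambda>cs. list_all (\<lambda>j. \<bar>x $ (ix ! j)\<bar> = \<bar>t * zr (cs ! j)\<bar>) [0..<length ix]) ps"
proof -
  have "x \<in> zvec (coordinate_basis ix t) ` set (concat (map zsigns ps)) \<longleftrightarrow>
      (\<exists>cs\<in>set ps. x \<in> zvec (coordinate_basis ix t) ` set (zsigns cs))"
    by auto
  also have "\<dots> \<longleftrightarrow> (\<exists>cs\<in>set ps. \<forall>j<length ix. \<bar>x $ (ix ! j)\<bar> = \<bar>t * zr (cs ! j)\<bar>)"
    using assms by (intro bex_cong HOL.refl zvec_zsigns) (auto simp: list_all_iff)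
  finally show ?thesis by (simp add: list_ex_iff list_all_iff atLeast0LessThan lessThan_def)
qed

lemma golden_ratio_inverse: "1 / (2 * golden_ratio) = (golden_ratio - 1) / 2"
  using golden_ratio_square golden_ratio_bounds by (simp add: field_simps)

abbreviation indices_3 :: "3 list" where "indices_3 \<equiv> [1, 2, 3]"
abbreviation indices_4 :: "4 list" where "indices_4 \<equiv> [1, 2, 3, 4]"

lemma indices_3: "distinct indices_3" "set indices_3 = UNIV"
  by (simp, simp only: list.set UNIV_3)

lemma indices_4: "distinct indices_4" "set indices_4 = UNIV"
  by (simp, simp only: list.set UNIV_4)

text \<open>
  Simple roots and multiples of the dual bases.  The coordinates of the 600-cell are doubled, and its
  roots are among its vertices; the roots of the icosahedron are vertices of an icosidodecahedron.
\<close>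

definition patterns_600 :: "zphi list list" where
  "patterns_600 =
     [[(2, 0), (0, 0), (0, 0), (0, 0)], [(0, 0), (2, 0), (0, 0), (0, 0)],
      [(0, 0), (0, 0), (2, 0), (0, 0)], [(0, 0), (0, 0), (0, 0), (2, 0)],
      [(1, 0), (1, 0), (1, 0), (1, 0)]] @
     map (map (\<lambda>k. [(0, 1), (1, 0), (-1, 1), (0, 0)] ! k))
       [[0,1,2,3], [0,2,3,1], [0,3,1,2], [1,0,3,2], [1,2,0,3], [1,3,2,0],
        [2,0,1,3], [2,1,3,0], [2,3,0,1], [3,0,2,1], [3,1,0,2], [3,2,1,0]]"

text \<open>The labels along the list are 3, 3, 5: only the last two roots have inner product -2
  phi. The vertex lies on every mirror but the first.\<close>

definition roots_600 :: "zroot list" where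
  "roots_600 =
     [([(-1, 1), (0, -1), (-1, 0), (0, 0)], 4), ([(0, 0), (0, 0), (2, 0), (0, 0)], 4),
      ([(0, 0), (-1, 1), (-1, 0), (0, -1)], 4), ([(0, 0), (0, 0), (0, 0), (2, 0)], 4)]"

definition dual_600 :: "zphi list list" where
  "dual_600 =
     [[(0, 1), (0, 0), (0, 0), (0, 0)], [(1, 3), (0, 1), (1, 0), (0, 0)],
      [(1, 2), (0, 1), (0, 0), (0, 0)], [(2, 3), (1, 1), (0, 0), (1, 0)]]"

definition vertex_600 :: "zphi list" where
  "vertex_600 = [(2, 0), (0, 0), (0, 0), (0, 0)]"

definition roots_icosahedron :: "zroot list" where
  "roots_icosahedron =
     [([(0, 0), (0, 0), (2, 0)], 4), ([(-1, 1), (0, -1), (-1, 0)], 4), ([(0, 0), (2, 0), (0, 0)], 4)]"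

definition dual_icosahedron :: "zphi list list" where
  "dual_icosahedron =
     [[(0, 1), (0, 0), (1, 0)], [(0, 1), (0, 0), (0, 0)], [(1, 1), (1, 0), (0, 0)]]"

definition vertex_icosahedron :: "zphi list" where
  "vertex_icosahedron = [(0, 1), (0, 0), (1, 0)]"

definition patterns_icosahedron :: "zphi list list" where
  "patterns_icosahedron = [[(0, 0), (1, 0), (0, 1)], [(0, 1), (0, 0), (1, 0)], [(1, 0), (0, 1), (0, 0)]]"

text \<open>The usual simple roots of F_4 with the short ones, e_4 and (1, -1, -1, -1)/2, doubled.
  The reflections stay the same, the coordinates become integral, and the first two roots become the
  shorter ones.\<close>

definition roots_24 :: "zroot list" where
  "roots_24 =
     [([(0, 0), (1, 0), (-1, 0), (0, 0)], 2), ([(0, 0), (0, 0), (1, 0), (-1, 0)], 2),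
      ([(0, 0), (0, 0), (0, 0), (2, 0)], 4), ([(1, 0), (-1, 0), (-1, 0), (-1, 0)], 4)]"

definition dual_24 :: "zphi list list" where
  "dual_24 =
     [[(1, 0), (1, 0), (0, 0), (0, 0)], [(2, 0), (1, 0), (1, 0), (0, 0)],
      [(3, 0), (1, 0), (1, 0), (1, 0)], [(1, 0), (0, 0), (0, 0), (0, 0)]]"

definition vertex_24 :: "zphi list" where
  "vertex_24 = [(1, 0), (1, 0), (0, 0), (0, 0)]"

definition patterns_24 :: "zphi list list" where
  "patterns_24 = map (map (\<lambda>k. (k, 0)))
     [[1, 1, 0, 0], [1, 0, 1, 0], [1, 0, 0, 1], [0, 1, 1, 0], [0, 1, 0, 1], [0, 0, 1, 1]]"

section \<open>The vertex sets of the three polytopes\<close>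

lemma icosahedron_vertices:
  "(\<Union>s\<in>{-1, 1}. \<Union>t\<in>{-1, 1}.
        {vector [0, s, t * golden_ratio], vector [t * golden_ratio, 0, s], vector [s, t * golden_ratio, 0]})
   = zvec (coordinate_basis indices_3 1) ` set (concat (map zsigns patterns_icosahedron))"
  (is "?A = ?B")
proof (rule Set.set_eqI)
  fix x :: "real^3"
  have g: "0 < golden_ratio" using golden_ratio_bounds by simp
  have "x \<in> ?A \<longleftrightarrow> (\<bar>x $ 1\<bar> = 0 \<and> \<bar>x $ 2\<bar> = 1 \<and> \<bar>x $ 3\<bar> = golden_ratio) \<or>
      (\<bar>x $ 1\<bar> = golden_ratio \<and> \<bar>x $ 2\<bar> = 0 \<and> \<bar>x $ 3\<bar> = 1) \<or>
      (\<bar>x $ 1\<bar> = 1 \<and> \<bar>x $ 2\<bar> = golden_ratio \<and> \<bar>x $ 3\<bar> = 0)"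
    using g by (auto simp: vec_eq_iff forall_3 vector_3 abs_if split: if_splits)
  also have "\<dots> \<longleftrightarrow> x \<in> ?B"
    by (subst zvec_patterns[OF indices_3]) (use g in \<open>auto simp: patterns_icosahedron_def zr_def upt_rec numeral_2_eq_2 numeral_3_eq_3\<close>)
  finally show "x \<in> ?A \<longleftrightarrow> x \<in> ?B" .
qed

lemma cell24_vertices:
  "{x. (\<forall>i. x $ i \<in> {-1, 0, 1}) \<and> card {i. x $ i \<noteq> 0} = 2}
   = zvec (coordinate_basis indices_4 1) ` set (concat (map zsigns patterns_24))"
  (is "?A = ?B")
proof (rule Set.set_eqI)
  fix x :: "real^4"
  have "card {i. x $ i \<noteq> 0} = (\<Sum>i\<in>UNIV. if x $ i \<noteq> 0 then 1 else 0)"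
    by (simp add: sum.If_cases)
  moreover have "x $ i \<in> {-1, 0, 1} \<longleftrightarrow> x $ i = 0 \<or> \<bar>x $ i\<bar> = 1" for i
    by (auto simp: abs_if split: if_splits)
  ultimately have "x \<in> ?A \<longleftrightarrow> (\<forall>i. x $ i = 0 \<or> \<bar>x $ i\<bar> = 1) \<and>
      (if x $ 1 \<noteq> 0 then 1 else 0) + (if x $ 2 \<noteq> 0 then 1 else 0) + (if x $ 3 \<noteq> 0 then 1 else 0)
        + (if x $ 4 \<noteq> 0 then 1 else 0) = (2 :: nat)"
    by (simp only: mem_Collect_eq sum_4)
  also have "\<dots> \<longleftrightarrow> x \<in> ?B"
    by (subst zvec_patterns[OF indices_4]) (auto simp: patterns_24_def forall_4 zr_def upt_rec numeral_2_eq_2 numeral_3_eq_3)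
  finally show "x \<in> ?A \<longleftrightarrow> x \<in> ?B" .
qed

abbreviation transp :: "4 \<Rightarrow> 4 \<Rightarrow> 4 \<Rightarrow> 4" where "transp \<equiv> Transposition.transpose"

text \<open>\<open>p\<close> is sorted by three transpositions; each nontrivial one flips the
  parity, and the nested equivalence counts them modulo 2.\<close>

lemma evenperm_4:
  fixes p :: "4 \<Rightarrow> 4"
  assumes p: "p permutes UNIV"
  defines "q \<equiv> transp 1 (p 1) \<circ> p"
  shows "evenperm p \<longleftrightarrow> (p 1 = 1) = ((q 2 = 2) = (transp 2 (q 2) (q 3) = 3))"
proof -
  define q' where "q' = transp 2 (q 2) \<circ> q"
  define q'' where "q'' = transp 3 (q' 3) \<circ> q'"
  have sw: "transp x y permutes UNIV" for x y :: 4
    by (rule permutes_swap_id) simp_all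
  have perm: "q permutes UNIV" "q' permutes UNIV" "q'' permutes UNIV"
    unfolding q''_def q'_def q_def by (intro permutes_compose p sw)+
  have q1: "q 1 = 1" by (simp add: q_def)
  then have "q 2 \<noteq> 1" using permutes_inj[OF perm(1)] by (auto dest: injD[of q 2 1])
  then have q'12: "q' 1 = 1" "q' 2 = 2"
    using q1 by (simp_all add: q'_def Transposition.transpose_def)
  have inj': "inj q'" by (rule permutes_inj[OF perm(2)])
  have "q' 3 \<noteq> 1" "q' 3 \<noteq> 2" using q'12 injD[OF inj', of 3 1] injD[OF inj', of 3 2] by auto
  then have q''123: "q'' 1 = 1" "q'' 2 = 2" "q'' 3 = 3"
    using q'12 by (simp_all add: q''_def Transposition.transpose_def)
  have inj'': "inj q''" by (rule permutes_inj[OF perm(3)])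
  have "q'' 4 = 4"
    using exhaust_4[of "q'' 4"] q''123 injD[OF inj'', of 4 1] injD[OF inj'', of 4 2] injD[OF inj'', of 4 3] by auto
  then have "q'' = id" using q''123 by (simp add: fun_eq_iff forall_4)
  have permutation: "permutation p" "permutation q" "permutation q'"
    using p perm by (auto intro: permutes_imp_permutation[of UNIV])
  have "evenperm q \<longleftrightarrow> ((1 = p 1) = evenperm p)"
    unfolding q_def by (simp add: evenperm_comp permutation evenperm_swap permutation_swap_id)
  moreover have "evenperm q' \<longleftrightarrow> ((2 = q 2) = evenperm q)"
    unfolding q'_def by (simp add: evenperm_comp permutation evenperm_swap permutation_swap_id)
  moreover have "evenperm q'' \<longleftrightarrow> ((3 = q' 3) = evenperm q')"
    unfolding q''_def by (simp add: evenperm_comp permutation evenperm_swap permutation_swap_id)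
  ultimately show ?thesis
    unfolding \<open>q'' = id\<close> by (auto simp: q'_def)
qed

text \<open>The order is that of the last twelve entries of \<open>patterns_600\<close>, so that the
  two disjunctions agree term by term.\<close>

definition even_tuples :: "4 list list" where
  "even_tuples =
     [[1,2,3,4], [1,3,4,2], [1,4,2,3], [2,1,4,3], [2,3,1,4], [2,4,3,1],
      [3,1,2,4], [3,2,4,1], [3,4,1,2], [4,1,3,2], [4,2,1,3], [4,3,2,1]]"

lemma even_permutations_4:
  "(\<exists>p. p permutes (UNIV :: 4 set) \<and> evenperm p \<and> Q (p 1) (p 2) (p 3) (p 4)) \<longleftrightarrow>
   list_ex (\<lambda>l. Q (l ! 0) (l ! 1) (l ! 2) (l ! 3)) even_tuples"
  (is "?A \<longleftrightarrow> ?B")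
proof
  assume ?A
  then obtain p where p: "p permutes (UNIV :: 4 set)" "evenperm p" "Q (p 1) (p 2) (p 3) (p 4)" by blast
  have inj: "inj p" by (rule permutes_inj[OF p(1)])
  have ne: "p 1 \<noteq> p 2" "p 1 \<noteq> p 3" "p 1 \<noteq> p 4" "p 2 \<noteq> p 3" "p 2 \<noteq> p 4" "p 3 \<noteq> p 4"
    using inj by (simp_all add: inj_eq)
  have ev: "(p 1 = 1) = ((transp 1 (p 1) (p 2) = 2) =
      (transp 2 (transp 1 (p 1) (p 2)) (transp 1 (p 1) (p 3)) = 3))"
    using evenperm_4[OF p(1)] p(2) by simp
  have "[p 1, p 2, p 3, p 4] \<in> set even_tuples"
    using exhaust_4[of "p 1"] exhaust_4[of "p 2"] exhaust_4[of "p 3"] exhaust_4[of "p 4"] ne ev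
    by (elim disjE) (simp_all add: even_tuples_def Transposition.transpose_def)
  then show ?B using p(3) by (force simp: list_ex_iff)
next
  assume ?B
  have sw: "transp a b permutes UNIV" for a b :: 4
    by (rule permutes_swap_id) simp_all
  have *: ?A if "Q (p 1) (p 2) (p 3) (p 4)" "p = transp a b \<circ> transp c d"
      "(a = b) = (c = d)" for a b c d p
  proof (intro exI conjI)
    show "p permutes UNIV" unfolding that(2) by (intro permutes_compose sw)
    show "evenperm p" unfolding that(2)
      using that(3) by (simp add: evenperm_comp evenperm_swap permutation_swap_id)
    show "Q (p 1) (p 2) (p 3) (p 4)" by (rule that(1))
  qed
  \<comment> \<open>Every even permutation of four points as a product of two transpositions; the
    identity uses the same one twice.\<close>
  let ?W = "[(1,2,1,2), (2,3,3,4), (2,3,2,4), (1,2,3,4), (1,2,2,3), (1,2,2,4),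
      (1,2,1,3), (1,3,3,4), (1,3,2,4), (1,2,1,4), (1,3,1,4), (1,4,2,3)] :: (4 \<times> 4 \<times> 4 \<times> 4) list"
  let ?f = "\<lambda>(a, b, c, d). map (transp a b \<circ> transp c d) indices_4"
  have eq: "even_tuples = map ?f ?W"
    by (simp add: even_tuples_def Transposition.transpose_def)
  obtain l where l: "l \<in> set even_tuples" and Q: "Q (l ! 0) (l ! 1) (l ! 2) (l ! 3)"
    using \<open>?B\<close> unfolding list_ex_iff by blast
  have "l \<in> ?f ` set ?W" using l unfolding eq set_map .
  then obtain t where t: "t \<in> set ?W" "l = ?f t" by (rule imageE)
  obtain a b c d where abcd: "t = (a, b, c, d)" by (cases t)
  have "(a = b) = (c = d)" using t(1) unfolding abcd by auto
  then show ?A using Q unfolding t(2) abcd by (intro *[OF _ HOL.refl, of a b c d]) simp_all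
qed

lemma cell600_vertices:
  "{s *\<^sub>R axis i 1 | s i. s \<in> {-1, 1}}
      \<union> {x. \<forall>i. x $ i \<in> {-1/2, 1/2}}
      \<union> {\<chi> i. s i * (vector [golden_ratio/2, 1/2, 1/(2 * golden_ratio), 0] :: real^4) $ p i | s p.
           (\<forall>i. s i \<in> {-1, 1}) \<and> p permutes UNIV \<and> evenperm p}
   = zvec (coordinate_basis indices_4 (1 / 2)) ` set (concat (map zsigns patterns_600))"
  (is "?A \<union> ?B \<union> ?C = ?D")
proof (rule Set.set_eqI)
  fix x :: "real^4"
  let ?g = "golden_ratio"
  let ?v = "vector [?g/2, 1/2, 1/(2 * ?g), 0] :: real^4"
  have g: "1 < ?g" using golden_ratio_bounds by simp
  have v: "?v $ 1 = ?g/2" "?v $ 2 = 1/2" "?v $ 3 = (?g - 1)/2" "?v $ 4 = 0"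
    using golden_ratio_inverse by (simp_all add: vector_def)
  have nonneg: "0 \<le> ?v $ i" for i using exhaust_4[of i] g v by auto
  have ex_4: "(\<exists>i. Q i) \<longleftrightarrow> Q 1 \<or> Q 2 \<or> Q 3 \<or> Q 4" for Q :: "4 \<Rightarrow> bool"
    by (metis exhaust_4)
  have "x \<in> ?A \<longleftrightarrow> (\<exists>i. \<bar>x $ i\<bar> = 1 \<and> (\<forall>j. j \<noteq> i \<longrightarrow> x $ j = 0))"
  proof
    assume "x \<in> ?A"
    then obtain s i where "x = s *\<^sub>R axis i 1" "s \<in> {-1, 1}" by blast
    then show "\<exists>i. \<bar>x $ i\<bar> = 1 \<and> (\<forall>j. j \<noteq> i \<longrightarrow> x $ j = 0)"
      by (intro exI[of _ i]) (auto simp: axis_def)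
  next
    assume "\<exists>i. \<bar>x $ i\<bar> = 1 \<and> (\<forall>j. j \<noteq> i \<longrightarrow> x $ j = 0)"
    then obtain i where i: "\<bar>x $ i\<bar> = 1" "\<forall>j. j \<noteq> i \<longrightarrow> x $ j = 0" by blast
    have "x = x $ i *\<^sub>R axis i 1"
      unfolding vec_eq_iff using i(2) by (simp add: axis_def)
    moreover have "x $ i \<in> {-1, 1}" using i(1) by (auto simp: abs_if split: if_splits)
    ultimately show "x \<in> ?A" by blast
  qed
  then have A: "x \<in> ?A \<longleftrightarrow>
      (\<bar>x $ 1\<bar> = 1 \<and> x $ 2 = 0 \<and> x $ 3 = 0 \<and> x $ 4 = 0) \<or> (x $ 1 = 0 \<and> \<bar>x $ 2\<bar> = 1 \<and> x $ 3 = 0 \<and> x $ 4 = 0) \<or>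
      (x $ 1 = 0 \<and> x $ 2 = 0 \<and> \<bar>x $ 3\<bar> = 1 \<and> x $ 4 = 0) \<or> (x $ 1 = 0 \<and> x $ 2 = 0 \<and> x $ 3 = 0 \<and> \<bar>x $ 4\<bar> = 1)"
    unfolding ex_4 forall_4 by auto
  have B: "x \<in> ?B \<longleftrightarrow> \<bar>x $ 1\<bar> = 1/2 \<and> \<bar>x $ 2\<bar> = 1/2 \<and> \<bar>x $ 3\<bar> = 1/2 \<and> \<bar>x $ 4\<bar> = 1/2"
    by (auto simp: forall_4 abs_if split: if_splits)
  \<comment> \<open>As \<open>?v\<close> is nonnegative, the free signs amount to prescribing the
    absolute values; at a zero coordinate either sign will do.\<close>
  have "x \<in> ?C \<longleftrightarrow> (\<exists>p. p permutes UNIV \<and> evenperm p \<and> (\<forall>i. \<bar>x $ i\<bar> = ?v $ p i))"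
  proof
    assume "x \<in> ?C"
    then obtain s p where sp: "x = (\<chi> i. s i * ?v $ p i)" "\<forall>i. s i \<in> {-1, 1}" "p permutes UNIV" "evenperm p"
      by blast
    have "\<bar>x $ i\<bar> = ?v $ p i" for i
      using sp(2)[rule_format, of i] nonneg[of "p i"] by (auto simp: sp(1) abs_mult)
    then show "\<exists>p. p permutes UNIV \<and> evenperm p \<and> (\<forall>i. \<bar>x $ i\<bar> = ?v $ p i)" using sp by blast
  next
    assume "\<exists>p. p permutes UNIV \<and> evenperm p \<and> (\<forall>i. \<bar>x $ i\<bar> = ?v $ p i)"
    then obtain p where p: "p permutes UNIV" "evenperm p" "\<forall>i. \<bar>x $ i\<bar> = ?v $ p i" by blast
    define s :: "4 \<Rightarrow> real" where "s i = (if x $ i < 0 then - 1 else 1)" for i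
    have "x $ i = s i * ?v $ p i" for i
      unfolding p(3)[rule_format, of i, symmetric] by (simp add: s_def)
    then have "x = (\<chi> i. s i * ?v $ p i)" by (simp add: vec_eq_iff)
    moreover have "\<forall>i. s i \<in> {-1, 1}" by (simp add: s_def)
    ultimately show "x \<in> ?C" using p by blast
  qed
  also have "\<dots> \<longleftrightarrow> list_ex (\<lambda>l. \<bar>x $ 1\<bar> = ?v $ (l ! 0) \<and> \<bar>x $ 2\<bar> = ?v $ (l ! 1)
      \<and> \<bar>x $ 3\<bar> = ?v $ (l ! 2) \<and> \<bar>x $ 4\<bar> = ?v $ (l ! 3)) even_tuples"
    unfolding forall_4 by (rule even_permutations_4)
  finally have C: "x \<in> ?C \<longleftrightarrow> list_ex (\<lambda>l. \<bar>x $ 1\<bar> = ?v $ (l ! 0) \<and> \<bar>x $ 2\<bar> = ?v $ (l ! 1)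
      \<and> \<bar>x $ 3\<bar> = ?v $ (l ! 2) \<and> \<bar>x $ 4\<bar> = ?v $ (l ! 3)) even_tuples" .
  have z: "zr (0, 1) = ?g" "zr (- 1, 1) = ?g - 1" by (simp_all add: zr_def)
  have up: "[0..<length indices_4] = [0, 1, 2, 3]" by (simp add: upt_rec)
  have D: "x \<in> ?D \<longleftrightarrow> list_ex (\<lambda>cs. list_all (\<lambda>j. \<bar>x $ (indices_4 ! j)\<bar> = \<bar>1 / 2 * zr (cs ! j)\<bar>)
      [0..<length indices_4]) patterns_600"
    by (rule zvec_patterns[OF indices_4]) (simp_all add: patterns_600_def)
  have abs: "\<bar>?g\<bar> = ?g" "\<bar>?g - 1\<bar> = ?g - 1" using g by simp_all
  show "x \<in> ?A \<union> ?B \<union> ?C \<longleftrightarrow> x \<in> ?D"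
    unfolding Un_iff A B C D up
    by (simp add: patterns_600_def even_tuples_def v z abs disj_assoc)
qed

text \<open>In \<open>matrix_H\<close> the label 5 comes first, whereas the roots of the icosahedron
  and the 600-cell, numbered by rank, have it last.\<close>

definition reverse_nodes :: "nat \<Rightarrow> nat \<Rightarrow> nat" where
  "reverse_nodes n i = (if i < n then n - Suc i else i)"

lemma reverse_nodes_permutes: "reverse_nodes n permutes {..<n}"
  by (rule bij_imp_permutes[OF bij_betwI[where g = "reverse_nodes n"]]) (auto simp: reverse_nodes_def)

section \<open>Certificates and conclusions for the three polytopes\<close>

lemma check_600: "zcheck 4 roots_600 dual_600 vertex_600 patterns_600"
  by code_simp

lemma no_return_600: "no_return roots_600 dual_600 vertex_600 29 vertex_600"
  by code_simp

lemma check_icosahedron: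
  "zcheck 3 roots_icosahedron dual_icosahedron vertex_icosahedron patterns_icosahedron"
  by code_simp

lemma no_return_icosahedron:
  "no_return roots_icosahedron dual_icosahedron vertex_icosahedron 9 vertex_icosahedron"
  by code_simp

lemma check_24: "zcheck 4 roots_24 dual_24 vertex_24 patterns_24"
  by code_simp

lemma no_return_24: "no_return roots_24 dual_24 vertex_24 11 vertex_24"
  by code_simp

lemma scaled_basis_3: "0 < t \<Longrightarrow> scaled_basis (t * t) 3 (coordinate_basis indices_3 t)"
  using scaled_coordinate_basis[OF indices_3(1), of t] by (simp add: numeral_3_eq_3)

lemma scaled_basis_4: "0 < t \<Longrightarrow> scaled_basis (t * t) 4 (coordinate_basis indices_4 t)"
  using scaled_coordinate_basis[OF indices_4(1), of t] by (simp add: eval_nat_numeral)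

interpretation cell24: zphi_wythoff 4 roots_24 dual_24 vertex_24 patterns_24 "1 * 1" "coordinate_basis indices_4 1"
  by unfold_locales (rule check_24, simp, rule scaled_basis_4, simp)

interpretation icosahedron: zphi_wythoff 3 roots_icosahedron dual_icosahedron vertex_icosahedron
    patterns_icosahedron "1 * 1" "coordinate_basis indices_3 1"
  by unfold_locales (rule check_icosahedron, simp, rule scaled_basis_3, simp)

text \<open>The scale 1/2 undoes the doubling of the coordinates; its square is the squared length
  of the basis vectors.\<close>

interpretation cell600: zphi_wythoff 4 roots_600 dual_600 vertex_600 patterns_600 "1 / 2 * (1 / 2)"
    "coordinate_basis indices_4 (1 / 2)"
  by unfold_locales (rule check_600, simp, rule scaled_basis_4, simp)

lemma cell24_eq: "cell24 = cell24.face 4"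
  unfolding cell24_def cell24_vertices cell24.face_def cell24.level_n ..

lemma icosahedron_eq: "icosahedron = icosahedron.face 3"
  unfolding icosahedron_def icosahedron_vertices icosahedron.face_def icosahedron.level_n ..

lemma cell600_eq: "cell600 = cell600.face 4"
  unfolding cell600_def cell600_vertices cell600.face_def cell600.level_n ..

lemma cell24_coxeter_rep: "coxeter_rep 4 matrix_F (cell24.R \<circ> id)"
  unfolding matrix_F_def
proof (rule cell24.reflections_coxeter_rep)
  show "list_all (\<lambda>i. zlabel (roots_24 ! id i) (roots_24 ! id (Suc i)) = Some (if i = 1 then 4 else 3)) [0..<4 - 1]"
    by code_simp
qed auto

lemma icosahedron_coxeter_rep: "coxeter_rep 3 matrix_H (icosahedron.R \<circ> reverse_nodes 3)"
  unfolding matrix_H_def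
proof (rule icosahedron.reflections_coxeter_rep)
  show "list_all (\<lambda>i. zlabel (roots_icosahedron ! reverse_nodes 3 i) (roots_icosahedron ! reverse_nodes 3 (Suc i))
      = Some (if i = 0 then 5 else 3)) [0..<3 - 1]"
    by code_simp
qed (auto simp: reverse_nodes_def)

lemma cell600_coxeter_rep: "coxeter_rep 4 matrix_H (cell600.R \<circ> reverse_nodes 4)"
  unfolding matrix_H_def
proof (rule cell600.reflections_coxeter_rep)
  show "list_all (\<lambda>i. zlabel (roots_600 ! reverse_nodes 4 i) (roots_600 ! reverse_nodes 4 (Suc i))
      = Some (if i = 0 then 5 else 3)) [0..<4 - 1]"
    by code_simp
qed (auto simp: reverse_nodes_def)

lemma cell24_powers_ne_id: "0 < k \<Longrightarrow> k < 12 \<Longrightarrow> word_map cell24.R [0..<4] ^^ k \<noteq> id"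
  by (rule cell24.powers_ne_id[OF no_return_24]) simp_all

lemma icosahedron_powers_ne_id: "0 < k \<Longrightarrow> k < 10 \<Longrightarrow> word_map icosahedron.R [0..<3] ^^ k \<noteq> id"
  by (rule icosahedron.powers_ne_id[OF no_return_icosahedron]) simp_all

lemma cell600_powers_ne_id: "0 < k \<Longrightarrow> k < 30 \<Longrightarrow> word_map cell600.R [0..<4] ^^ k \<noteq> id"
  by (rule cell600.powers_ne_id[OF no_return_600]) simp_all

lemmas cell24_zigzag =
  cell24.zigzag_length_eq_coxeter_number[OF zero_less_numeral coxeter_power_F4[unfolded matrix_F_def]
    cell24_coxeter_rep[unfolded matrix_F_def] permutes_id cell24_powers_ne_id, folded matrix_F_def cell24_eq]

lemmas icosahedron_zigzag =
  icosahedron.zigzag_length_eq_coxeter_number[OF zero_less_numeral coxeter_power_H3[unfolded matrix_H_def]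
    icosahedron_coxeter_rep[unfolded matrix_H_def] reverse_nodes_permutes icosahedron_powers_ne_id,
    folded matrix_H_def icosahedron_eq]

lemmas cell600_zigzag =
  cell600.zigzag_length_eq_coxeter_number[OF zero_less_numeral coxeter_power_H4[unfolded matrix_H_def]
    cell600_coxeter_rep[unfolded matrix_H_def] reverse_nodes_permutes cell600_powers_ne_id,
    folded matrix_H_def cell600_eq]

theorem corollary2:
  shows
    "(\<forall>n\<ge>1.
        (\<forall>\<delta> F. \<delta> permutes {..<n} \<longrightarrow> F \<in> flags n (simplex_faces n) \<longrightarrow>
           zigzag_length n (simplex_faces n) \<delta> F = coxeter_number n matrix_A) \<and>
        coxeter_number n matrix_A = n + 1) \<and>
     (\<forall>n\<ge>1.
        (\<forall>\<delta> F. \<delta> permutes {..<n} \<longrightarrow> F \<in> flags n (cross_polytope_faces n) \<longrightarrow>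
           zigzag_length n (cross_polytope_faces n) \<delta> F = coxeter_number n (matrix_B n)) \<and>
        coxeter_number n (matrix_B n) = 2 * n) \<and>
     (\<forall>\<delta> F. \<delta> permutes {..<4} \<longrightarrow> F \<in> flags 4 (convex_polytope_faces cell24) \<longrightarrow>
        zigzag_length 4 (convex_polytope_faces cell24) \<delta> F = coxeter_number 4 matrix_F) \<and>
     coxeter_number 4 matrix_F = 12 \<and>
     (\<forall>\<delta> F. \<delta> permutes {..<3} \<longrightarrow> F \<in> flags 3 (convex_polytope_faces icosahedron) \<longrightarrow>
        zigzag_length 3 (convex_polytope_faces icosahedron) \<delta> F = coxeter_number 3 matrix_H) \<and>
     coxeter_number 3 matrix_H = 10 \<and>
     (\<forall>\<delta> F. \<delta> permutes {..<4} \<longrightarrow> F \<in> flags 4 (convex_polytope_faces cell600) \<longrightarrow>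
        zigzag_length 4 (convex_polytope_faces cell600) \<delta> F = coxeter_number 4 matrix_H) \<and>
     coxeter_number 4 matrix_H = 30"
  by (intro conjI allI impI)
    (simp_all add: simplex_zigzag cross_zigzag cell24_zigzag icosahedron_zigzag cell600_zigzag)

end
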